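(* There exist real numbers $\delta,s_0,T,\epsilon$ with $s_0,T>0$, $$0<\delta<s_0^2<T^2<1,\qquad \epsilon>0,$$ and distinct maximal test curves $(\psi_\tau)_{\tau\in\mathbb{R}}$ and $(\theta_\tau)_{\tau\in\mathbb{R}}$ on $(\mathbb{CP}^1,\omega_{\mathrm{FS}})$ whose zero-contact sets agree for every parameter, i.e. $\{\psi_\tau=0\}=\{\theta_\tau=0\}$ as subsets of $\mathbb{CP}^1$ for every $\tau\in\mathbb{R}$. More precisely, $$\psi_\tau=\theta_\tau=0\quad(\tau\le0),\qquad \psi_\tau=b_{\tau^2}\quad(0<\tau\le T),\qquad \psi_\tau=\theta_\tau=-\infty\quad(\tau>T),$$ and $$\theta_\tau=b_{\tau^2}\quad(0<\tau\le s_0).$$ For $s_0<\tau\le T$, the function $\theta_\tau$ is a normalized positive-mass $\omega_{\mathrm{FS}}$-model potential satisfying $$\{\theta_\tau=0\}=\{b_{\tau^2}=0\}=C_{\tau^2}.$$ For every $x\in\mathbb{CP}^1$, both functions $\tau\mapsto\psi_\tau(x)$ and $\tau\mapsto\theta_\tau(x)$ are upper semicontinuous, concave, and decreasing. The two curves are distinct at every $\tau\in(s_0,T]$, i.e. $\psi_\tau\ne\theta_\tau$ for every $\tau\in(s_0,T]$.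
   Context: On the affine chart $\mathbb{C}\subset\mathbb{CP}^1$ with coordinate $w$, $\omega_{\mathrm{FS}}=dd^c\left(\tfrac12\log(1+|w|^2)\right)$, where $dd^c$ is normalized so that $dd^c\log|w-p|=\delta_p$; thus $\int_{\mathbb{CP}^1}\omega_{\mathrm{FS}}=1$. $\mathrm{PSH}(X,\omega)$ is the set of $\omega$-plurisubharmonic functions on $X$ (not identically $-\infty$). Model potentials: let $(X,\omega)$ be a compact Kähler manifold. For an upper-semicontinuous $f$ set $P_\omega(f)=\left(\sup\{v\in\mathrm{PSH}(X,\omega): v\le f\}\right)^*$, where $^*$ denotes upper-semicontinuous regularization. For $\phi\in\mathrm{PSH}(X,\omega)$ with $\sup_X\phi=0$ (such $\phi$ is called normalized) set $P_\omega[\phi]=\left(\lim_{C\to\infty}P_\omega(\min\{\phi+C,0\})\right)^*$. The function $\phi$ is an $\omega$-model potential if $P_\omega[\phi]=\phi$. It has positive mass if its non-pluripolar Monge--Ampère measure has strictly positive total mass. In complex dimension one that measure is $\langle\omega+dd^cu\rangle=\mathbf{1}_{\{u>-\infty\}}(\omega+dd^cu)$. Test curves: a test curve is a family $(\psi_\tau)_{\tau\in\mathbb{R}}$ with $\psi_\tau\in\mathrm{PSH}(X,\omega)\cup\{-\infty\}$ such that for every $x\in X$ the function $\tau\mapsto\psi_\tau(x)$ (with values in $[-\infty,\infty)$) is upper semicontinuous, concave and decreasing (non-increasing), while $\psi_\tau=0$ for all sufficiently negative $\tau$ and $\psi_\tau\equiv-\infty$ for all sufficiently positive $\tau$. It is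 maximal if every slice $\psi_\tau\not\equiv-\infty$ is a normalized model potential, i.e. $P_\omega[\psi_\tau]=\psi_\tau$. Cap potentials: for $0<\rho<1$, $C_\rho=\{w\in\mathbb{C}: |w|^2\le(1-\rho)/\rho\}$, and $b_\rho\in\mathrm{PSH}(\mathbb{CP}^1,\omega_{\mathrm{FS}})$ is the function with $b_\rho(w)=0$ for $|w|^2\le(1-\rho)/\rho$, $$b_\rho(w)=\tfrac12\left(-\log(1+|w|^2)+(1-\rho)\log|w|^2-\rho\log\rho-(1-\rho)\log(1-\rho)\right)\quad\text{for }|w|^2\ge(1-\rho)/\rho,$$ and $b_\rho(\infty)=-\infty$. *)

theory Defs
  imports "HOL-Analysis.Analysis"
begin

section \<open>Semicontinuity and subharmonic functions\<close>

definition usc :: "'a topology \<Rightarrow> ('a \<Rightarrow> ereal) \<Rightarrow> bool" where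
  "usc X f \<longleftrightarrow> (\<forall>c. openin X {x \<in> topspace X. f x < c})"

text \<open>The filter \<^term>\<open>nhdsin X x\<close> contains the point itself, so this is the
  smallest upper semicontinuous majorant of \<^term>\<open>f\<close>.\<close>

definition usc_reg :: "'a topology \<Rightarrow> ('a \<Rightarrow> ereal) \<Rightarrow> 'a \<Rightarrow> ereal" where
  "usc_reg X f x = Limsup (nhdsin X x) f"

text \<open>Mean value over the circle of radius \<open>r\<close> about \<open>a\<close>, as the integral of the positive part
  minus the integral of the negative part (\<^term>\<open>e2ennreal\<close> sends negative values to 0).
  The positive part has finite integral whenever the function is upper semicontinuous
  and \<open>< \<infinity>\<close>.\<close>

definition circle_mean :: "(complex \<Rightarrow> ereal) \<Rightarrow> complex \<Rightarrow> real \<Rightarrow> ereal" where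
  "circle_mean f a r =
     (enn2ereal (\<integral>\<^sup>+t\<in>{0..2*pi}. e2ennreal (f (a + of_real r * cis t)) \<partial>lborel)
      - enn2ereal (\<integral>\<^sup>+t\<in>{0..2*pi}. e2ennreal (- f (a + of_real r * cis t)) \<partial>lborel))
     / ereal (2 * pi)"

text \<open>Subharmonic functions on the whole plane; the constant \<open>-\<infinity>\<close> is allowed here.\<close>

definition subharmonic :: "(complex \<Rightarrow> ereal) \<Rightarrow> bool" where
  "subharmonic f \<longleftrightarrow> usc euclidean f \<and> (\<forall>z. f z < \<infinity>) \<and>
     (\<forall>a r. 0 < r \<longrightarrow> f a \<le> circle_mean f a r)"

section \<open>The projective line with the Fubini-Study form\<close>

type_synonym cp1 = "complex option"

text \<open>\<^term>\<open>Some w\<close> is the point with affine coordinate \<open>w\<close>, and \<^term>\<open>None\<close> is the point at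
  infinity.\<close>

definition cp1_top :: "cp1 topology" where
  "cp1_top = Alexandroff_compactification euclidean"

definition chart_inf :: "complex \<Rightarrow> cp1" where
  "chart_inf z = (if z = 0 then None else Some (1 / z))"

definition charts :: "(complex \<Rightarrow> cp1) set" where
  "charts = {Some, chart_inf}"

text \<open>The topology is the one glued from the two holomorphic charts.\<close>

lemma topspace_cp1_top [simp]: "topspace cp1_top = UNIV"
  by (auto simp: cp1_top_def UNIV_option_conv)

lemma continuous_map_chart_inf: "continuous_map euclidean cp1_top chart_inf"
  unfolding continuous_map
proof (intro conjI allI impI)
  fix U assume U: "openin cp1_top U"
  show "openin euclidean {x \<in> topspace euclidean. chart_inf x \<in> U}"
    using U unfolding cp1_top_def openin_Alexandroff_compactification
  proof (elim disjE exE conjE)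
    fix V :: "complex set" assume V: "openin euclidean V" "U = Some ` V"
    have "{x. chart_inf x \<in> U} = (- {0}) \<inter> (\<lambda>z. 1 / z) -` V"
      using V by (auto simp: chart_inf_def image_iff split: if_splits)
    moreover have "open \<dots>"
      using V by (intro continuous_open_preimage) (auto intro!: continuous_intros)
    ultimately show ?thesis by simp
  next
    fix C :: "complex set"
    assume C: "compactin euclidean C" and U': "U = insert None (Some ` (topspace euclidean - C))"
    let ?D = "(\<lambda>z. 1 / z) ` (C - {0})"
    have eq: "{x. chart_inf x \<in> U} = - ?D"
    proof (intro set_eqI)
      fix z :: complex
      have "1 / z \<in> C \<longleftrightarrow> z \<in> ?D" if "z \<noteq> 0"
        using that by (auto intro!: image_eqI[of z _ "1 / z"])
      moreover have "0 \<notin> ?D" by auto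
      ultimately show "z \<in> {x. chart_inf x \<in> U} \<longleftrightarrow> z \<in> - ?D"
        unfolding U' by (cases "z = 0") (auto simp: chart_inf_def)
    qed
    have "closed ?D"
      unfolding closed_sequential_limits
    proof (intro allI impI, elim conjE)
      fix f l assume f: "\<forall>n. f n \<in> ?D" and l: "f \<longlonglongrightarrow> l"
      have "bounded C" using C compact_imp_bounded by auto
      then obtain B where B: "B > 0" "\<forall>z\<in>C. norm z \<le> B" by (auto simp: bounded_pos)
      have fC: "1 / f n \<in> C \<and> f n \<noteq> 0" for n
        using f[rule_format, of n] by auto
      have "norm (f n) \<ge> 1 / B" for n
        using B fC[of n] by (auto simp: norm_divide field_simps)
      then have "norm l \<ge> 1 / B"
        by (intro LIMSEQ_le_const[OF tendsto_norm[OF l]]) auto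
      then have l0: "l \<noteq> 0" using B by auto
      then have "(\<lambda>n. 1 / f n) \<longlonglongrightarrow> 1 / l" using l by (intro tendsto_intros)
      moreover have "closed C" using C compact_imp_closed by auto
      ultimately have "1 / l \<in> C" using fC closed_sequentially[of C "\<lambda>n. 1 / f n"] by auto
      then show "l \<in> ?D" using l0 by (intro image_eqI[of _ _ "1 / l"]) auto
    qed
    then show ?thesis by (simp add: eq open_Compl)
  qed
qed auto

lemma openin_cp1_top_iff:
  "openin cp1_top U \<longleftrightarrow> (\<forall>\<kappa>\<in>charts. open (\<kappa> -` U))"
proof
  assume U: "openin cp1_top U"
  have "continuous_map euclidean cp1_top (Some :: complex \<Rightarrow> cp1)"
    unfolding cp1_top_def by (rule continuous_map_Some)
  then have "open (Some -` U)"
    using U by (fastforce simp: continuous_map vimage_def)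
  moreover have "open (chart_inf -` U)"
    using U continuous_map_chart_inf by (fastforce simp: continuous_map vimage_def)
  ultimately show "\<forall>\<kappa>\<in>charts. open (\<kappa> -` U)" by (simp add: charts_def)
next
  assume "\<forall>\<kappa>\<in>charts. open (\<kappa> -` U)"
  then have o: "open (Some -` U)" and oi: "open (chart_inf -` U)" by (auto simp: charts_def)
  show "openin cp1_top U"
  proof (cases "None \<in> U")
    case False
    have "U = Some ` (Some -` U)"
    proof (intro set_eqI)
      fix x show "x \<in> U \<longleftrightarrow> x \<in> Some ` (Some -` U)"
        using False by (cases x) auto
    qed
    then show ?thesis using o
      by (auto simp: cp1_top_def openin_Alexandroff_compactification)
  next
    case True
    define C where "C = - (Some -` U)"
    have "0 \<in> chart_inf -` U" using True by (simp add: chart_inf_def)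
    then obtain e where e: "e > 0" "ball 0 e \<subseteq> chart_inf -` U"
      using oi openE by blast
    have "norm w \<le> 1 / e" if "w \<in> C" for w
    proof (rule ccontr)
      assume "\<not> norm w \<le> 1 / e"
      then have w: "norm w > 1 / e" by simp
      then have "w \<noteq> 0" using e by (auto simp: field_simps)
      then have "1 / w \<in> ball 0 e" using e w by (auto simp: norm_divide field_simps)
      then have "chart_inf (1 / w) \<in> U" using e by auto
      then show False using that \<open>w \<noteq> 0\<close> by (simp add: chart_inf_def C_def)
    qed
    then have "bounded C" by (auto simp: bounded_iff)
    moreover have cC: "closed C" using o by (simp add: C_def closed_Compl)
    ultimately have "compact C" by (simp add: compact_eq_bounded_closed)
    moreover have "U = insert None (Some ` (topspace euclidean - C))"
    proof (intro set_eqI)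
      fix x show "x \<in> U \<longleftrightarrow> x \<in> insert None (Some ` (topspace euclidean - C))"
        using True by (cases x) (auto simp: C_def image_iff)
    qed
    ultimately show ?thesis using cC
      by (auto simp: cp1_top_def openin_Alexandroff_compactification)
  qed
qed

text \<open>The local expression \<open>u + 1/2 log (1 + |z|^2)\<close> in a chart. The same potential of the
  Fubini-Study form serves in both charts, because \<open>log |w|\<close> is harmonic away from 0.\<close>

definition local_pot :: "(cp1 \<Rightarrow> ereal) \<Rightarrow> (complex \<Rightarrow> cp1) \<Rightarrow> complex \<Rightarrow> ereal" where
  "local_pot u \<kappa> z = u (\<kappa> z) + ereal (1/2 * ln (1 + (cmod z)\<^sup>2))"

definition PSH :: "(cp1 \<Rightarrow> ereal) set" where
  "PSH = {u. usc cp1_top u \<and> (\<forall>x. u x < \<infinity>) \<and> u \<noteq> (\<lambda>_. -\<infinity>) \<and>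
             (\<forall>\<kappa>\<in>charts. subharmonic (local_pot u \<kappa>))}"

section \<open>Envelopes and model potentials\<close>

definition P_env :: "(cp1 \<Rightarrow> ereal) \<Rightarrow> cp1 \<Rightarrow> ereal" where
  "P_env f = usc_reg cp1_top (\<lambda>x. SUP v \<in> {v \<in> PSH. v \<le> f}. v x)"

definition P_model :: "(cp1 \<Rightarrow> ereal) \<Rightarrow> cp1 \<Rightarrow> ereal" where
  "P_model \<phi> = usc_reg cp1_top
     (\<lambda>x. Lim at_top (\<lambda>C::real. P_env (\<lambda>y. min (\<phi> y + ereal C) 0) x))"

definition normalized :: "(cp1 \<Rightarrow> ereal) \<Rightarrow> bool" where
  "normalized \<phi> \<longleftrightarrow> \<phi> \<in> PSH \<and> (SUP x. \<phi> x) = 0"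

definition model_potential :: "(cp1 \<Rightarrow> ereal) \<Rightarrow> bool" where
  "model_potential \<phi> \<longleftrightarrow> normalized \<phi> \<and> P_model \<phi> = \<phi>"

section \<open>Non-pluripolar mass\<close>

definition dir_deriv :: "complex \<Rightarrow> (complex \<Rightarrow> real) \<Rightarrow> complex \<Rightarrow> real" where
  "dir_deriv v f z = frechet_derivative f (at z) v"

definition test_function :: "(complex \<Rightarrow> real) \<Rightarrow> bool" where
  "test_function f \<longleftrightarrow>
     (\<forall>vs. foldr dir_deriv vs f differentiable_on UNIV) \<and> compact (closure {z. f z \<noteq> 0})"

definition laplacian :: "(complex \<Rightarrow> real) \<Rightarrow> complex \<Rightarrow> real" where
  "laplacian f z = dir_deriv 1 (dir_deriv 1 f) z + dir_deriv \<i> (dir_deriv \<i> f) z"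

definition ext_zero :: "(complex \<Rightarrow> cp1) \<Rightarrow> (complex \<Rightarrow> real) \<Rightarrow> cp1 \<Rightarrow> real" where
  "ext_zero \<kappa> f x = (if x \<in> range \<kappa> then f (inv \<kappa> x) else 0)"

text \<open>\<open>\<mu>\<close> is the Borel measure \<open>\<omega> + dd^c u\<close>. In each chart this current is \<open>dd^c\<close> of the local
  expression of \<open>u\<close>, in the sense of distributions; the normalization \<open>dd^c log |w - p| = \<delta>_p\<close>
  makes \<open>dd^c\<close> equal to \<open>1/(2 pi)\<close> times the Laplacian. For \<open>u\<close> in \<^term>\<open>PSH\<close> there is exactly
  one such \<open>\<mu>\<close>, and the set \<open>u = -\<infinity>\<close>, where \<^term>\<open>real_of_ereal\<close> gives the value 0, has Lebesgue
  measure zero.\<close>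

definition curvature_measure :: "(cp1 \<Rightarrow> ereal) \<Rightarrow> cp1 measure \<Rightarrow> bool" where
  "curvature_measure u \<mu> \<longleftrightarrow>
     finite_measure \<mu> \<and> space \<mu> = UNIV \<and> sets \<mu> = sigma_sets UNIV {U. openin cp1_top U} \<and>
     (\<forall>\<kappa>\<in>charts. \<forall>f. test_function f \<longrightarrow>
        (\<integral>x. ext_zero \<kappa> f x \<partial>\<mu>) =
        1 / (2 * pi) * (\<integral>z. real_of_ereal (local_pot u \<kappa> z) * laplacian f z \<partial>lborel))"

definition nonpluripolar :: "(cp1 \<Rightarrow> ereal) \<Rightarrow> cp1 measure \<Rightarrow> cp1 measure" where
  "nonpluripolar u \<mu> = density \<mu> (indicator {x. u x > -\<infinity>})"

definition positive_mass :: "(cp1 \<Rightarrow> ereal) \<Rightarrow> bool" where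
  "positive_mass u \<longleftrightarrow>
     (\<exists>\<mu>. curvature_measure u \<mu> \<and> emeasure (nonpluripolar u \<mu>) UNIV > 0)"

section \<open>Test curves\<close>

text \<open>Concavity for functions with values in \<open>[-\<infinity>, \<infinity>)\<close>. The weights are strictly
  between 0 and 1, where the extended products need no convention.\<close>

definition ext_concave :: "(real \<Rightarrow> ereal) \<Rightarrow> bool" where
  "ext_concave g \<longleftrightarrow> (\<forall>\<sigma> \<tau> t. 0 < t \<and> t < 1 \<longrightarrow>
     ereal (1 - t) * g \<sigma> + ereal t * g \<tau> \<le> g ((1 - t) * \<sigma> + t * \<tau>))"

definition test_curve :: "(real \<Rightarrow> cp1 \<Rightarrow> ereal) \<Rightarrow> bool" where
  "test_curve \<psi> \<longleftrightarrow>
     (\<forall>\<tau>. \<psi> \<tau> \<in> PSH \<union> {\<lambda>_. -\<infinity>}) \<and>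
     (\<forall>x. usc euclidean (\<lambda>\<tau>. \<psi> \<tau> x) \<and> ext_concave (\<lambda>\<tau>. \<psi> \<tau> x) \<and> antimono (\<lambda>\<tau>. \<psi> \<tau> x)) \<and>
     (\<forall>\<^sub>F \<tau> in at_bot. \<psi> \<tau> = (\<lambda>_. 0)) \<and>
     (\<forall>\<^sub>F \<tau> in at_top. \<psi> \<tau> = (\<lambda>_. -\<infinity>))"

definition maximal_test_curve :: "(real \<Rightarrow> cp1 \<Rightarrow> ereal) \<Rightarrow> bool" where
  "maximal_test_curve \<psi> \<longleftrightarrow>
     test_curve \<psi> \<and> (\<forall>\<tau>. \<psi> \<tau> \<noteq> (\<lambda>_. -\<infinity>) \<longrightarrow> model_potential (\<psi> \<tau>))"

section \<open>Cap potentials\<close>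

definition cap :: "real \<Rightarrow> complex set" where
  "cap \<rho> = {w. (cmod w)\<^sup>2 \<le> (1 - \<rho>) / \<rho>}"

definition cap_potential :: "real \<Rightarrow> cp1 \<Rightarrow> ereal" where
  "cap_potential \<rho> x = (case x of
     None \<Rightarrow> -\<infinity>
   | Some w \<Rightarrow>
       if w \<in> cap \<rho> then 0
       else ereal (1/2 * (- ln (1 + (cmod w)\<^sup>2) + (1 - \<rho>) * ln ((cmod w)\<^sup>2)
                          - \<rho> * ln \<rho> - (1 - \<rho>) * ln (1 - \<rho>))))"

end

theory Submission
  imports Defs "HOL-Complex_Analysis.Cauchy_Integral_Formula" "HOL-Real_Asymp.Real_Asymp"
begin

text \<open>Put \<open>\<Omega>\<close> for the complement of the cap \<open>C\<close> of parameter \<open>s\<^sub>0\<^sup>2\<close>, a disc of radius \<open>R\<close> about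
  infinity in the coordinate \<open>z = 1/w\<close>. By Vitali's theorem disjoint discs fill \<open>\<Omega>\<close> up to a null
  set; giving each centre the share of its disc in the area of \<open>\<Omega>\<close> yields an atomic probability
  measure \<open>\<kappa>\<close>. By the mean value property the logarithmic potentials of \<open>\<kappa>\<close> and of the unit mass at
  infinity agree on \<open>C\<close>, and their difference \<open>V\<close> satisfies \<open>V \<le> log (R |w|)\<close> on \<open>\<Omega>\<close>. Take for
  \<open>\<theta>\<close> the curve \<open>b + max 0 (\<tau> - s\<^sub>0)\<^sup>2 V\<close>, with \<open>b\<close> the cap potential of parameter \<open>\<tau>\<^sup>2\<close>: part of the pole
  at infinity is replaced by a multiple of \<open>\<kappa>\<close>, which is carried by the \<open>-\<infinity>\<close> set of \<open>\<theta>\<close>.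
  The bound on \<open>V\<close> lets the concavity of \<open>b\<close> in \<open>\<tau>\<close> absorb the perturbation and keeps \<open>\<theta> < 0\<close> off the cap.

  For the model property, a competitor \<open>v \<le> 0\<close> with \<open>v \<le> \<theta> + C\<close> has at least the poles of \<open>\<theta>\<close>. The
  maximum principle off the cap, with the pole at infinity and the first \<open>N\<close> atoms taken into account,
  and \<open>N \<rightarrow> \<infinity>\<close> give \<open>v \<le> \<theta>\<close>; on the boundary circle of the cap the atoms left out contribute
  an error that tends to 0.\<close>

text \<open>The contact set and the curvature on it must stay fixed, so only the polar part, the
  pole at infinity, can be altered, and its replacement must have the same potential on the cap.
  Finitely many atoms cannot do this: the difference of the two potentials would be harmonic off a
  finite set, hence on a connected open set, and vanishing on the interior of the cap it would
  vanish identically. Infinitely many atoms whose discs fill the outside escape this argument; the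
  price is that domination has to be proved with finitely many of them at a time.

  The square of the parameter lets the perturbation start with slope zero, so the derivative in the
  parameter has no jump at the starting point and only the second derivative 2 V has to be
  compensated. At a fixed point of modulus |w| the derivative of the cap potential is minus the
  parameter times \<open>slope\<close>, an increasing quantity whose value at the starting parameter
  is exactly 2 log (R |w|). The bound on V was made for this number.\<close>

section \<open>The negative logarithm with a genuine pole\<close>

text \<open>The value \<open>top\<close> keeps the pole that the default value
  \<open>ln 0 = 0\<close> would erase. Beyond 1 the function is clipped to 0, so kernels are first
  scaled to be at most 1. In return, sums and integrals of kernels can be interchanged without
  integrability conditions.\<close>

definition nlog :: "real \<Rightarrow> ennreal" where
  "nlog t = (if t \<le> 0 then top else ennreal (- ln t))"

lemma nlog_pos: "0 < t \<Longrightarrow> nlog t = ennreal (- ln t)"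
  by (simp add: nlog_def)

lemma nlog_measurable [measurable]: "nlog \<in> borel_measurable borel"
  unfolding nlog_def[abs_def] by measurable

lemma nlog_antimono: "s \<le> t \<Longrightarrow> nlog t \<le> nlog s"
  by (auto simp: nlog_def intro!: ennreal_leI)

lemma nlog_mult:
  assumes "0 < s" "s \<le> 1" "t \<le> 1"
  shows "nlog (s * t) = nlog s + nlog t"
proof (cases "t \<le> 0")
  case True
  then have "s * t \<le> 0" using assms by (simp add: mult_le_0_iff)
  then show ?thesis using True by (simp add: nlog_def)
next
  case False
  then have "0 < t" by simp
  then have "ln s \<le> 0" "ln t \<le> 0" using assms by auto
  with \<open>0 < t\<close> assms show ?thesis
    by (simp add: nlog_def ln_mult mult_le_0_iff not_le flip: ennreal_plus)
qed

lemma cis_measurable [measurable]: "cis \<in> borel_measurable borel"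
  by (intro borel_measurable_continuous_onI continuous_intros)

text \<open>Continuity holds at the pole as well, because \<open>top\<close> is a limit in
  \<open>ennreal\<close>. All Fatou arguments for kernels rest on this.\<close>

lemma tendsto_nlog:
  assumes "(f \<longlongrightarrow> t) F"
  shows "((\<lambda>x. nlog (f x)) \<longlongrightarrow> nlog t) F"
proof -
  have "isCont nlog t"
  proof (cases t "0::real" rule: linorder_cases)
    case less
    then have "eventually (\<lambda>x. x < 0) (nhds t)" using eventually_nhds_in_open[of "{..<0}" t] by simp
    then have ev: "eventually (\<lambda>x. nlog x = top) (nhds t)"
      by eventually_elim (simp add: nlog_def)
    show ?thesis by (subst isCont_cong[OF ev]) auto
  next
    case greater
    then have "eventually (\<lambda>x. 0 < x) (nhds t)" using eventually_nhds_in_open[of "{0<..}" t] by simp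
    then have ev: "eventually (\<lambda>x. nlog x = ennreal (- ln x)) (nhds t)"
      by eventually_elim (simp add: nlog_def)
    have "isCont (\<lambda>x. - ln x) t" using greater by (intro continuous_intros) auto
    then have "isCont (\<lambda>x. ennreal (- ln x)) t"
      unfolding isCont_def by (rule tendsto_ennrealI)
    then show ?thesis unfolding isCont_cong[OF ev] .
  next
    case equal
    have "eventually (\<lambda>x. of_nat n < nlog x) (at 0)" for n
    proof -
      have "eventually (\<lambda>x::real. x < exp (- real n - 1)) (nhds 0)"
        using eventually_nhds_in_open[of "{..<exp (- real n - 1)}" 0] by simp
      then have "eventually (\<lambda>x::real. x < exp (- real n - 1)) (at 0)"
        by (simp add: eventually_nhds_conv_at)
      then show ?thesis
      proof eventually_elim
        case (elim x)
        show ?case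
        proof (cases "x \<le> 0")
          case False
          then have "ln x < - real n - 1" using elim by (metis ln_exp ln_less_cancel_iff not_le exp_gt_zero)
          then have "ennreal (real n) < ennreal (- ln x)" by (intro ennreal_lessI) auto
          then show ?thesis using False by (simp add: nlog_def ennreal_of_nat_eq_real_of_nat)
        qed (simp add: nlog_def of_nat_less_top)
      qed
    qed
    then have "(nlog \<longlongrightarrow> top) (at 0)"
    proof (intro order_tendstoI)
      fix y :: ennreal assume "y < top"
      then obtain n where "y < of_nat n" using ennreal_Ex_less_of_nat by auto
      then show "eventually (\<lambda>x. y < nlog x) (at 0)"
        using \<open>eventually (\<lambda>x. of_nat n < nlog x) (at 0)\<close> by (auto elim: eventually_mono)
    qed simp
    then show ?thesis using equal by (simp add: isCont_def nlog_def)
  qed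
  then show ?thesis using assms isCont_tendsto_compose by blast
qed

section \<open>Logarithmic means over circles and discs\<close>

text \<open>After division by \<open>a\<close> the integrand is the real part of Ln (1 + x z), which
  is holomorphic on the closed unit disc and vanishes at 0. Cauchy's formula then gives mean
  0.\<close>

lemma has_integral_ln_circle_aux:
  fixes a b :: complex
  assumes "cmod b < cmod a"
  shows "((\<lambda>t. ln (cmod (a + b * cis t))) has_integral 2 * pi * ln (cmod a)) {0..2*pi}"
proof -
  from assms have a0: "a \<noteq> 0" by auto
  define x where "x = b / a"
  have x1: "cmod x < 1" using assms a0 by (simp add: x_def norm_divide)
  \<comment> \<open>Since |x z| < 1, the argument of \<open>Ln\<close> stays in the right half
    plane, off the branch cut.\<close>
  have pos: "1 + x * z \<notin> \<real>\<^sub>\<le>\<^sub>0" if "cmod z \<le> 1" for z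
  proof -
    have "cmod (x * z) < 1"
      using x1 that by (metis mult_left_le norm_ge_zero norm_mult order_le_less_trans)
    then have "- 1 < Re (x * z)" using abs_Re_le_cmod[of "x * z"] by linarith
    then show ?thesis by (auto simp: complex_nonpos_Reals_iff)
  qed
  have "(\<lambda>z. Ln (1 + x * z)) holomorphic_on cball 0 1"
    using pos by (intro holomorphic_intros) (auto simp: dist_norm)
  then have "((\<lambda>u. Ln (1 + x * u) / (u - 0)) has_contour_integral (2 * of_real pi * \<i> * Ln (1 + x * 0))) (circlepath 0 1)"
    by (rule Cauchy_integral_circlepath_simple) simp
  then have "((\<lambda>u. Ln (1 + x * u) / u) has_contour_integral 0) (part_circlepath 0 1 0 (2*pi))"
    by (simp add: circlepath_def)
  then have "((\<lambda>t. Ln (1 + x * cis t) / cis t * \<i> * cis t) has_integral 0) {0..2*pi}"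
    by (subst (asm) has_contour_integral_part_circlepath_iff) auto
  moreover have "Ln (1 + x * cis t) / cis t * \<i> * cis t = \<i> * Ln (1 + x * cis t)" for t
    by (simp add: field_simps)
  ultimately have "((\<lambda>t. \<i> * Ln (1 + x * cis t)) has_integral 0) {0..2*pi}" by (simp only:)
  \<comment> \<open>The contour integral carries a factor i, so the log modulus appears as an
    imaginary part.\<close>
  then have "((\<lambda>t. Im (\<i> * Ln (1 + x * cis t))) has_integral 0) {0..2*pi}"
    using has_integral_Im[of "\<lambda>t. \<i> * Ln (1 + x * cis t)" 0] by simp
  moreover have "Im (\<i> * Ln (1 + x * cis t)) = ln (cmod (1 + x * cis t))" for t
  proof -
    have "1 + x * cis t \<noteq> 0" using pos[of "cis t"] by auto
    then show ?thesis by simp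
  qed
  ultimately have "((\<lambda>t. ln (cmod (1 + x * cis t))) has_integral 0) {0..2*pi}" by simp
  from has_integral_add[OF this has_integral_const_real[of "ln (cmod a)" 0 "2*pi"]]
  have "((\<lambda>t. ln (cmod (1 + x * cis t)) + ln (cmod a)) has_integral 2 * pi * ln (cmod a)) {0..2*pi}"
    by simp
  moreover have "ln (cmod (1 + x * cis t)) + ln (cmod a) = ln (cmod (a + b * cis t))" for t
  proof -
    have "1 + x * cis t \<noteq> 0" using pos[of "cis t"] by auto
    moreover have "a + b * cis t = (1 + x * cis t) * a" using a0 by (simp add: x_def field_simps)
    ultimately show ?thesis using a0 by (simp add: norm_mult ln_mult del: mult.commute)
  qed
  ultimately show ?thesis by simp
qed

text \<open>Conjugation followed by a rotation exchanges the two coefficients; this reduces the case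
  of a dominant \<open>b\<close> to that of a dominant \<open>a\<close>.\<close>

lemma cmod_add_cis: "cmod (a + b * cis t) = cmod (cnj b + cnj a * cis t)"
proof -
  have "cnj b + cnj a * cis t = cnj (cis (-t)) * cnj (a + b * cis t)"
    by (simp add: algebra_simps cis_cnj cis_mult)
  then show ?thesis by (metis norm_mult complex_mod_cnj norm_cis mult_1)
qed

lemma has_integral_ln_circle:
  fixes a b :: complex
  assumes "cmod a \<noteq> cmod b"
  shows "((\<lambda>t. ln (cmod (a + b * cis t))) has_integral 2 * pi * ln (max (cmod a) (cmod b))) {0..2*pi}"
proof (cases "cmod b < cmod a")
  case True
  then show ?thesis using has_integral_ln_circle_aux[OF True] by (simp add: max_def)
next
  case False
  then have "cmod (cnj a) < cmod (cnj b)" using assms by simp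
  from has_integral_ln_circle_aux[OF this] False show ?thesis
    by (simp add: cmod_add_cis[of a b] max_def)
qed

text \<open>The scale \<open>S\<close> bounds the modulus on the whole circle, so
  \<open>nlog\<close> is not clipped and equals \<open>ln S\<close> minus a finite
  logarithm.\<close>

lemma nn_integral_nlog_circle:
  fixes a b :: complex
  assumes ne: "cmod a \<noteq> cmod b" and S: "cmod a + cmod b \<le> S"
  shows "(\<integral>\<^sup>+t\<in>{0..2*pi}. nlog (cmod (a + b * cis t) / S) \<partial>lborel)
           = ennreal (2 * pi) * nlog (max (cmod a) (cmod b) / S)"
proof -
  have M: "0 < max (cmod a) (cmod b)" using ne by (smt (verit) norm_ge_zero)
  then have S0: "0 < S" "max (cmod a) (cmod b) \<le> S" using S by (smt (verit) norm_ge_zero)+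
  have nz: "0 < cmod (a + b * cis t)" for t
  proof -
    have "cmod (a + b * cis t) \<ge> \<bar>cmod a - cmod b\<bar>"
      using norm_triangle_ineq3[of a "- (b * cis t)"] by (simp add: norm_mult)
    then show ?thesis using ne by linarith
  qed
  have le: "cmod (a + b * cis t) \<le> S" for t
    using norm_triangle_ineq[of a "b * cis t"] S by (simp add: norm_mult)
  have eq: "nlog (cmod (a + b * cis t) / S) = ennreal (ln S - ln (cmod (a + b * cis t)))" for t
    using nz[of t] S0 by (simp add: nlog_def ln_div not_le)
  have I: "((\<lambda>t. ln S - ln (cmod (a + b * cis t))) has_integral
      (2 * pi * ln S - 2 * pi * ln (max (cmod a) (cmod b)))) {0..2*pi}"
    using has_integral_diff[OF has_integral_const_real[of "ln S" 0 "2*pi"] has_integral_ln_circle[OF ne]]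
    by simp
  have "(\<integral>\<^sup>+t\<in>{0..2*pi}. nlog (cmod (a + b * cis t) / S) \<partial>lborel) =
      ennreal (2 * pi * ln S - 2 * pi * ln (max (cmod a) (cmod b)))"
    unfolding eq using nn_integral_has_integral_lebesgue'[OF _ I] nz le S0 by simp
  also have "\<dots> = ennreal (2 * pi) * nlog (max (cmod a) (cmod b) / S)"
  proof -
    have "nlog (max (cmod a) (cmod b) / S) = ennreal (ln S - ln (max (cmod a) (cmod b)))"
      using M S0(1) by (subst nlog_pos) (simp_all only: divide_pos_pos ln_divide_pos minus_diff_eq)
    moreover have "0 \<le> ln S - ln (max (cmod a) (cmod b))"
      using M S0 by (simp only: diff_ge_0_iff_ge ln_le_cancel_iff)
    then have "ennreal (2 * pi) * ennreal (ln S - ln (max (cmod a) (cmod b)))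
        = ennreal (2 * pi * (ln S - ln (max (cmod a) (cmod b))))"
      by (intro ennreal_mult[symmetric]) auto
    ultimately show ?thesis by (simp only: right_diff_distrib)
  qed
  finally show ?thesis .
qed

text \<open>When the circle meets the pole, it is approximated by circles that miss it, and Fatou's
  lemma passes to the limit. This yields one inequality, which is the direction needed for the
  sub-mean property.\<close>

lemma nn_integral_nlog_circle_le:
  fixes a b :: complex
  assumes S: "cmod a + cmod b \<le> S"
  shows "(\<integral>\<^sup>+t\<in>{0..2*pi}. nlog (cmod (a + b * cis t) / S) \<partial>lborel)
           \<le> ennreal (2 * pi) * nlog (max (cmod a) (cmod b) / S)"
proof (cases "cmod a = cmod b")
  case False
  then show ?thesis using nn_integral_nlog_circle[OF _ S] by simp
next
  case eq: True
  show ?thesis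
  proof (cases "a = 0")
    case True
    then show ?thesis by (simp add: nlog_def eq[symmetric] ennreal_mult_top)
  next
    case a0: False
    then have S0: "0 < S" using S by (smt (verit) norm_ge_zero zero_less_norm_iff)
    \<comment> \<open>Factors below 1 that tend to 1; shrinking \<open>b\<close> leaves the larger
      modulus, hence the right-hand side, unchanged.\<close>
    define \<beta> where "\<beta> n = (1 - 1 / (real n + 2))" for n
    have \<beta>: "0 \<le> \<beta> n" "\<beta> n < 1" for n by (auto simp: \<beta>_def field_simps)
    have lim: "\<beta> \<longlonglongrightarrow> 1"
    proof -
      have "(\<lambda>n. 1 - 1 / (real (n + 2))) \<longlonglongrightarrow> 1 - 0"
        by (intro tendsto_diff tendsto_const LIMSEQ_ignore_initial_segment[OF lim_1_over_n])
      then show ?thesis by (simp add: \<beta>_def[abs_def] add.commute)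
    qed
    have lim2: "(\<lambda>n. nlog (cmod (a + of_real (\<beta> n) * b * cis t) / S)) \<longlonglongrightarrow> nlog (cmod (a + b * cis t) / S)" for t
    proof -
      have "(\<lambda>n. cmod (a + of_real (\<beta> n) * b * cis t) / S) \<longlonglongrightarrow> cmod (a + of_real 1 * b * cis t) / S"
        by (intro tendsto_intros lim) (use S0 in auto)
      then show ?thesis using tendsto_nlog by simp
    qed
    have "(\<integral>\<^sup>+t\<in>{0..2*pi}. nlog (cmod (a + b * cis t) / S) \<partial>lborel)
      = (\<integral>\<^sup>+t. liminf (\<lambda>n. nlog (cmod (a + of_real (\<beta> n) * b * cis t) / S) * indicator {0..2*pi} t) \<partial>lborel)"
    proof (intro nn_integral_cong)
      fix t
      have "(\<lambda>n. nlog (cmod (a + of_real (\<beta> n) * b * cis t) / S) * indicator {0..2*pi} t)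
          \<longlonglongrightarrow> nlog (cmod (a + b * cis t) / S) * indicator {0..2*pi} t"
        using lim2[of t] by (cases "t \<in> {0..2*pi}") auto
      then show "nlog (cmod (a + b * cis t) / S) * indicator {0..2*pi} t
        = liminf (\<lambda>n. nlog (cmod (a + of_real (\<beta> n) * b * cis t) / S) * indicator {0..2*pi} t)"
        using lim_imp_Liminf[OF trivial_limit_sequentially] by metis
    qed
    also have "\<dots> \<le> liminf (\<lambda>n. \<integral>\<^sup>+t\<in>{0..2*pi}. nlog (cmod (a + of_real (\<beta> n) * b * cis t) / S) \<partial>lborel)"
      by (rule nn_integral_liminf) measurable
    also have "\<dots> = liminf (\<lambda>n. ennreal (2 * pi) * nlog (max (cmod a) (cmod b) / S))"
    proof -
      have "(\<integral>\<^sup>+t\<in>{0..2*pi}. nlog (cmod (a + of_real (\<beta> n) * b * cis t) / S) \<partial>lborel)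
        = ennreal (2 * pi) * nlog (max (cmod a) (cmod b) / S)" for n
      proof -
        have 1: "cmod (of_real (\<beta> n) * b) < cmod a"
        proof -
          have "\<beta> n * cmod b < 1 * cmod b"
            using \<beta>[of n] a0 eq by (intro mult_strict_right_mono) auto
          then show ?thesis using \<beta>[of n] eq by (simp only: norm_mult norm_of_real abs_of_nonneg mult_1)
        qed
        then have 2: "cmod a \<noteq> cmod (of_real (\<beta> n) * b)" by linarith
        from 1 have 3: "max (cmod a) (cmod (of_real (\<beta> n) * b)) = max (cmod a) (cmod b)"
          using eq by simp
        have "cmod a + cmod (of_real (\<beta> n) * b) \<le> S" using 1 eq S by linarith
        from nn_integral_nlog_circle[OF 2 this] show ?thesis using 3 by simp
      qed
      then show ?thesis by simp
    qed
    also have "\<dots> = ennreal (2 * pi) * nlog (max (cmod a) (cmod b) / S)"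
      by (simp add: Liminf_const)
    finally show ?thesis .
  qed
qed

lemma circle_ln_mean_real:
  assumes "0 < r" "r < cmod a"
  shows "((\<lambda>t. ln (cmod (a + of_real r * cis t))) has_integral 2 * pi * ln (cmod a)) {0..2*pi}"
  using has_integral_ln_circle[of a "of_real r"] assms by (simp add: max_def)

section \<open>Averages over discs without polar coordinates\<close>

lemma nn_integral_lborel_translate:
  fixes f :: "'a::euclidean_space \<Rightarrow> ennreal"
  assumes [measurable]: "f \<in> borel_measurable borel"
  shows "(\<integral>\<^sup>+z. f (c + z) \<partial>lborel) = (\<integral>\<^sup>+z. f z \<partial>lborel)"
  by (subst (2) lborel_distr_plus[of c, symmetric]) (simp add: nn_integral_distr)

lemma ball_measurable [measurable]: "ball (c::'a::metric_space) r \<in> sets borel"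
  by simp

lemma cball_measurable [measurable]: "cball (c::'a::metric_space) r \<in> sets borel"
  by simp

lemma emeasure_complex_ball:
  "0 \<le> r \<Longrightarrow> emeasure lborel (ball (c::complex) r) = ennreal (pi * r\<^sup>2)"
  using emeasure_ball[where ?'a=complex, of r c] by (simp add: unit_ball_vol_2)

text \<open>Comparing \<open>\<integral>\<integral> f (u x) g (u x + y)\<close> computed in both orders, with \<open>g\<close> the indicator of the unit
  disc, uses only translation invariance.\<close>

lemma nn_integral_lborel_rotate:
  fixes f :: "complex \<Rightarrow> ennreal"
  assumes f [measurable]: "f \<in> borel_measurable borel" and u: "cmod u = 1"
  shows "(\<integral>\<^sup>+z. f (u * z) \<partial>lborel) = (\<integral>\<^sup>+z. f z \<partial>lborel)"
proof -
  define g :: "complex \<Rightarrow> ennreal" where "g = indicator (ball 0 1)"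
  have [measurable]: "g \<in> borel_measurable borel" by (simp add: g_def)
  have gi: "(\<integral>\<^sup>+z. g z \<partial>lborel) = ennreal pi"
    using emeasure_complex_ball[of 1 0] by (simp add: g_def)
  \<comment> \<open>The right-hand side does not depend on \<open>v\<close>, so comparing
    \<open>v = u\<close> with \<open>v = 1\<close> removes the reflection.\<close>
  have *: "(\<integral>\<^sup>+z. f (v * z) \<partial>lborel) = (\<integral>\<^sup>+z. f (- z) \<partial>lborel)" if v: "cmod v = 1" for v
  proof -
    have v0: "v \<noteq> 0" using v by auto
    have "(\<integral>\<^sup>+z. f (v * z) \<partial>lborel) * ennreal pi
        = (\<integral>\<^sup>+x. (\<integral>\<^sup>+y. f (v * x) * g (v * x + y) \<partial>lborel) \<partial>lborel)"
      by (simp add: nn_integral_cmult nn_integral_multc nn_integral_lborel_translate gi)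
    also have "\<dots> = (\<integral>\<^sup>+y. (\<integral>\<^sup>+x. f (v * x) * g (v * x + y) \<partial>lborel) \<partial>lborel)"
      by (rule lborel_pair.Fubini') measurable
    also have "\<dots> = (\<integral>\<^sup>+y. (\<integral>\<^sup>+x. f (v * x - y) * g (v * x) \<partial>lborel) \<partial>lborel)"
    proof (rule nn_integral_cong)
      fix y
      show "(\<integral>\<^sup>+x. f (v * x) * g (v * x + y) \<partial>lborel) = (\<integral>\<^sup>+x. f (v * x - y) * g (v * x) \<partial>lborel)"
        using v0 by (subst nn_integral_lborel_translate[symmetric, where c="- (y / v)"])
          (auto simp: algebra_simps)
    qed
    also have "\<dots> = (\<integral>\<^sup>+x. (\<integral>\<^sup>+y. f (v * x - y) * g (v * x) \<partial>lborel) \<partial>lborel)"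
      by (rule lborel_pair.Fubini') measurable
    also have "\<dots> = (\<integral>\<^sup>+x. (\<integral>\<^sup>+y. f (- y) \<partial>lborel) * g x \<partial>lborel)"
    proof (rule nn_integral_cong)
      fix x
      have "(\<integral>\<^sup>+y. f (v * x - y) \<partial>lborel) = (\<integral>\<^sup>+y. f (- y) \<partial>lborel)"
        by (subst nn_integral_lborel_translate[symmetric, where c="v * x"]) auto
      moreover have "g (v * x) = g x" using v by (simp add: g_def norm_mult indicator_def)
      ultimately show "(\<integral>\<^sup>+y. f (v * x - y) * g (v * x) \<partial>lborel) = (\<integral>\<^sup>+y. f (- y) \<partial>lborel) * g x"
        by (simp add: nn_integral_multc)
    qed
    also have "\<dots> = (\<integral>\<^sup>+y. f (- y) \<partial>lborel) * ennreal pi"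
      by (simp add: nn_integral_cmult gi)
    finally have "ennreal pi * (\<integral>\<^sup>+z. f (v * z) \<partial>lborel) = ennreal pi * (\<integral>\<^sup>+y. f (- y) \<partial>lborel)"
      by (simp only: mult.commute)
    then show ?thesis
      by (subst (asm) ennreal_mult_cancel_left) (use pi_gt_zero in \<open>auto simp: ennreal_eq_0_iff simp del: pi_gt_zero\<close>)
  qed
  from *[OF u] *[of 1] show ?thesis by simp
qed

text \<open>By rotation invariance every angle contributes the same integral over the disc. Together
  with Fubini this replaces integration in polar coordinates.\<close>

lemma nn_integral_ball_average:
  fixes f :: "complex \<Rightarrow> ennreal"
  assumes f [measurable]: "f \<in> borel_measurable borel"
  shows "ennreal (2 * pi) * (\<integral>\<^sup>+z\<in>ball 0 r. f z \<partial>lborel)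
    = (\<integral>\<^sup>+z\<in>ball 0 r. (\<integral>\<^sup>+t\<in>{0..2*pi}. f (z * cis t) \<partial>lborel) \<partial>lborel)"
proof -
  have "(\<integral>\<^sup>+z\<in>ball 0 r. (\<integral>\<^sup>+t\<in>{0..2*pi}. f (z * cis t) \<partial>lborel) \<partial>lborel)
     = (\<integral>\<^sup>+z. (\<integral>\<^sup>+t. f (z * cis t) * indicator {0..2*pi} t * indicator (ball 0 r) z \<partial>lborel) \<partial>lborel)"
    by (simp add: nn_integral_multc)
  also have "\<dots> = (\<integral>\<^sup>+t. (\<integral>\<^sup>+z. f (z * cis t) * indicator {0..2*pi} t * indicator (ball 0 r) z \<partial>lborel) \<partial>lborel)"
    by (rule lborel_pair.Fubini') measurable
  also have "\<dots> = (\<integral>\<^sup>+t. (\<integral>\<^sup>+z\<in>ball 0 r. f z \<partial>lborel) * indicator {0..2*pi} t \<partial>lborel)"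
  proof (rule nn_integral_cong)
    fix t :: real
    have "(\<integral>\<^sup>+z. f (z * cis t) * indicator {0..2*pi} t * indicator (ball 0 r) z \<partial>lborel)
      = (\<integral>\<^sup>+z. f (cis t * z) * indicator (ball 0 r) (cis t * z) * indicator {0..2*pi} t \<partial>lborel)"
      by (intro nn_integral_cong) (auto simp: indicator_def norm_mult mult_ac)
    also have "\<dots> = (\<integral>\<^sup>+z. f (cis t * z) * indicator (ball 0 r) (cis t * z) \<partial>lborel) * indicator {0..2*pi} t"
      by (simp add: nn_integral_multc)
    also have "(\<integral>\<^sup>+z. f (cis t * z) * indicator (ball 0 r) (cis t * z) \<partial>lborel) = (\<integral>\<^sup>+z\<in>ball 0 r. f z \<partial>lborel)"
      by (rule nn_integral_lborel_rotate[where f="\<lambda>z. f z * indicator (ball 0 r) z"]) auto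
    finally show "(\<integral>\<^sup>+z. f (z * cis t) * indicator {0..2*pi} t * indicator (ball 0 r) z \<partial>lborel)
      = (\<integral>\<^sup>+z\<in>ball 0 r. f z \<partial>lborel) * indicator {0..2*pi} t" .
  qed
  also have "\<dots> = (\<integral>\<^sup>+z\<in>ball 0 r. f z \<partial>lborel) * ennreal (2 * pi)"
    by (subst nn_integral_cmult) auto
  finally show ?thesis by (simp add: mult.commute)
qed

lemma AE_cmod_neq: "AE z in lborel. cmod z \<noteq> \<rho>"
proof -
  have "sphere (0::complex) \<rho> \<in> null_sets lebesgue"
    using negligible_sphere negligible_iff_null_sets by blast
  then have "sphere (0::complex) \<rho> \<in> null_sets lborel"
    by (simp add: null_sets_completion_iff)
  then have "AE z::complex in lborel. z \<notin> sphere 0 \<rho>" by (rule AE_not_in)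
  then show ?thesis by eventually_elim simp
qed

lemma nn_integral_nlog_ball:
  assumes S: "cmod (z - c) + r \<le> S"
  shows "(\<integral>\<^sup>+\<zeta>\<in>ball c r. nlog (cmod (z - \<zeta>) / S) \<partial>lborel)
    = (\<integral>\<^sup>+\<zeta>\<in>ball 0 r. nlog (max (cmod (z - c)) (cmod \<zeta>) / S) \<partial>lborel)"
proof -
  let ?f = "\<lambda>\<zeta>. nlog (cmod ((z - c) + - \<zeta>) / S)"
  have "ennreal (2 * pi) * (\<integral>\<^sup>+\<zeta>\<in>ball 0 r. ?f \<zeta> \<partial>lborel)
     = (\<integral>\<^sup>+\<zeta>\<in>ball 0 r. (\<integral>\<^sup>+t\<in>{0..2*pi}. ?f (\<zeta> * cis t) \<partial>lborel) \<partial>lborel)"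
    by (rule nn_integral_ball_average) measurable
  also have "\<dots> = (\<integral>\<^sup>+\<zeta>\<in>ball 0 r. ennreal (2 * pi) * nlog (max (cmod (z - c)) (cmod \<zeta>) / S) \<partial>lborel)"
  proof (rule nn_integral_cong_AE)
    from AE_cmod_neq[of "cmod (z - c)"]
    show "AE \<zeta> in lborel. (\<integral>\<^sup>+t\<in>{0..2*pi}. ?f (\<zeta> * cis t) \<partial>lborel) * indicator (ball 0 r) \<zeta> =
      ennreal (2 * pi) * nlog (max (cmod (z - c)) (cmod \<zeta>) / S) * indicator (ball 0 r) \<zeta>"
    proof eventually_elim
      case (elim \<zeta>)
      show ?case
      proof (cases "\<zeta> \<in> ball 0 r")
        case True
        then have "cmod (z - c) + cmod (- \<zeta>) \<le> S" using S by simp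
        from nn_integral_nlog_circle[OF _ this] elim True show ?thesis by simp
      qed simp
    qed
  qed
  also have "\<dots> = ennreal (2 * pi) * (\<integral>\<^sup>+\<zeta>\<in>ball 0 r. nlog (max (cmod (z - c)) (cmod \<zeta>) / S) \<partial>lborel)"
    unfolding mult.assoc by (rule nn_integral_cmult) measurable
  finally have "(\<integral>\<^sup>+\<zeta>\<in>ball 0 r. ?f \<zeta> \<partial>lborel)
      = (\<integral>\<^sup>+\<zeta>\<in>ball 0 r. nlog (max (cmod (z - c)) (cmod \<zeta>) / S) \<partial>lborel)"
    by (subst (asm) ennreal_mult_cancel_left) (use pi_gt_zero in \<open>auto simp: ennreal_eq_0_iff simp del: pi_gt_zero\<close>)
  moreover have "(\<integral>\<^sup>+\<zeta>\<in>ball c r. nlog (cmod (z - \<zeta>) / S) \<partial>lborel) = (\<integral>\<^sup>+\<zeta>\<in>ball 0 r. ?f \<zeta> \<partial>lborel)"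
    by (subst nn_integral_lborel_translate[symmetric, where c=c])
      (auto intro!: nn_integral_cong simp: indicator_def dist_norm algebra_simps)
  ultimately show ?thesis by simp
qed

lemma nn_integral_ball_const:
  "0 \<le> r \<Longrightarrow> (\<integral>\<^sup>+\<zeta>\<in>ball (c::complex) r. k \<partial>lborel) = ennreal (pi * r\<^sup>2) * k"
  by (subst nn_integral_cmult) (auto simp: emeasure_complex_ball mult.commute)

text \<open>Seen from outside, the larger of the two radii is always the distance to the centre, so
  the disc acts like a point mass (Newton's theorem).\<close>

lemma nn_integral_nlog_ball_eq:
  assumes "cmod (z - c) + r \<le> S" "r \<le> cmod (z - c)" "0 \<le> r"
  shows "(\<integral>\<^sup>+\<zeta>\<in>ball c r. nlog (cmod (z - \<zeta>) / S) \<partial>lborel) = ennreal (pi * r\<^sup>2) * nlog (cmod (z - c) / S)"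
proof -
  have "(\<integral>\<^sup>+\<zeta>\<in>ball 0 r. nlog (max (cmod (z - c)) (cmod \<zeta>) / S) \<partial>lborel)
      = (\<integral>\<^sup>+\<zeta>\<in>ball (0::complex) r. nlog (cmod (z - c) / S) \<partial>lborel)"
    using assms by (intro nn_integral_cong) (auto simp: indicator_def max_def)
  then show ?thesis
    by (simp only: nn_integral_nlog_ball[OF assms(1)] nn_integral_ball_const[OF assms(3)])
qed

text \<open>Taking the maximum with a second radius can only lower \<open>nlog\<close>; so for every
  \<open>z\<close> spreading a point mass over a disc weakens its pole.\<close>

lemma nn_integral_nlog_ball_le:
  assumes "cmod (z - c) + r \<le> S" "0 \<le> r"
  shows "(\<integral>\<^sup>+\<zeta>\<in>ball c r. nlog (cmod (z - \<zeta>) / S) \<partial>lborel) \<le> ennreal (pi * r\<^sup>2) * nlog (cmod (z - c) / S)"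
proof -
  have S0: "0 \<le> S" using assms norm_ge_zero[of "z - c"] by linarith
  have "(\<integral>\<^sup>+\<zeta>\<in>ball 0 r. nlog (max (cmod (z - c)) (cmod \<zeta>) / S) \<partial>lborel)
      \<le> (\<integral>\<^sup>+\<zeta>\<in>ball (0::complex) r. nlog (cmod (z - c) / S) \<partial>lborel)"
    using S0 by (intro nn_integral_mono mult_right_mono nlog_antimono divide_right_mono) auto
  then show ?thesis
    by (simp only: nn_integral_nlog_ball[OF assms(1)] nn_integral_ball_const[OF assms(2)])
qed

text \<open>For \<open>z\<close> in the disc neither of the two radii exceeds
  \<open>r\<close>.\<close>

lemma nn_integral_nlog_ball_ge:
  assumes "cmod (z - c) + r \<le> S" "0 \<le> r" "cmod (z - c) \<le> r"
  shows "ennreal (pi * r\<^sup>2) * nlog (r / S) \<le> (\<integral>\<^sup>+\<zeta>\<in>ball c r. nlog (cmod (z - \<zeta>) / S) \<partial>lborel)"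
proof -
  have S0: "0 \<le> S" using assms norm_ge_zero[of "z - c"] by linarith
  have "(\<integral>\<^sup>+\<zeta>\<in>ball (0::complex) r. nlog (r / S) \<partial>lborel)
     \<le> (\<integral>\<^sup>+\<zeta>\<in>ball 0 r. nlog (max (cmod (z - c)) (cmod \<zeta>) / S) \<partial>lborel)"
    using S0 assms by (intro nn_integral_mono)
      (auto simp: indicator_def intro!: nlog_antimono divide_right_mono)
  then show ?thesis
    by (simp only: nn_integral_nlog_ball[OF assms(1)] nn_integral_ball_const[OF assms(2)])
qed

section \<open>Filling a disc by discs\<close>

text \<open>The small discs inside the large one cover every nonzero point at arbitrarily small
  scales, as Vitali's theorem requires. Centres avoid 0, the point at infinity of the other
  coordinate, where the rest of the pole stays.\<close>

lemma disc_packing: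
  assumes R: "0 < R"
  obtains c :: "nat \<Rightarrow> complex" and r :: "nat \<Rightarrow> real"
  where "\<And>n. 0 \<le> r n" "\<And>n. ball (c n) (r n) \<subseteq> ball 0 R" "\<And>n. c n \<noteq> 0" "\<And>n. cmod (c n) < R"
    "disjoint_family (\<lambda>n. ball (c n) (r n))"
    "AE z in lborel. z \<in> ball 0 R \<longleftrightarrow> (\<exists>n. z \<in> ball (c n) (r n))"
proof -
  define K where "K = {(c::complex, r). 0 < r \<and> ball c r \<subseteq> ball 0 R \<and> c \<noteq> 0 \<and> cmod c < R}"
  have cover: "\<exists>i. i \<in> K \<and> x \<in> ball (fst i) (snd i) \<and> snd i < d" if x: "x \<in> ball 0 R - {0}" and d: "0 < d" for x d
  proof -
    \<comment> \<open>The first bound makes the cover fine, the second keeps the disc inside the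
      large one.\<close>
    define r where "r = min (d / 2) (R - cmod x)"
    have "0 < r" "r < d" using x d by (auto simp: r_def)
    moreover have "ball x r \<subseteq> ball 0 R"
    proof
      fix y assume "y \<in> ball x r"
      then have "cmod (y - x) < R - cmod x" by (simp add: r_def dist_norm norm_minus_commute)
      then show "y \<in> ball 0 R" using norm_triangle_ineq[of "y - x" x] by simp
    qed
    ultimately have "(x, r) \<in> K" using x by (auto simp: K_def)
    then show ?thesis using \<open>0 < r\<close> \<open>r < d\<close> by (intro exI[of _ "(x, r)"]) auto
  qed
  obtain C where C: "countable C" "C \<subseteq> K"
    "pairwise (\<lambda>i j. disjnt (ball (fst i) (snd i)) (ball (fst j) (snd j))) C"
    "negligible ((ball 0 R - {0}) - (\<Union>i \<in> C. ball (fst i) (snd i)))"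
    by (rule Vitali_covering_theorem_balls[of "ball 0 R - {0}" K fst snd, OF cover])
  define N where "N = to_nat_on C ` C"
  \<comment> \<open>Indices outside the coded family get an empty disc with an admissible centre; it
    will have weight 0.\<close>
  define p where "p n = (if n \<in> N then from_nat_into C n else (of_real (R / 2), 0))" for n
  have pC: "p n \<in> C" if "n \<in> N" for n
    using that C(1) by (auto simp: p_def N_def)
  have pN: "p n = (of_real (R / 2), 0)" if "n \<notin> N" for n using that by (simp add: p_def)
  have inj: "m = n" if "m \<in> N" "n \<in> N" "p m = p n" for m n
    using that C(1) by (auto simp: p_def N_def)
  have surj: "\<exists>n\<in>N. p n = i" if "i \<in> C" for i
    using that C(1) by (auto simp: p_def N_def intro!: bexI[of _ "to_nat_on C i"])
  have un: "(\<exists>n. z \<in> ball (fst (p n)) (snd (p n))) \<longleftrightarrow> z \<in> (\<Union>i \<in> C. ball (fst i) (snd i))" for z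
  proof
    assume "\<exists>n. z \<in> ball (fst (p n)) (snd (p n))"
    then obtain n where n: "z \<in> ball (fst (p n)) (snd (p n))" by blast
    then have "n \<in> N" using pN by (cases "n \<in> N") auto
    then show "z \<in> (\<Union>i \<in> C. ball (fst i) (snd i))" using pC n by blast
  next
    assume "z \<in> (\<Union>i \<in> C. ball (fst i) (snd i))"
    then show "\<exists>n. z \<in> ball (fst (p n)) (snd (p n))" using surj by (metis UN_E)
  qed
  show thesis
  proof (rule that[of "\<lambda>n. snd (p n)" "\<lambda>n. fst (p n)"])
    fix n
    have "p n \<in> K \<or> p n = (of_real (R / 2), 0)" using pC pN C(2) by blast
    then show "0 \<le> snd (p n)" "ball (fst (p n)) (snd (p n)) \<subseteq> ball 0 R" "fst (p n) \<noteq> 0" "cmod (fst (p n)) < R"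
      using R by (auto simp: K_def)
  next
    show "disjoint_family (\<lambda>n. ball (fst (p n)) (snd (p n)))"
      unfolding disjoint_family_on_def
    proof (intro ballI impI)
      fix m n :: nat assume "m \<noteq> n"
      show "ball (fst (p m)) (snd (p m)) \<inter> ball (fst (p n)) (snd (p n)) = {}"
      proof (cases "m \<in> N \<and> n \<in> N")
        case True
        then have "p m \<noteq> p n" using inj \<open>m \<noteq> n\<close> by blast
        then show ?thesis using C(3) pC True unfolding pairwise_def disjnt_def by blast
      qed (auto simp: pN)
    qed
  next
    \<comment> \<open>The origin was removed from the set to be covered, so it joins the exceptional
      null set.\<close>
    have "negligible (insert 0 ((ball 0 R - {0}) - (\<Union>i \<in> C. ball (fst i) (snd i))))"
      using C(4) by simp
    then have "insert 0 ((ball 0 R - {0}) - (\<Union>i \<in> C. ball (fst i) (snd i))) \<in> null_sets lebesgue"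
      by (simp add: negligible_iff_null_sets)
    moreover have "insert 0 ((ball 0 R - {0}) - (\<Union>i \<in> C. ball (fst i) (snd i))) \<in> sets borel"
    proof -
      have "open (\<Union>i \<in> C. ball (fst i) (snd i))" by (intro open_UN ballI open_ball)
      moreover have "insert 0 ((ball 0 R - {0}) - (\<Union>i \<in> C. ball (fst i) (snd i)))
         = {0} \<union> (ball 0 R - {0} - (\<Union>i \<in> C. ball (fst i) (snd i)))" by (rule insert_is_Un)
      ultimately show ?thesis by (simp only:) (intro sets.Un sets.Diff borel_open borel_closed closed_singleton open_ball)
    qed
    ultimately have "insert 0 ((ball 0 R - {0}) - (\<Union>i \<in> C. ball (fst i) (snd i))) \<in> null_sets lborel"
      by (simp only: null_sets_completion_iff sets_lborel)
    from AE_not_in[OF this]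
    show "AE z in lborel. z \<in> ball 0 R \<longleftrightarrow> (\<exists>n. z \<in> ball (fst (p n)) (snd (p n)))"
    proof eventually_elim
      case (elim z)
      have "z \<in> ball 0 R" if "z \<in> (\<Union>i \<in> C. ball (fst i) (snd i))"
        using that C(2) by (fastforce simp: K_def)
      then show ?case unfolding un using elim by blast
    qed
  qed
qed

text \<open>The disc of radius \<open>R\<close> about 0 and the packing discs weighted by their share of its area:
  the resulting atomic probability measure has the same logarithmic potential outside the disc
  as the unit mass at 0.\<close>

locale packing =
  fixes R :: real and c :: "nat \<Rightarrow> complex" and r :: "nat \<Rightarrow> real"
  assumes R: "0 < R"
    and r_nonneg: "\<And>n. 0 \<le> r n"
    and ball_subset: "\<And>n. ball (c n) (r n) \<subseteq> ball 0 R"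
    and c_nonzero: "\<And>n. c n \<noteq> 0"
    and c_less: "\<And>n. cmod (c n) < R"
    and disjoint: "disjoint_family (\<lambda>n. ball (c n) (r n))"
    and filling: "AE z in lborel. z \<in> ball 0 R \<longleftrightarrow> (\<exists>n. z \<in> ball (c n) (r n))"
begin

definition \<alpha> :: "nat \<Rightarrow> real" where
  "\<alpha> n = (r n)\<^sup>2 / R\<^sup>2"

lemma \<alpha>_nonneg: "0 \<le> \<alpha> n"
  by (simp add: \<alpha>_def)

lemma nn_integral_packing:
  assumes [measurable]: "f \<in> borel_measurable borel"
  shows "(\<integral>\<^sup>+z\<in>ball 0 R. f z \<partial>lborel) = (\<Sum>n. \<integral>\<^sup>+z\<in>ball (c n) (r n). f z \<partial>lborel)"
proof -
  have "(\<integral>\<^sup>+z\<in>ball 0 R. f z \<partial>lborel) = (\<integral>\<^sup>+z. (\<Sum>n. f z * indicator (ball (c n) (r n)) z) \<partial>lborel)"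
  proof (rule nn_integral_cong_AE, use filling in eventually_elim)
    case (elim z)
    have "(\<Sum>n. indicator (ball (c n) (r n)) z :: ennreal) = indicator (\<Union>n. ball (c n) (r n)) z"
      by (rule suminf_indicator[OF disjoint])
    then show ?case using elim by (simp add: ennreal_suminf_cmult indicator_def)
  qed
  also have "\<dots> = (\<Sum>n. \<integral>\<^sup>+z\<in>ball (c n) (r n). f z \<partial>lborel)"
    by (rule nn_integral_suminf) measurable
  finally show ?thesis .
qed

lemma mult_\<alpha>: "ennreal (pi * R\<^sup>2) * (ennreal (\<alpha> n) * k) = ennreal (pi * (r n)\<^sup>2) * k"
proof -
  have "ennreal (pi * R\<^sup>2) * ennreal (\<alpha> n) = ennreal (pi * R\<^sup>2 * \<alpha> n)"
    using \<alpha>_nonneg by (intro ennreal_mult[symmetric]) auto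
  also have "pi * R\<^sup>2 * \<alpha> n = pi * (r n)\<^sup>2" using R by (simp add: \<alpha>_def)
  finally show ?thesis by (simp only: mult.assoc[symmetric])
qed

lemma piR: "ennreal (pi * R\<^sup>2) \<noteq> 0" "ennreal (pi * R\<^sup>2) \<noteq> top"
  using R by (auto simp: ennreal_eq_0_iff not_le)

lemma suminf_\<alpha>: "(\<Sum>n. ennreal (\<alpha> n)) = 1"
proof -
  have "ennreal (pi * R\<^sup>2) * (\<Sum>n. ennreal (\<alpha> n)) = (\<Sum>n. ennreal (pi * R\<^sup>2) * (ennreal (\<alpha> n) * 1))"
    by (simp add: ennreal_suminf_cmult)
  also have "\<dots> = (\<Sum>n. \<integral>\<^sup>+z\<in>ball (c n) (r n). 1 \<partial>lborel)"
    unfolding mult_\<alpha> by (subst nn_integral_ball_const[OF r_nonneg]) simp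
  also have "\<dots> = ennreal (pi * R\<^sup>2) * 1"
  proof -
    have "(\<Sum>n. \<integral>\<^sup>+z\<in>ball (c n) (r n). 1 \<partial>lborel) = (\<integral>\<^sup>+z\<in>ball (0::complex) R. 1 \<partial>lborel)"
      by (rule nn_integral_packing[symmetric]) measurable
    also have "\<dots> = ennreal (pi * R\<^sup>2) * 1"
      using R by (intro nn_integral_ball_const) auto
    finally show ?thesis .
  qed
  finally show ?thesis by (subst (asm) ennreal_mult_cancel_left) (use piR in blast)
qed

lemma ball_bound: "cmod (c n) + r n \<le> R"
proof -
  have "ball (c n) (r n) \<subseteq> cball 0 R"
    using ball_subset[of n] ball_subset_cball by blast
  \<comment> \<open>For radius 0 the disc is empty and the inclusion says nothing about the centre,
    hence the appeal to \<open>c_less\<close>.\<close>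
  then show ?thesis using r_nonneg[of n] c_less[of n]
    by (cases "r n = 0") (auto simp: ball_subset_cball_iff)
qed

text \<open>Seen from outside, each packing disc acts as its atom and the large disc as a mass at 0.
  Both sides, multiplied by the area, are therefore the potential of Lebesgue measure on the large
  disc.\<close>

lemma suminf_nlog_eq:
  assumes "R \<le> cmod z" "cmod z + R \<le> S"
  shows "(\<Sum>n. ennreal (\<alpha> n) * nlog (cmod (z - c n) / S)) = nlog (cmod z / S)"
proof -
  have "ennreal (pi * R\<^sup>2) * (\<Sum>n. ennreal (\<alpha> n) * nlog (cmod (z - c n) / S))
      = (\<Sum>n. ennreal (pi * R\<^sup>2) * (ennreal (\<alpha> n) * nlog (cmod (z - c n) / S)))"
    by (simp add: ennreal_suminf_cmult)
  also have "\<dots> = (\<Sum>n. \<integral>\<^sup>+\<zeta>\<in>ball (c n) (r n). nlog (cmod (z - \<zeta>) / S) \<partial>lborel)"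
  proof (intro suminf_cong)
    fix n
    have 1: "r n \<le> cmod (z - c n)"
      using norm_triangle_ineq2[of z "c n"] ball_bound[of n] assms(1) by linarith
    have 2: "cmod (z - c n) + r n \<le> S"
      using norm_triangle_ineq4[of z "c n"] ball_bound[of n] assms(2) by linarith
    show "ennreal (pi * R\<^sup>2) * (ennreal (\<alpha> n) * nlog (cmod (z - c n) / S)) =
        (\<integral>\<^sup>+\<zeta>\<in>ball (c n) (r n). nlog (cmod (z - \<zeta>) / S) \<partial>lborel)"
      unfolding mult_\<alpha> using nn_integral_nlog_ball_eq[OF 2 1 r_nonneg] by simp
  qed
  also have "\<dots> = (\<integral>\<^sup>+\<zeta>\<in>ball 0 R. nlog (cmod (z - \<zeta>) / S) \<partial>lborel)"
    by (rule nn_integral_packing[symmetric]) measurable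
  also have "\<dots> = ennreal (pi * R\<^sup>2) * nlog (cmod z / S)"
    using nn_integral_nlog_ball_eq[of z 0 R S] assms R by simp
  finally show ?thesis by (subst (asm) ennreal_mult_cancel_left) (use piR in blast)
qed

text \<open>Concentrating the area of each packing disc at its centre can only raise the integral of
  \<open>nlog\<close>, and the uniform mass already has the value on the left as a lower
  bound.\<close>

lemma suminf_nlog_ge:
  assumes "cmod z \<le> R" "cmod z + R \<le> S"
  shows "nlog (R / S) \<le> (\<Sum>n. ennreal (\<alpha> n) * nlog (cmod (z - c n) / S))"
proof -
  have "ennreal (pi * R\<^sup>2) * nlog (R / S) \<le> (\<integral>\<^sup>+\<zeta>\<in>ball 0 R. nlog (cmod (z - \<zeta>) / S) \<partial>lborel)"
    using nn_integral_nlog_ball_ge[of z 0 R S] assms R by simp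
  also have "\<dots> = (\<Sum>n. \<integral>\<^sup>+\<zeta>\<in>ball (c n) (r n). nlog (cmod (z - \<zeta>) / S) \<partial>lborel)"
    by (rule nn_integral_packing) measurable
  also have "\<dots> \<le> (\<Sum>n. ennreal (pi * R\<^sup>2) * (ennreal (\<alpha> n) * nlog (cmod (z - c n) / S)))"
  proof (intro suminf_le summableI)
    fix n
    have "cmod (z - c n) + r n \<le> S"
      using norm_triangle_ineq4[of z "c n"] ball_bound[of n] assms(2) by linarith
    then show "(\<integral>\<^sup>+\<zeta>\<in>ball (c n) (r n). nlog (cmod (z - \<zeta>) / S) \<partial>lborel)
        \<le> ennreal (pi * R\<^sup>2) * (ennreal (\<alpha> n) * nlog (cmod (z - c n) / S))"
      unfolding mult_\<alpha> by (rule nn_integral_nlog_ball_le[OF _ r_nonneg])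
  qed
  also have "\<dots> = ennreal (pi * R\<^sup>2) * (\<Sum>n. ennreal (\<alpha> n) * nlog (cmod (z - c n) / S))"
    by (simp add: ennreal_suminf_cmult)
  finally show ?thesis using piR by (simp add: ennreal_mult_le_mult_iff)
qed

end

section \<open>The chordal kernel on the projective line\<close>

text \<open>The exponential of the local Fubini-Study potential, in either chart.\<close>

definition fs :: "complex \<Rightarrow> real" where
  "fs z = sqrt (1 + (cmod z)\<^sup>2)"

lemma fs_ge_1: "1 \<le> fs z" and fs_pos [simp]: "0 < fs z" and fs_nz [simp]: "fs z \<noteq> 0"
  and fs_0 [simp]: "fs 0 = 1"
proof -
  show "1 \<le> fs z" by (simp add: fs_def)
  then show "0 < fs z" "fs z \<noteq> 0" by linarith+
qed (simp add: fs_def)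

lemma ln_fs: "ln (fs z) = 1 / 2 * ln (1 + (cmod z)\<^sup>2)"
proof -
  have "0 < 1 + (cmod z)\<^sup>2" by (simp add: add_pos_nonneg)
  then show ?thesis by (simp add: fs_def ln_sqrt)
qed

lemma ln_fs_nonneg: "0 \<le> ln (fs z)"
  using fs_ge_1 by simp

lemma fs_continuous [continuous_intros]: "continuous_on A fs"
  unfolding fs_def[abs_def] by (intro continuous_intros)

lemma fs_measurable [measurable]: "fs \<in> borel_measurable borel"
  by (intro borel_measurable_continuous_onI continuous_intros)

lemma fs_mono: "cmod z \<le> cmod w \<Longrightarrow> fs z \<le> fs w"
  by (simp add: fs_def power_mono)

lemma fs_divide: "z \<noteq> 0 \<Longrightarrow> fs (1 / z) = fs z / cmod z"
proof -
  assume z: "z \<noteq> 0"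
  have "1 + (cmod (1 / z))\<^sup>2 = (1 + (cmod z)\<^sup>2) / (cmod z)\<^sup>2"
    using z by (simp add: norm_divide field_simps power2_eq_square)
  then show ?thesis by (simp add: fs_def real_sqrt_divide)
qed

text \<open>Cauchy-Schwarz for the vectors (|z|, 1) and (1, |p|). It bounds the chordal kernel by 1
  and also supplies the scale \<open>S\<close> of the circle lemmas.\<close>

lemma cmod_add_le_fs: "cmod z + cmod p \<le> fs z * fs p"
proof -
  have "(cmod z + cmod p)\<^sup>2 \<le> (1 + (cmod z)\<^sup>2) * (1 + (cmod p)\<^sup>2)"
  proof -
    have "(1 + (cmod z)\<^sup>2) * (1 + (cmod p)\<^sup>2) - (cmod z + cmod p)\<^sup>2 = (1 - cmod z * cmod p)\<^sup>2"
      by (simp add: power2_eq_square algebra_simps)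
    then show ?thesis by (metis diff_ge_0_iff_ge zero_le_power2)
  qed
  then have "cmod z + cmod p \<le> sqrt ((1 + (cmod z)\<^sup>2) * (1 + (cmod p)\<^sup>2))"
    by (rule real_le_rsqrt)
  then show ?thesis by (simp add: fs_def real_sqrt_mult)
qed

text \<open>The chordal distance on the Riemann sphere, normalised to diameter 1.\<close>

definition chord :: "cp1 \<Rightarrow> cp1 \<Rightarrow> real" where
  "chord x y = (case x of
     None \<Rightarrow> (case y of None \<Rightarrow> 0 | Some p \<Rightarrow> 1 / fs p)
   | Some w \<Rightarrow> (case y of None \<Rightarrow> 1 / fs w | Some p \<Rightarrow> cmod (w - p) / (fs w * fs p)))"

text \<open>Inversion is an isometry of the chordal distance, so both charts show the same formula
  and later proofs can treat them together.\<close>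

lemma chord_chart:
  assumes "\<kappa> \<in> charts"
  shows "chord (\<kappa> z) (\<kappa> p) = cmod (z - p) / (fs z * fs p)"
proof -
  have "cmod (1 / z - 1 / p) / (fs (1 / z) * fs (1 / p)) = cmod (z - p) / (fs z * fs p)"
    if "z \<noteq> 0" "p \<noteq> 0"
  proof -
    have "1 / z - 1 / p = (p - z) / (z * p)" using that by (simp add: field_simps)
    then have "cmod (1 / z - 1 / p) = cmod (z - p) / (cmod z * cmod p)"
      by (simp add: norm_divide norm_mult norm_minus_commute)
    then show ?thesis using that by (simp add: fs_divide field_simps)
  qed
  then show ?thesis using assms
    by (auto simp: charts_def chart_inf_def chord_def fs_divide)
qed

text \<open>Each chart misses exactly one point. From there the kernel is a pure Fubini-Study factor
  and cancels against the local potential.\<close>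

lemma chord_chart_outside:
  assumes "\<kappa> \<in> charts" "y \<notin> range \<kappa>"
  shows "chord (\<kappa> z) y = 1 / fs z"
proof (cases "\<kappa> = Some")
  case True
  then have "y = None" using assms by (cases y) auto
  then show ?thesis using True by (simp add: chord_def)
next
  case False
  then have \<kappa>: "\<kappa> = chart_inf" using assms by (simp add: charts_def)
  have "y = Some 0"
  proof (rule ccontr)
    assume "y \<noteq> Some 0"
    then have "y = chart_inf (case y of None \<Rightarrow> 0 | Some w \<Rightarrow> 1 / w)"
      by (cases y) (auto simp: chart_inf_def)
    then show False using assms \<kappa> by blast
  qed
  then show ?thesis unfolding \<kappa>
    by (auto simp: chord_def chart_inf_def fs_divide norm_divide)
qed

lemma chord_nonneg: "0 \<le> chord x y"
  by (auto simp: chord_def less_imp_le split: option.split)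

lemma chord_le_1: "chord x y \<le> 1"
proof -
  have "cmod (w - p) / (fs w * fs p) \<le> 1" for w p
    using cmod_add_le_fs[of w p] norm_triangle_ineq4[of w p] by (simp add: divide_le_eq_1)
  then show ?thesis using fs_ge_1 by (auto simp: chord_def split: option.split)
qed

section \<open>Borel structure of the projective line\<close>

definition cp1_borel :: "cp1 measure" where
  "cp1_borel = sigma UNIV {U. openin cp1_top U}"

lemma space_cp1_borel [simp]: "space cp1_borel = UNIV"
  and sets_cp1_borel: "sets cp1_borel = sigma_sets UNIV {U. openin cp1_top U}"
  by (simp_all add: cp1_borel_def)

lemma openin_sets_cp1: "openin cp1_top U \<Longrightarrow> U \<in> sets cp1_borel"
  by (simp add: sets_cp1_borel)

lemma chart_measurable:
  assumes "\<kappa> \<in> charts" shows "\<kappa> \<in> borel \<rightarrow>\<^sub>M cp1_borel"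
  unfolding cp1_borel_def
  using assms by (intro measurable_measure_of) (auto simp: openin_cp1_top_iff)

lemma Some_measurable [measurable]: "Some \<in> borel \<rightarrow>\<^sub>M cp1_borel"
  and chart_inf_measurable [measurable]: "chart_inf \<in> borel \<rightarrow>\<^sub>M cp1_borel"
  by (simp_all add: chart_measurable charts_def)

lemma openin_Some_image: "open V \<Longrightarrow> openin cp1_top (Some ` V)"
  by (auto simp: cp1_top_def openin_Alexandroff_compactification)

lemma None_measurable [measurable]: "{None} \<in> sets cp1_borel"
proof -
  have "Some ` UNIV \<in> sets cp1_borel" by (intro openin_sets_cp1 openin_Some_image) simp
  then have "space cp1_borel - Some ` UNIV \<in> sets cp1_borel" by (rule sets.compl_sets)
  moreover have "space cp1_borel - Some ` UNIV = {None}" by (auto simp: UNIV_option_conv)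
  ultimately show ?thesis by simp
qed

lemma the_measurable [measurable]: "the \<in> cp1_borel \<rightarrow>\<^sub>M borel"
proof (rule borel_measurableI)
  fix V :: "complex set" assume V: "open V"
  have S: "Some ` V \<in> sets cp1_borel" using V by (intro openin_sets_cp1 openin_Some_image)
  \<comment> \<open>\<open>the None\<close> is some unspecified complex number, so
    \<open>None\<close> belongs to the preimage or not; both cases are measurable.\<close>
  have "the -` V \<inter> space cp1_borel = Some ` V \<union> (if the None \<in> V then {None} else {})"
  proof (intro set_eqI)
    fix x :: cp1
    show "x \<in> the -` V \<inter> space cp1_borel \<longleftrightarrow> x \<in> Some ` V \<union> (if the None \<in> V then {None} else {})"
      by (cases x) auto
  qed
  then show "the -` V \<inter> space cp1_borel \<in> sets cp1_borel"
    using S sets.Un[OF S None_measurable] by auto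
qed

lemma chord_measurable [measurable (raw)]:
  assumes [measurable]: "f \<in> M \<rightarrow>\<^sub>M cp1_borel" "g \<in> M \<rightarrow>\<^sub>M cp1_borel"
  shows "(\<lambda>x. chord (f x) (g x)) \<in> borel_measurable M"
proof -
  have eq: "chord x y = (if x \<in> {None} then (if y \<in> {None} then 0 else 1 / fs (the y))
      else (if y \<in> {None} then 1 / fs (the x) else cmod (the x - the y) / (fs (the x) * fs (the y))))" for x y
    by (cases x; cases y) (auto simp: chord_def)
  show ?thesis unfolding eq by measurable
qed

lemma chart_inf_divide: "z \<noteq> 0 \<Longrightarrow> chart_inf z = Some (1 / z)"
  by (simp add: chart_inf_def)

lemma chart_inf_in_charts: "chart_inf \<in> charts"
  by (simp add: charts_def)

lemma chart_inf_inverse: "w \<noteq> 0 \<Longrightarrow> Some w = chart_inf (1 / w)"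
  by (simp add: chart_inf_def)

lemma nlog_chord_measurable: "(\<lambda>y. nlog (chord x y)) \<in> borel_measurable cp1_borel"
  by measurable

section \<open>Potentials of probability measures\<close>

text \<open>The Green potential of a probability measure: in a chart the factors \<open>fs z\<close>
  cancel because the total mass is 1, leaving an ordinary logarithmic potential up to a
  constant.\<close>

definition pot :: "real \<Rightarrow> cp1 measure \<Rightarrow> cp1 \<Rightarrow> ereal" where
  "pot C \<mu> x = ereal C - enn2ereal (\<integral>\<^sup>+y. nlog (chord x y) \<partial>\<mu>)"

text \<open>Superlevel sets are closed along sequences; lower semicontinuity of \<open>I\<close> is
  assumed in the form that Fatou's lemma delivers.\<close>

lemma usc_minus_lsc:
  fixes g :: "'a::metric_space \<Rightarrow> real" and I :: "'a \<Rightarrow> ennreal"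
  assumes g: "continuous_on UNIV g"
    and I: "\<And>X z. X \<longlonglongrightarrow> z \<Longrightarrow> I z \<le> liminf (\<lambda>n. I (X n))"
  shows "open {z. ereal (g z) - enn2ereal (I z) < k}"
proof (cases k)
  case (real k')
  \<comment> \<open>Moving the subtraction to the other side leaves an inequality in
    \<open>ennreal\<close> that also covers infinite \<open>I z\<close>.\<close>
  have iff: "k \<le> ereal (g z) - enn2ereal (I z) \<longleftrightarrow> k' \<le> g z \<and> I z \<le> ennreal (g z - k')" for z
  proof (cases "I z")
    case (real i)
    then show ?thesis using \<open>k = ereal k'\<close> by (cases "k' \<le> g z") (auto simp: ennreal_le_iff)
  qed (auto simp: \<open>k = ereal k'\<close> top_unique)
  have "closed {z. k \<le> ereal (g z) - enn2ereal (I z)}"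
    unfolding closed_sequential_limits
  proof (intro allI impI, elim conjE)
    fix X z assume X: "\<forall>n. X n \<in> {z. k \<le> ereal (g z) - enn2ereal (I z)}" "X \<longlonglongrightarrow> z"
    have gl: "(\<lambda>n. g (X n)) \<longlonglongrightarrow> g z"
      using g X(2) continuous_on_tendsto_compose[OF g X(2)] by simp
    have "k' \<le> g z" using X(1) iff by (intro LIMSEQ_le_const[OF gl]) auto
    moreover have "I z \<le> ennreal (g z - k')"
    proof -
      have "I z \<le> liminf (\<lambda>n. I (X n))" by (rule I[OF X(2)])
      also have "\<dots> \<le> liminf (\<lambda>n. ennreal (g (X n) - k'))"
        using X(1) iff by (intro Liminf_mono) auto
      also have "\<dots> = ennreal (g z - k')"
        by (intro lim_imp_Liminf tendsto_ennrealI tendsto_intros gl) auto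
      finally show ?thesis .
    qed
    ultimately show "z \<in> {z. k \<le> ereal (g z) - enn2ereal (I z)}" using iff by simp
  qed
  moreover have "{z. ereal (g z) - enn2ereal (I z) < k} = - {z. k \<le> ereal (g z) - enn2ereal (I z)}"
    by auto
  ultimately show ?thesis by (simp add: open_Compl)
next
  case PInf
  have "ereal (g z) - enn2ereal (I z) < \<infinity>" for z by (cases "I z") auto
  then show ?thesis using PInf by simp
qed simp

text \<open>The kernel is continuous into \<open>ennreal\<close> for each fixed \<open>y\<close>, so
  this is Fatou's lemma.\<close>

lemma nn_integral_chord_lsc:
  assumes \<kappa>: "\<kappa> \<in> charts" and \<mu>: "sets \<mu> = sets cp1_borel" and X: "X \<longlonglongrightarrow> z"
  shows "(\<integral>\<^sup>+y. nlog (chord (\<kappa> z) y) \<partial>\<mu>) \<le> liminf (\<lambda>n. \<integral>\<^sup>+y. nlog (chord (\<kappa> (X n)) y) \<partial>\<mu>)"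
proof -
  have [measurable_cong]: "sets \<mu> = sets cp1_borel" by (rule \<mu>)
  have "(\<lambda>n. nlog (chord (\<kappa> (X n)) y)) \<longlonglongrightarrow> nlog (chord (\<kappa> z) y)" for y
  proof (rule tendsto_nlog, cases "y \<in> range \<kappa>")
    case True
    then obtain p where y: "y = \<kappa> p" by blast
    show "(\<lambda>n. chord (\<kappa> (X n)) y) \<longlonglongrightarrow> chord (\<kappa> z) y"
      unfolding y chord_chart[OF \<kappa>]
      by (intro tendsto_intros X continuous_on_tendsto_compose[OF fs_continuous[of UNIV] X]) auto
  next
    case False
    show "(\<lambda>n. chord (\<kappa> (X n)) y) \<longlonglongrightarrow> chord (\<kappa> z) y"
      unfolding chord_chart_outside[OF \<kappa> False]
      by (intro tendsto_intros continuous_on_tendsto_compose[OF fs_continuous[of UNIV] X]) auto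
  qed
  then have "(\<integral>\<^sup>+y. nlog (chord (\<kappa> z) y) \<partial>\<mu>) = (\<integral>\<^sup>+y. liminf (\<lambda>n. nlog (chord (\<kappa> (X n)) y)) \<partial>\<mu>)"
    by (intro nn_integral_cong) (metis lim_imp_Liminf trivial_limit_sequentially)
  also have "\<dots> \<le> liminf (\<lambda>n. \<integral>\<^sup>+y. nlog (chord (\<kappa> (X n)) y) \<partial>\<mu>)"
    by (rule nn_integral_liminf) measurable
  finally show ?thesis .
qed

section \<open>The sub-mean inequality for potentials\<close>

text \<open>\<open>circle_mean\<close> integrates positive and negative parts separately. The
  pointwise identity below rearranges these without subtraction, and the positive part is finite
  since it is at most \<open>B\<close>.\<close>

lemma circle_mean_eq:
  assumes f: "\<And>t. f (a + of_real r * cis t) = ereal B - enn2ereal (J t)"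
    and J [measurable]: "J \<in> borel_measurable borel" and B: "0 \<le> B"
  shows "circle_mean f a r = (ereal (2 * pi * B) - enn2ereal (\<integral>\<^sup>+t\<in>{0..2*pi}. J t \<partial>lborel)) / ereal (2 * pi)"
proof -
  define P where "P = (\<integral>\<^sup>+t\<in>{0..2*pi}. e2ennreal (ereal B - enn2ereal (J t)) \<partial>lborel)"
  define Q where "Q = (\<integral>\<^sup>+t\<in>{0..2*pi}. e2ennreal (- (ereal B - enn2ereal (J t))) \<partial>lborel)"
  define K where "K = (\<integral>\<^sup>+t\<in>{0..2*pi}. J t \<partial>lborel)"
  have BI: "(\<integral>\<^sup>+t\<in>{0..2*pi}. ennreal B \<partial>lborel) = ennreal (2 * pi * B)"
    using B by (subst nn_integral_cmult) (auto simp: ennreal_mult mult.commute)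
  \<comment> \<open>Positive part minus negative part equals \<open>B - j\<close>, rewritten with
    sums only so that it survives \<open>j = top\<close>.\<close>
  have pt: "e2ennreal (ereal B - enn2ereal j) + j = e2ennreal (- (ereal B - enn2ereal j)) + ennreal B" for j
  proof (cases j)
    case (real i)
    then show ?thesis using B by (cases "i \<le> B") (auto simp: ennreal_neg simp flip: ennreal_plus ennreal.abs_eq)
  qed (auto simp: e2ennreal_neg)
  have "P + K = (\<integral>\<^sup>+t\<in>{0..2*pi}. e2ennreal (ereal B - enn2ereal (J t)) + J t \<partial>lborel)"
    unfolding P_def K_def by (subst nn_integral_add[symmetric]) (auto simp: distrib_right)
  also have "\<dots> = (\<integral>\<^sup>+t\<in>{0..2*pi}. e2ennreal (- (ereal B - enn2ereal (J t))) + ennreal B \<partial>lborel)"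
    by (simp only: pt)
  also have "\<dots> = Q + ennreal (2 * pi * B)"
    unfolding Q_def BI[symmetric] by (subst nn_integral_add[symmetric]) (auto simp: distrib_right)
  finally have eq: "P + K = Q + ennreal (2 * pi * B)" .
  have "P \<le> (\<integral>\<^sup>+t\<in>{0..2*pi}. ennreal B \<partial>lborel)"
    unfolding P_def
  proof (intro nn_integral_mono mult_right_mono)
    fix t
    have "ereal B - enn2ereal (J t) \<le> ereal B" by (cases "J t") auto
    then have "e2ennreal (ereal B - enn2ereal (J t)) \<le> e2ennreal (ereal B)" by (rule e2ennreal_mono)
    then show "e2ennreal (ereal B - enn2ereal (J t)) \<le> ennreal B" by (simp add: ennreal.abs_eq)
  qed simp
  then obtain p where p: "P = ennreal p" "0 \<le> p"
    unfolding BI by (cases P) (auto simp: top_unique)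
  have "enn2ereal P - enn2ereal Q = ereal (2 * pi * B) - enn2ereal K"
  proof (cases K)
    case (real k)
    then have "Q \<noteq> top" using eq p by (auto simp flip: ennreal_plus)
    then obtain q where q: "Q = ennreal q" "0 \<le> q" by (cases Q) auto
    have "p + k = q + 2 * pi * B"
      using eq real p q B by (simp flip: ennreal_plus)
    then show ?thesis using real p q by simp
  next
    case top
    then have "Q + ennreal (2 * pi * B) = top" using eq by simp
    then have "Q = top" by (simp add: ennreal_add_eq_top)
    then show ?thesis using top p by simp
  qed
  then show ?thesis by (simp add: circle_mean_def f P_def Q_def K_def)
qed

lemma circle_mean_mono:
  assumes "0 < r" "\<And>t. f (a + of_real r * cis t) \<le> g (a + of_real r * cis t)"
  shows "circle_mean f a r \<le> circle_mean g a r"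
  unfolding circle_mean_def using assms
  by (intro ereal_divide_right_mono ereal_minus_mono)
    (auto intro!: nn_integral_mono mult_right_mono e2ennreal_mono simp: less_eq_ennreal.rep_eq[symmetric])

lemma circle_mean_real:
  assumes e: "continuous_on {0..2*pi} (\<lambda>t. e (a + of_real r * cis t))"
    and I: "((\<lambda>t. e (a + of_real r * cis t)) has_integral I) {0..2*pi}"
  shows "circle_mean (\<lambda>z. ereal (e z)) a r = ereal (I / (2 * pi))"
proof -
  let ?e = "\<lambda>t. indicator {0..2*pi} t * e (a + of_real r * cis t)"
  have int: "set_integrable lborel {0..2*pi} (\<lambda>t. e (a + of_real r * cis t))"
    by (rule borel_integrable_atLeastAtMost'[OF e])
  then have int': "integrable lborel ?e" by (simp add: set_integrable_def)
  have "(LINT t:{0..2*pi}|lborel. e (a + of_real r * cis t)) = I"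
    using set_borel_integral_eq_integral(2)[OF int] I by (simp add: integral_unique)
  then have eq: "integral\<^sup>L lborel ?e = I" by (simp add: set_lebesgue_integral_def)
  have 1: "(\<integral>\<^sup>+t. ennreal (?e t) \<partial>lborel) = (\<integral>\<^sup>+t\<in>{0..2*pi}. e2ennreal (ereal (e (a + of_real r * cis t))) \<partial>lborel)"
    by (intro nn_integral_cong) (auto simp: indicator_def ennreal.abs_eq e2ennreal_neg)
  have 2: "(\<integral>\<^sup>+t. ennreal (- ?e t) \<partial>lborel) = (\<integral>\<^sup>+t\<in>{0..2*pi}. e2ennreal (- ereal (e (a + of_real r * cis t))) \<partial>lborel)"
    by (intro nn_integral_cong) (auto simp: indicator_def ennreal.abs_eq e2ennreal_neg)
  from int' have fin: "(\<integral>\<^sup>+t. ennreal (?e t) \<partial>lborel) \<noteq> top" "(\<integral>\<^sup>+t. ennreal (- ?e t) \<partial>lborel) \<noteq> top"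
    unfolding real_integrable_def by auto
  from fin(1) obtain p where p: "(\<integral>\<^sup>+t. ennreal (?e t) \<partial>lborel) = ennreal p" "0 \<le> p"
    unfolding top.not_eq_extremum less_top_ennreal by blast
  from fin(2) obtain q where q: "(\<integral>\<^sup>+t. ennreal (- ?e t) \<partial>lborel) = ennreal q" "0 \<le> q"
    unfolding top.not_eq_extremum less_top_ennreal by blast
  note pq = p q
  have "I = p - q"
    using real_lebesgue_integral_def[OF int'] eq pq by simp
  then show ?thesis
    unfolding circle_mean_def 1[symmetric] 2[symmetric] using pq by simp
qed

lemma pot_local:
  "local_pot (pot C \<mu>) \<kappa> z = ereal (C + ln (fs z)) - enn2ereal (\<integral>\<^sup>+y. nlog (chord (\<kappa> z) y) \<partial>\<mu>)"
  by (cases "(\<integral>\<^sup>+y. nlog (chord (\<kappa> z) y) \<partial>\<mu>)") (auto simp: local_pot_def pot_def ln_fs)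

text \<open>The factor \<open>fs z\<close> cancels the one in the kernel and leaves |z - p| divided
  by a constant, to which the circle estimate applies. \<open>E\<close> bounds \<open>fs\<close> on
  the disc and so keeps the argument at most 1.\<close>

lemma nn_integral_chord_circle_le:
  assumes \<kappa>: "\<kappa> \<in> charts" and r: "0 < r" and E: "fs (of_real (cmod a + r)) \<le> E"
  shows "(\<integral>\<^sup>+t\<in>{0..2*pi}. nlog (fs (a + of_real r * cis t) / E * chord (\<kappa> (a + of_real r * cis t)) y) \<partial>lborel)
    \<le> ennreal (2 * pi) * nlog (fs a / E * chord (\<kappa> a) y)"
proof -
  have E0: "0 < E" using E fs_ge_1[of "of_real (cmod a + r)"] by linarith
  show ?thesis
  proof (cases "y \<in> range \<kappa>")
    case True
    then obtain p where y: "y = \<kappa> p" by blast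
    have eq: "fs z / E * chord (\<kappa> z) y = cmod (z - p) / (E * fs p)" for z
      unfolding y chord_chart[OF \<kappa>] using E0 by (simp add: field_simps)
    have nM: "cmod (of_real (cmod a + r)) = cmod a + r" using r by (simp only: norm_of_real) simp
    have "cmod a + r + cmod p \<le> fs (of_real (cmod a + r)) * fs p"
      using cmod_add_le_fs[of "of_real (cmod a + r)" p] unfolding nM .
    also have "\<dots> \<le> E * fs p" using E by (intro mult_right_mono) (auto simp: less_imp_le)
    finally have "cmod a + r + cmod p \<le> E * fs p" .
    then have S: "cmod (a - p) + cmod (of_real r :: complex) \<le> E * fs p"
      using norm_triangle_ineq4[of a p] r by simp
    have "(\<integral>\<^sup>+t\<in>{0..2*pi}. nlog (cmod ((a - p) + of_real r * cis t) / (E * fs p)) \<partial>lborel)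
      \<le> ennreal (2 * pi) * nlog (max (cmod (a - p)) (cmod (of_real r :: complex)) / (E * fs p))"
      by (rule nn_integral_nlog_circle_le[OF S])
    \<comment> \<open>Forgetting the radius in the maximum is where equality becomes the sub-mean
      inequality.\<close>
    also have "\<dots> \<le> ennreal (2 * pi) * nlog (cmod (a - p) / (E * fs p))"
      using E0 by (intro mult_left_mono nlog_antimono divide_right_mono) (auto simp: less_imp_le)
    finally show ?thesis unfolding eq by (simp add: algebra_simps)
  next
    case False
    have eq: "fs z / E * chord (\<kappa> z) y = 1 / E" for z
      unfolding chord_chart_outside[OF \<kappa> False] by simp
    show ?thesis unfolding eq by (subst nn_integral_cmult) (auto simp: mult.commute)
  qed
qed

text \<open>On the disc in question the local potential is a constant minus a nonnegative integral
  \<open>J\<close>. Tonelli then reduces the claim to a single kernel.\<close>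

lemma pot_submean:
  assumes \<kappa>: "\<kappa> \<in> charts" and \<mu>: "sets \<mu> = sets cp1_borel" "finite_measure \<mu>" "emeasure \<mu> UNIV = 1" and r: "0 < r"
  shows "local_pot (pot C \<mu>) \<kappa> a \<le> circle_mean (local_pot (pot C \<mu>) \<kappa>) a r"
proof -
  interpret \<mu>: finite_measure \<mu> by fact
  have space: "space \<mu> = UNIV" using sets_eq_imp_space_eq[OF \<mu>(1)] by simp
  interpret pair_sigma_finite lborel \<mu> ..
  have [measurable_cong]: "sets \<mu> = sets cp1_borel" by (rule \<mu>(1))
  have [measurable]: "\<kappa> \<in> borel \<rightarrow>\<^sub>M cp1_borel" by (rule chart_measurable[OF \<kappa>])
  define E where "E = fs (of_real (cmod a + r))"
  define B where "B = \<bar>C\<bar> + ln E"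
  \<comment> \<open>The exponential factor shifts the constant by |C| - C: it makes \<open>B\<close>
    nonnegative, as \<open>circle_mean_eq\<close> demands, while \<open>ln E' = B - C\<close> and
    \<open>E'\<close> remains at least \<open>E\<close>.\<close>
  define E' where "E' = E * exp (\<bar>C\<bar> - C)"
  have E1: "1 \<le> E" by (simp add: E_def fs_ge_1)
  have EE': "E \<le> E'" using E1 mult_left_mono[of 1 "exp (\<bar>C\<bar> - C)" E] by (simp add: E'_def)
  have lnE': "ln E' = B - C" using E1 by (simp add: E'_def B_def ln_mult)
  have E'0: "0 < E'" using E1 EE' by linarith
  have B0: "0 \<le> B" using E1 by (simp add: B_def)
  define z where "z t = a + of_real r * cis t" for t
  have [measurable]: "z \<in> borel_measurable borel" unfolding z_def by measurable
  define J where "J w = (\<integral>\<^sup>+y. nlog (fs w / E' * chord (\<kappa> w) y) \<partial>\<mu>)" for w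
  have loc: "local_pot (pot C \<mu>) \<kappa> w = ereal B - enn2ereal (J w)" if w: "cmod w \<le> cmod a + r" for w
  proof -
    have "cmod (of_real (cmod a + r)) = cmod a + r" using r by (simp only: norm_of_real) simp
    then have "fs w \<le> E" unfolding E_def using w by (intro fs_mono) (simp only:)
    then have fw: "fs w \<le> E'" using EE' by linarith
    have "J w = (\<integral>\<^sup>+y. nlog (fs w / E') + nlog (chord (\<kappa> w) y) \<partial>\<mu>)"
      unfolding J_def using fw E'0 by (intro nn_integral_cong nlog_mult chord_le_1) auto
    also have "\<dots> = nlog (fs w / E') + (\<integral>\<^sup>+y. nlog (chord (\<kappa> w) y) \<partial>\<mu>)"
      by (subst nn_integral_add) (auto simp: space \<mu>(3))
    also have "nlog (fs w / E') = ennreal (B - C - ln (fs w))"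
      using E'0 by (simp add: nlog_pos ln_div lnE')
    finally have J: "J w = ennreal (B - C - ln (fs w)) + (\<integral>\<^sup>+y. nlog (chord (\<kappa> w) y) \<partial>\<mu>)" .
    have "ln (fs w) \<le> ln E'" using fw E'0 by (subst ln_le_cancel_iff) auto
    then have "0 \<le> B - C - ln (fs w)" using lnE' by simp
    then show ?thesis unfolding pot_local J
      by (cases "\<integral>\<^sup>+y. nlog (chord (\<kappa> w) y) \<partial>\<mu>") (auto simp flip: ennreal_plus)
  qed
  have zle: "cmod (z t) \<le> cmod a + r" for t
    unfolding z_def using norm_triangle_ineq[of a "of_real r * cis t"] r by (simp add: norm_mult)
  have "(\<integral>\<^sup>+t\<in>{0..2*pi}. J (z t) \<partial>lborel)
      = (\<integral>\<^sup>+t. (\<integral>\<^sup>+y. nlog (fs (z t) / E' * chord (\<kappa> (z t)) y) * indicator {0..2*pi} t \<partial>\<mu>) \<partial>lborel)"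
    unfolding J_def by (intro nn_integral_cong nn_integral_multc[symmetric]) measurable
  also have "\<dots> = (\<integral>\<^sup>+y. (\<integral>\<^sup>+t\<in>{0..2*pi}. nlog (fs (z t) / E' * chord (\<kappa> (z t)) y) \<partial>lborel) \<partial>\<mu>)"
    by (rule Fubini'[symmetric]) measurable
  also have "\<dots> \<le> (\<integral>\<^sup>+y. ennreal (2 * pi) * nlog (fs a / E' * chord (\<kappa> a) y) \<partial>\<mu>)"
    unfolding z_def using EE' by (intro nn_integral_mono nn_integral_chord_circle_le[OF \<kappa> r]) (simp add: E_def)
  also have "\<dots> = ennreal (2 * pi) * J a"
    unfolding J_def by (rule nn_integral_cmult) measurable
  finally have le: "(\<integral>\<^sup>+t\<in>{0..2*pi}. J (z t) \<partial>lborel) \<le> ennreal (2 * pi) * J a" .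
  have "circle_mean (local_pot (pot C \<mu>) \<kappa>) a r
      = (ereal (2 * pi * B) - enn2ereal (\<integral>\<^sup>+t\<in>{0..2*pi}. J (z t) \<partial>lborel)) / ereal (2 * pi)"
  proof (rule circle_mean_eq[OF _ _ B0])
    show "local_pot (pot C \<mu>) \<kappa> (a + of_real r * cis t) = ereal B - enn2ereal (J (z t))" for t
      using loc[OF zle, of t] by (simp add: z_def)
    show "(\<lambda>t. J (z t)) \<in> borel_measurable borel" unfolding J_def by measurable
  qed
  also have "\<dots> \<ge> (ereal (2 * pi * B) - enn2ereal (ennreal (2 * pi) * J a)) / ereal (2 * pi)"
    using le by (intro ereal_divide_right_mono ereal_minus_mono) (auto simp: less_eq_ennreal.rep_eq)
  also (xtrans) have "(ereal (2 * pi * B) - enn2ereal (ennreal (2 * pi) * J a)) / ereal (2 * pi)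
      = local_pot (pot C \<mu>) \<kappa> a"
  proof -
    have "cmod a \<le> cmod a + r" using r by simp
    from loc[OF this] show ?thesis
      by (cases "J a") (auto simp: ennreal_mult_top diff_divide_distrib simp flip: ennreal_mult)
  qed
  finally show ?thesis .
qed

lemma pot_PSH:
  assumes \<mu>: "sets \<mu> = sets cp1_borel" "finite_measure \<mu>" "emeasure \<mu> UNIV = 1"
    and fin: "(\<integral>\<^sup>+y. nlog (chord x y) \<partial>\<mu>) < top"
  shows "pot C \<mu> \<in> PSH"
proof -
  have "usc cp1_top (pot C \<mu>)"
    unfolding usc_def
  proof (intro allI)
    fix k
    have "open (\<kappa> -` {x \<in> topspace cp1_top. pot C \<mu> x < k})" if "\<kappa> \<in> charts" for \<kappa>
      using usc_minus_lsc[of "\<lambda>_::complex. C", OF _ nn_integral_chord_lsc[OF that \<mu>(1)]]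
      by (simp add: pot_def vimage_def)
    then show "openin cp1_top {x \<in> topspace cp1_top. pot C \<mu> x < k}"
      unfolding openin_cp1_top_iff by blast
  qed
  moreover have "pot C \<mu> y < \<infinity>" for y
    unfolding pot_def by (cases "\<integral>\<^sup>+z. nlog (chord y z) \<partial>\<mu>") auto
  moreover have "pot C \<mu> \<noteq> (\<lambda>_. -\<infinity>)"
  proof
    assume "pot C \<mu> = (\<lambda>_. -\<infinity>)"
    then have "pot C \<mu> x = -\<infinity>" by simp
    then show False using fin unfolding pot_def by (cases "\<integral>\<^sup>+z. nlog (chord x z) \<partial>\<mu>") auto
  qed
  moreover have "subharmonic (local_pot (pot C \<mu>) \<kappa>)" if \<kappa>: "\<kappa> \<in> charts" for \<kappa>
    unfolding subharmonic_def
  proof (intro conjI allI impI)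
    have c: "continuous_on UNIV (\<lambda>z. C + ln (fs z))" by (intro continuous_intros) auto
    show "usc euclidean (local_pot (pot C \<mu>) \<kappa>)"
      unfolding usc_def pot_local using usc_minus_lsc[OF c nn_integral_chord_lsc[OF \<kappa> \<mu>(1)]] by simp
    show "local_pot (pot C \<mu>) \<kappa> z < \<infinity>" for z
      unfolding pot_local by (cases "\<integral>\<^sup>+y. nlog (chord (\<kappa> z) y) \<partial>\<mu>") auto
    show "local_pot (pot C \<mu>) \<kappa> a \<le> circle_mean (local_pot (pot C \<mu>) \<kappa>) a r" if "0 < r" for a r
      by (rule pot_submean[OF \<kappa> \<mu> that])
  qed
  ultimately show ?thesis by (auto simp: PSH_def)
qed

section \<open>The distributional Laplacian of the logarithm\<close>

lemma integrable_bounded_support: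
  fixes g :: "complex \<Rightarrow> real"
  assumes [measurable]: "g \<in> borel_measurable borel" and "\<And>z. \<bar>g z\<bar> \<le> M * indicator (cball 0 K) z"
  shows "integrable lborel g"
proof (rule Bochner_Integration.integrable_bound)
  have "emeasure lborel (cball (0::complex) K) < \<infinity>" by (rule emeasure_bounded_finite[OF bounded_cball])
  then show "integrable lborel (\<lambda>z::complex. M * indicator (cball 0 K) z :: real)" by simp
  show "AE z in lborel. norm (g z) \<le> norm (M * indicator (cball 0 K) z)"
    using assms(2) by (auto intro!: AE_I2 intro: order_trans[OF _ abs_ge_self])
qed simp

lemma continuous_compact_support_bounded:
  fixes g :: "complex \<Rightarrow> real"
  assumes "continuous_on UNIV g" "\<And>z. K < cmod z \<Longrightarrow> g z = 0"
  obtains M where "0 \<le> M" "\<And>z. \<bar>g z\<bar> \<le> M" "\<And>z. \<bar>g z\<bar> \<le> M * indicator (cball 0 K) z"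
proof -
  have "bounded (g ` cball 0 K)"
    using assms(1) by (intro compact_imp_bounded compact_continuous_image) (auto intro: continuous_on_subset)
  then obtain M where M: "0 < M" "\<And>z. z \<in> cball 0 K \<Longrightarrow> \<bar>g z\<bar> \<le> M"
    by (auto simp: bounded_pos)
  show thesis
  proof (rule that[of M])
    show "0 \<le> M" using M by simp
    show *: "\<bar>g z\<bar> \<le> M * indicator (cball 0 K) z" for z
      using M(2)[of z] assms(2)[of z] by (cases "z \<in> cball 0 K") auto
    show "\<bar>g z\<bar> \<le> M" for z using *[of z] M(1) by (cases "z \<in> cball 0 K") auto
  qed
qed

text \<open>By translation invariance the integral of every difference quotient vanishes.\<close>

lemma integral_line_derivative_0:
  fixes g g' :: "complex \<Rightarrow> real"
  assumes der: "\<And>z. ((\<lambda>h. g (z + of_real h * v)) has_real_derivative g' z) (at 0)"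
    and cg: "continuous_on UNIV g" and cg': "continuous_on UNIV g'" and v: "cmod v \<le> 1"
    and supp: "\<And>z. K < cmod z \<Longrightarrow> g z = 0" "\<And>z. K < cmod z \<Longrightarrow> g' z = 0"
  shows "(\<integral>z. g' z \<partial>lborel) = 0"
proof -
  have [measurable]: "g \<in> borel_measurable borel" "g' \<in> borel_measurable borel"
    using cg cg' by (auto intro: borel_measurable_continuous_onI)
  obtain M where M: "0 \<le> M" "\<And>z. \<bar>g' z\<bar> \<le> M"
    using continuous_compact_support_bounded[OF cg' supp(2)] by metis
  obtain Mg where Mg: "\<And>z. \<bar>g z\<bar> \<le> Mg * indicator (cball 0 K) z"
    using continuous_compact_support_bounded[OF cg supp(1)] by metis
  have ig: "integrable lborel g" by (rule integrable_bounded_support[OF _ Mg]) simp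
  define h where "h n = 1 / real (Suc n)" for n
  have h: "0 < h n" "h n \<le> 1" for n by (auto simp: h_def)
  have h0: "h \<longlonglongrightarrow> 0" unfolding h_def by (rule LIMSEQ_Suc[OF lim_1_over_n])
  define q where "q n z = (g (z + of_real (h n) * v) - g z) / h n" for n z
  have [measurable]: "q n \<in> borel_measurable borel" for n unfolding q_def by measurable
  have lim: "(\<lambda>n. q n z) \<longlonglongrightarrow> g' z" for z
  proof -
    have "((\<lambda>x. (g (z + of_real x * v) - g z) / x) \<longlongrightarrow> g' z) (at 0)"
      using der[of z] by (simp add: DERIV_def)
    then have "((\<lambda>n. (g (z + of_real (h n) * v) - g z) / h n) \<longlongrightarrow> g' z) sequentially"
      by (rule filterlim_compose) (use h h0 in \<open>auto simp: filterlim_at intro!: always_eventually; metis less_irrefl\<close>)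
    then show ?thesis by (simp add: q_def)
  qed
  \<comment> \<open>The shift has length at most 1. Hence both terms vanish outside radius
    \<open>K + 1\<close>, and inside the mean value theorem bounds the quotient by the
    derivative.\<close>
  have bd: "\<bar>q n z\<bar> \<le> M * indicator (cball 0 (K + 1)) z" for n z
  proof (cases "z \<in> cball 0 (K + 1)")
    case False
    have "cmod (of_real (h n) * v) \<le> 1"
      using h[of n] v mult_mono[of "h n" 1 "cmod v" 1] by (simp add: norm_mult)
    moreover have "cmod z \<le> cmod (z + of_real (h n) * v) + cmod (of_real (h n) * v)"
      using norm_triangle_ineq4[of "z + of_real (h n) * v" "of_real (h n) * v"] by simp
    ultimately have "K < cmod (z + of_real (h n) * v)" "K < cmod z" using False by auto
    then show ?thesis using supp(1) False by (simp add: q_def)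
  next
    case True
    have "((\<lambda>s. g (z + of_real s * v)) has_real_derivative g' (z + of_real t * v)) (at t)" for t
    proof -
      have "((\<lambda>s. g (z + of_real t * v + of_real (s - t) * v)) has_real_derivative g' (z + of_real t * v) * 1) (at t)"
        by (rule DERIV_chain2[where g="\<lambda>s. s - t" and f="\<lambda>x. g (z + of_real t * v + of_real x * v)"])
          (use der[of "z + of_real t * v"] in \<open>auto intro!: derivative_eq_intros\<close>)
      moreover have "z + of_real t * v + of_real (s - t) * v = z + of_real s * v" for s
        by (simp add: algebra_simps)
      ultimately show ?thesis by (simp only: mult_1_right)
    qed
    then obtain t where "g (z + of_real (h n) * v) - g (z + of_real 0 * v) = (h n - 0) * g' (z + of_real t * v)"
      using MVT2[OF h(1)[of n], of "\<lambda>s. g (z + of_real s * v)" "\<lambda>t. g' (z + of_real t * v)"] by blast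
    then have "q n z = g' (z + of_real t * v)" using h(1)[of n] by (simp add: q_def)
    then show ?thesis using M True by simp
  qed
  have "(\<lambda>n. \<integral>z. q n z \<partial>lborel) \<longlonglongrightarrow> (\<integral>z. g' z \<partial>lborel)"
  proof (rule integral_dominated_convergence)
    have "emeasure lborel (cball (0::complex) (K+1)) < \<infinity>" by (rule emeasure_bounded_finite[OF bounded_cball])
    then show "integrable lborel (\<lambda>z::complex. M * indicator (cball 0 (K+1)) z :: real)" by simp
  qed (use lim bd in auto)
  moreover have "(\<integral>z. q n z \<partial>lborel) = 0" for n
  proof -
    have eq: "(\<integral>z. g (z + of_real (h n) * v) \<partial>lborel) = (\<integral>z. g z \<partial>lborel)"
      by (subst (2) lborel_distr_plus[of "of_real (h n) * v", symmetric]) (simp add: integral_distr add.commute)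
    have ig2: "integrable lborel (\<lambda>z. g (z + of_real (h n) * v))"
    proof -
      have "integrable (distr lborel borel ((+) (of_real (h n) * v))) g"
        using ig by (simp add: lborel_distr_plus)
      then show ?thesis by (subst (asm) integrable_distr_eq) (auto simp: add.commute)
    qed
    show ?thesis unfolding q_def using ig ig2 eq by simp
  qed
  ultimately have "(\<lambda>n::nat. 0::real) \<longlonglongrightarrow> (\<integral>z. g' z \<partial>lborel)" by (simp only:)
  from LIMSEQ_unique[OF this tendsto_const] show ?thesis .
qed

section \<open>Green's identity against test functions\<close>

lemma test_function_facts:
  assumes "test_function f"
  shows "test_function (dir_deriv v f)"
    and "continuous_on UNIV f"
    and "((\<lambda>h. f (z + of_real h * v)) has_real_derivative dir_deriv v f z) (at 0)"
proof -
  have diff: "foldr dir_deriv vs f differentiable_on UNIV" for vs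
    using assms by (simp add: test_function_def)
  have fd: "f differentiable (at z)" for z using diff[of "[]"] by (simp add: differentiable_on_def)
  show "continuous_on UNIV f" using diff[of "[]"] by (simp add: differentiable_imp_continuous_on)
  show D: "((\<lambda>h. f (z + of_real h * v)) has_real_derivative dir_deriv v f z) (at 0)" for z
  proof -
    have "(f has_derivative frechet_derivative f (at z)) (at (z + of_real 0 * v))"
      using fd[of z] by (simp add: frechet_derivative_works)
    moreover have "((\<lambda>h. z + of_real h * v) has_derivative (\<lambda>h. of_real h * v)) (at (0::real))"
      by (auto intro!: derivative_eq_intros)
    ultimately have "((\<lambda>h. f (z + of_real h * v)) has_derivative (\<lambda>h. frechet_derivative f (at z) (of_real h * v))) (at 0)"
      using has_derivative_compose[of "\<lambda>h. z + of_real h * v" "\<lambda>h. of_real h * v" 0 UNIV f] by simp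
    moreover have "frechet_derivative f (at z) (of_real h * v) = dir_deriv v f z * h" for h
      using linear_cmul[OF linear_frechet_derivative[OF fd[of z]], of h v]
      by (simp add: dir_deriv_def scaleR_conv_of_real mult.commute)
    ultimately show ?thesis by (simp add: has_field_derivative_def)
  qed
  \<comment> \<open>Off the closed support the function is locally 0 along every line, so
    derivatives do not enlarge the support.\<close>
  have "dir_deriv v f z = 0" if "z \<notin> closure {z. f z \<noteq> 0}" for z
  proof -
    have "open (- closure {z. f z \<noteq> 0})" by (rule open_Compl[OF closed_closure])
    moreover have "continuous_on UNIV (\<lambda>h::real. z + of_real h * v)" by (intro continuous_intros)
    ultimately have "open ((\<lambda>h::real. z + of_real h * v) -` (- closure {z. f z \<noteq> 0}))"
      by (rule open_vimage)
    then have "eventually (\<lambda>h::real. z + of_real h * v \<in> - closure {z. f z \<noteq> 0}) (nhds 0)"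
      using that eventually_nhds_in_open by fastforce
    then have "eventually (\<lambda>h::real. f (z + of_real h * v) = 0) (nhds 0)"
      by eventually_elim (metis (mono_tags, lifting) ComplD closure_subset mem_Collect_eq subsetD)
    then have "((\<lambda>h::real. f (z + of_real h * v)) has_real_derivative 0) (at 0)"
      using DERIV_cong_ev[of 0 0 "\<lambda>h. f (z + of_real h * v)" "\<lambda>_. 0" 0 0] by simp
    then show ?thesis using D DERIV_unique by blast
  qed
  then have "closure {z. dir_deriv v f z \<noteq> 0} \<subseteq> closure {z. f z \<noteq> 0}"
    by (intro closure_minimal) auto
  moreover have "compact (closure {z. f z \<noteq> 0})" using assms by (simp add: test_function_def)
  ultimately have "compact (closure {z. dir_deriv v f z \<noteq> 0})"
    unfolding compact_eq_bounded_closed using bounded_subset closed_closure by blast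
  \<comment> \<open>\<open>foldr\<close> applies the last list entry first, so the direction already
    used is appended at the end.\<close>
  moreover have "foldr dir_deriv vs (dir_deriv v f) differentiable_on UNIV" for vs
    using diff[of "vs @ [v]"] by simp
  ultimately show "test_function (dir_deriv v f)" by (simp add: test_function_def)
qed

lemma test_function_support:
  assumes "test_function f"
  obtains K where "1 \<le> K" "\<And>z. K < cmod z \<Longrightarrow> f z = 0"
proof -
  have "bounded (closure {z. f z \<noteq> 0})"
    using assms by (auto simp: test_function_def compact_imp_bounded)
  then obtain K where K: "\<And>z. z \<in> closure {z. f z \<noteq> 0} \<Longrightarrow> cmod z \<le> K"
    by (auto simp: bounded_iff)
  show thesis
  proof (rule that[of "max 1 K"])
    fix z :: complex assume "max 1 K < cmod z"
    then have "z \<notin> closure {z. f z \<noteq> 0}" using K[of z] by auto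
    then show "f z = 0" using closure_subset[of "{z. f z \<noteq> 0}"] by auto
  qed simp
qed

text \<open>Integration by parts twice along one direction: the derivative of
  \<open>L * dir_deriv v f - f * L'\<close> is the difference of the two integrands, because the
  mixed terms cancel.\<close>

lemma integral_mult_second_derivative:
  fixes L L' L'' :: "complex \<Rightarrow> real"
  assumes f: "test_function f" and v: "cmod v \<le> 1"
    and L: "\<And>z. ((\<lambda>h. L (z + of_real h * v)) has_real_derivative L' z) (at 0)"
    and L': "\<And>z. ((\<lambda>h. L' (z + of_real h * v)) has_real_derivative L'' z) (at 0)"
    and c: "continuous_on UNIV L" "continuous_on UNIV L'" "continuous_on UNIV L''"
  shows "(\<integral>z. L z * dir_deriv v (dir_deriv v f) z \<partial>lborel) = (\<integral>z. f z * L'' z \<partial>lborel)"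
    and "integrable lborel (\<lambda>z. L z * dir_deriv v (dir_deriv v f) z)"
    and "integrable lborel (\<lambda>z. f z * L'' z)"
proof -
  note f1 = test_function_facts(1)[OF f, of v]
  note f2 = test_function_facts(1)[OF f1, of v]
  note cf = test_function_facts(2)[OF f] and cf1 = test_function_facts(2)[OF f1]
    and cf2 = test_function_facts(2)[OF f2]
  obtain K0 where K0: "\<And>z. K0 < cmod z \<Longrightarrow> f z = 0" using test_function_support[OF f] by metis
  obtain K1 where K1: "\<And>z. K1 < cmod z \<Longrightarrow> dir_deriv v f z = 0" using test_function_support[OF f1] by metis
  obtain K2 where K2: "\<And>z. K2 < cmod z \<Longrightarrow> dir_deriv v (dir_deriv v f) z = 0"
    using test_function_support[OF f2] by metis
  define K where "K = max K0 (max K1 K2)"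
  have I: "integrable lborel g" if "continuous_on UNIV g" "\<And>z. K < cmod z \<Longrightarrow> g z = 0" for g :: "complex \<Rightarrow> real"
    using continuous_compact_support_bounded[OF that] integrable_bounded_support
      borel_measurable_continuous_onI[OF that(1)] by metis
  show i1: "integrable lborel (\<lambda>z. L z * dir_deriv v (dir_deriv v f) z)"
    using K2 by (intro I continuous_intros c cf2) (auto simp: K_def)
  show i2: "integrable lborel (\<lambda>z. f z * L'' z)"
    using K0 by (intro I continuous_intros c cf) (auto simp: K_def)
  have "(\<integral>z. L z * dir_deriv v (dir_deriv v f) z - f z * L'' z \<partial>lborel) = 0"
  proof (rule integral_line_derivative_0[where g="\<lambda>z. L z * dir_deriv v f z - f z * L' z" and v=v and K=K])
    fix z
    show "((\<lambda>h. L (z + of_real h * v) * dir_deriv v f (z + of_real h * v) - f (z + of_real h * v) * L' (z + of_real h * v))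
       has_real_derivative L z * dir_deriv v (dir_deriv v f) z - f z * L'' z) (at 0)"
      using L[of z] L'[of z] test_function_facts(3)[OF f, of z v] test_function_facts(3)[OF f1, of z v]
      by (auto intro!: derivative_eq_intros)
  qed (use K0 K1 K2 v in \<open>auto simp: K_def intro!: continuous_intros c cf cf1 cf2\<close>)
  then show "(\<integral>z. L z * dir_deriv v (dir_deriv v f) z \<partial>lborel) = (\<integral>z. f z * L'' z \<partial>lborel)"
    using i1 i2 by simp
qed

text \<open>The smoothing replaces |z - p| by the square root of its square plus e squared. The
  ordinary Laplacian of the smoothed logarithm is an approximate identity of total mass 2
  pi.\<close>

lemma integral_log_regularised:
  assumes f: "test_function f" and e: "0 < e"
  shows "(\<integral>z. 1 / 2 * ln ((cmod (z - p))\<^sup>2 + e\<^sup>2) * laplacian f z \<partial>lborel)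
    = (\<integral>z. f z * (2 * e\<^sup>2 / ((cmod (z - p))\<^sup>2 + e\<^sup>2)\<^sup>2) \<partial>lborel)"
proof -
  define q where "q z = (cmod (z - p))\<^sup>2 + e\<^sup>2" for z
  have q0: "0 < q z" "q z \<noteq> 0" for z using e by (auto simp: q_def add_nonneg_pos intro!: less_imp_neq[symmetric])
  have cq: "continuous_on UNIV q" unfolding q_def by (intro continuous_intros)
  define L where "L z = 1 / 2 * ln (q z)" for z
  define L' where "L' v z = ((z - p) \<bullet> v) / q z" for v z
  define L'' where "L'' v z = (cmod v)\<^sup>2 / q z - 2 * ((z - p) \<bullet> v)\<^sup>2 / (q z)\<^sup>2" for v z
  have dq: "((\<lambda>h. q (z + of_real h * v)) has_real_derivative 2 * ((z - p) \<bullet> v)) (at 0)" for z v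
  proof -
    have "q (z + of_real h * v) = q z + 2 * h * ((z - p) \<bullet> v) + h\<^sup>2 * (cmod v)\<^sup>2" for h
    proof -
      have "z + of_real h * v - p = (z - p) + h *\<^sub>R v" by (simp add: scaleR_conv_of_real)
      then show ?thesis unfolding q_def power2_norm_eq_inner
        by (simp add: inner_add inner_commute power2_eq_square algebra_simps)
    qed
    then show ?thesis by (auto intro!: derivative_eq_intros)
  qed
  have dI: "((\<lambda>h. (z + of_real h * v - p) \<bullet> v) has_real_derivative (cmod v)\<^sup>2) (at 0)" for z v
  proof -
    have "(z + of_real h * v - p) \<bullet> v = (z - p) \<bullet> v + h * (cmod v)\<^sup>2" for h
    proof -
      have e: "z + of_real h * v - p = (z - p) + h *\<^sub>R v" by (simp add: scaleR_conv_of_real)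
      show ?thesis unfolding e power2_norm_eq_inner by (simp only: inner_add_left inner_scaleR_left)
    qed
    then show ?thesis by (auto intro!: derivative_eq_intros)
  qed
  have dL: "((\<lambda>h. L (z + of_real h * v)) has_real_derivative L' v z) (at 0)" for z v
    unfolding L_def L'_def
    by (rule derivative_eq_intros dq refl | use q0 in simp)+
  have dL': "((\<lambda>h. L' v (z + of_real h * v)) has_real_derivative L'' v z) (at 0)" for z v
  proof -
    have "((\<lambda>h. L' v (z + of_real h * v)) has_real_derivative
       ((cmod v)\<^sup>2 * q z - ((z - p) \<bullet> v) * (2 * ((z - p) \<bullet> v))) / (q z * q z)) (at 0)"
      unfolding L'_def using DERIV_divide[OF dI[of z v] dq[of z v]] q0 by simp
    moreover have "((cmod v)\<^sup>2 * q z - ((z - p) \<bullet> v) * (2 * ((z - p) \<bullet> v))) / (q z * q z) = L'' v z"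
      unfolding L''_def using q0[of z] by (simp add: field_simps power2_eq_square)
    ultimately show ?thesis by simp
  qed
  have cont: "continuous_on UNIV L" "continuous_on UNIV (L' v)" "continuous_on UNIV (L'' v)" for v
    unfolding L_def L'_def L''_def using q0 by (auto intro!: continuous_intros cq)
  note I = integral_mult_second_derivative[OF f _ dL dL' cont]
  have "(\<integral>z. L z * laplacian f z \<partial>lborel)
      = (\<integral>z. L z * dir_deriv 1 (dir_deriv 1 f) z + L z * dir_deriv \<i> (dir_deriv \<i> f) z \<partial>lborel)"
    by (simp add: laplacian_def distrib_left)
  also have "\<dots> = (\<integral>z. f z * L'' 1 z \<partial>lborel) + (\<integral>z. f z * L'' \<i> z \<partial>lborel)"
    using I[of 1] I[of \<i>] by simp
  also have "\<dots> = (\<integral>z. f z * L'' 1 z + f z * L'' \<i> z \<partial>lborel)"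
    using I(3)[of 1] I(3)[of \<i>] by simp
  also have "\<dots> = (\<integral>z. f z * (2 * e\<^sup>2 / (q z)\<^sup>2) \<partial>lborel)"
  proof (intro Bochner_Integration.integral_cong refl)
    fix z
    \<comment> \<open>The two coordinate directions together give the squared distance, that is,
      \<open>q\<close> without its regularising term.\<close>
    have "((z - p) \<bullet> 1)\<^sup>2 + ((z - p) \<bullet> \<i>)\<^sup>2 = q z - e\<^sup>2"
      by (simp add: q_def cmod_power2 inner_complex_def)
    moreover have "L'' 1 z + L'' \<i> z
        = 2 / q z - 2 * (((z - p) \<bullet> 1)\<^sup>2 + ((z - p) \<bullet> \<i>)\<^sup>2) / (q z)\<^sup>2"
      unfolding L''_def by (simp only: norm_one norm_ii distrib_left add_divide_distrib) simp
    ultimately have "L'' 1 z + L'' \<i> z = 2 / q z - 2 * (q z - e\<^sup>2) / (q z)\<^sup>2"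
      by (simp only:)
    also have "\<dots> = 2 * e\<^sup>2 / (q z)\<^sup>2"
      using q0[of z] by (simp add: field_simps power2_eq_square)
    finally show "f z * L'' 1 z + f z * L'' \<i> z = f z * (2 * e\<^sup>2 / (q z)\<^sup>2)"
      by (metis distrib_left)
  qed
  finally show ?thesis by (simp add: L_def q_def)
qed

lemma laplacian_facts:
  assumes f: "test_function f"
  obtains K M where "1 \<le> K" "0 \<le> M" "\<And>z. \<bar>laplacian f z\<bar> \<le> M * indicator (cball 0 K) z"
    "laplacian f \<in> borel_measurable borel" "integrable lborel (laplacian f)"
    "(\<integral>z. laplacian f z \<partial>lborel) = 0"
proof -
  note f1 = test_function_facts(1)[OF test_function_facts(1)[OF f, of 1], of 1]
  note f2 = test_function_facts(1)[OF test_function_facts(1)[OF f, of \<i>], of \<i>]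
  have c: "continuous_on UNIV (laplacian f)"
    unfolding laplacian_def by (intro continuous_intros test_function_facts(2) f1 f2)
  obtain K1 where K1: "1 \<le> K1" "\<And>z. K1 < cmod z \<Longrightarrow> dir_deriv 1 (dir_deriv 1 f) z = 0"
    using test_function_support[OF f1] by metis
  obtain K2 where K2: "\<And>z. K2 < cmod z \<Longrightarrow> dir_deriv \<i> (dir_deriv \<i> f) z = 0"
    using test_function_support[OF f2] by metis
  have s: "laplacian f z = 0" if "max K1 K2 < cmod z" for z
    using that K1(2)[of z] K2[of z] by (simp add: laplacian_def)
  obtain M where M: "0 \<le> M" "\<And>z. \<bar>laplacian f z\<bar> \<le> M * indicator (cball 0 (max K1 K2)) z"
    using continuous_compact_support_bounded[OF c s] by metis
  have m: "laplacian f \<in> borel_measurable borel" using c by (rule borel_measurable_continuous_onI)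
  \<comment> \<open>Green's identity with the constant function 1 shows that the Laplacian of a test
    function has integral 0.\<close>
  have one: "((\<lambda>h. (\<lambda>_. 1::real) (z + of_real h * v)) has_real_derivative (\<lambda>_. 0) z) (at 0)"
       "((\<lambda>h. (\<lambda>_. 0::real) (z + of_real h * v)) has_real_derivative (\<lambda>_. 0) z) (at 0)" for z v :: complex
    by auto
  note I = integral_mult_second_derivative[OF f _ one]
  have "(\<integral>z. laplacian f z \<partial>lborel) = 0"
    unfolding laplacian_def using I[of 1] I[of \<i>] by simp
  with M m integrable_bounded_support[OF m M(2)] K1(1) show thesis
    by (intro that[of "max K1 K2" M]) auto
qed

section \<open>Radial integrals in the plane\<close>

text \<open>A radial function is written as a superposition of indicators of discs, whose areas are
  known; Fubini then leaves a one-dimensional integral.\<close>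

lemma nn_integral_layer_cake:
  assumes [measurable]: "g \<in> borel_measurable borel"
  shows "(\<integral>\<^sup>+z. (\<integral>\<^sup>+t. g t * indicator {cmod z..} t \<partial>lborel) \<partial>lborel)
    = (\<integral>\<^sup>+t. g t * ennreal (pi * t\<^sup>2) * indicator {0..} t \<partial>lborel)"
proof -
  have "(\<integral>\<^sup>+z. (\<integral>\<^sup>+t. g t * indicator {cmod z..} t \<partial>lborel) \<partial>lborel)
      = (\<integral>\<^sup>+z. (\<integral>\<^sup>+t. g t * (if cmod z \<le> t then 1 else 0) \<partial>lborel) \<partial>lborel)"
    by (intro nn_integral_cong) (auto simp: indicator_def)
  also have "\<dots> = (\<integral>\<^sup>+t. (\<integral>\<^sup>+z. g t * (if cmod z \<le> t then 1 else 0) \<partial>lborel) \<partial>lborel)"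
    by (rule lborel_pair.Fubini') measurable
  also have "\<dots> = (\<integral>\<^sup>+t. g t * ennreal (pi * t\<^sup>2) * indicator {0..} t \<partial>lborel)"
  proof (rule nn_integral_cong)
    fix t :: real
    have "(\<integral>\<^sup>+z. (if cmod z \<le> t then 1 else 0) \<partial>lborel) = (\<integral>\<^sup>+z. indicator (cball (0::complex) t) z \<partial>lborel)"
      by (intro nn_integral_cong) (auto simp: indicator_def)
    also have "\<dots> = ennreal (pi * t\<^sup>2) * indicator {0..} t"
      using emeasure_cball[where ?'a=complex, of t 0] by (cases "0 \<le> t") (auto simp: unit_ball_vol_2)
    finally show "(\<integral>\<^sup>+z. g t * (if cmod z \<le> t then 1 else 0) \<partial>lborel)
        = g t * ennreal (pi * t\<^sup>2) * indicator {0..} t"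
      by (simp add: nn_integral_cmult mult.assoc)
  qed
  finally show ?thesis .
qed

lemma nn_integral_nlog_cmod: "(\<integral>\<^sup>+z. nlog (cmod (z - p)) \<partial>lborel) \<le> ennreal pi"
proof -
  \<comment> \<open>For 0 < |z| <= 1, - ln |z| is the integral of 1 / t from |z| to 1.\<close>
  define g :: "real \<Rightarrow> ennreal" where "g t = ennreal (1 / t) * indicator {0..1} t" for t
  have [measurable]: "g \<in> borel_measurable borel" unfolding g_def by measurable
  have "(\<integral>\<^sup>+z. nlog (cmod (z - p)) \<partial>lborel) = (\<integral>\<^sup>+z. nlog (cmod z) \<partial>lborel)"
    by (subst nn_integral_lborel_translate[symmetric, where c=p]) auto
  also have "\<dots> = (\<integral>\<^sup>+z. (\<integral>\<^sup>+t. g t * indicator {cmod z..} t \<partial>lborel) \<partial>lborel)"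
  proof (rule nn_integral_cong_AE, use AE_cmod_neq[of 0] in eventually_elim)
    case (elim z)
    then have z: "0 < cmod z" by auto
    show ?case
    proof (cases "cmod z \<le> 1")
      case True
      have "(\<integral>\<^sup>+t. ennreal (1 / t) * indicator {cmod z..1} t \<partial>lborel) = ennreal (ln 1 - ln (cmod z))"
      proof (rule nn_integral_FTC_Icc)
        show "(ln has_real_derivative 1 / x) (at x)" if "x \<in> {cmod z..1}" for x
        proof -
          have "0 < x" using z that by (meson atLeastAtMost_iff less_le_trans)
          then show ?thesis by (auto intro!: derivative_eq_intros simp: divide_inverse)
        qed
        show "0 \<le> 1 / x" if "x \<in> {cmod z..1}" for x
          using that order_trans[OF norm_ge_zero, of z x] by simp
      qed (use True in auto)
      also have "(\<integral>\<^sup>+t. ennreal (1 / t) * indicator {cmod z..1} t \<partial>lborel) = (\<integral>\<^sup>+t. g t * indicator {cmod z..} t \<partial>lborel)"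
        using z by (intro nn_integral_cong) (auto simp: g_def indicator_def dest: order_trans[OF norm_ge_zero])
      finally show ?thesis using z by (simp add: nlog_pos)
    next
      case False
      then have "(\<integral>\<^sup>+t. g t * indicator {cmod z..} t \<partial>lborel) = (\<integral>\<^sup>+t. 0 \<partial>(lborel :: real measure))"
        by (intro nn_integral_cong) (auto simp: g_def indicator_def)
      then show ?thesis using z False by (simp add: nlog_pos ennreal_neg)
    qed
  qed
  also have "\<dots> = (\<integral>\<^sup>+t. g t * ennreal (pi * t\<^sup>2) * indicator {0..} t \<partial>lborel)"
    by (rule nn_integral_layer_cake) measurable
  also have "\<dots> \<le> (\<integral>\<^sup>+t. ennreal pi * indicator {0..1} (t::real) \<partial>lborel)"
  proof (rule nn_integral_mono)
    fix t :: real
    have "ennreal (1 / t) * ennreal (pi * t\<^sup>2) \<le> ennreal pi" if "0 \<le> t" "t \<le> 1"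
      using that by (auto simp: power2_eq_square mult_left_le simp flip: ennreal_mult intro!: ennreal_leI)
    then show "g t * ennreal (pi * t\<^sup>2) * indicator {0..} t \<le> ennreal pi * indicator {0..1} t"
      by (auto simp: g_def indicator_def)
  qed
  also have "\<dots> = ennreal pi" by (subst nn_integral_cmult) auto
  finally show ?thesis .
qed

text \<open>The mass 2 pi is what turns the normalised Laplacian of log |z - p| into a unit point
  mass.\<close>

lemma integral_cauchy_kernel:
  "integrable lborel (\<lambda>u::complex. 2 / (1 + (cmod u)\<^sup>2)\<^sup>2)"
  "(\<integral>u. 2 / (1 + (cmod u)\<^sup>2)\<^sup>2 \<partial>lborel) = 2 * pi"
proof -
  \<comment> \<open>Minus the derivative of 2 / (1 + t^2)^2, the density for the superposition of
    discs.\<close>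
  define g where "g t = 8 * t / (1 + t\<^sup>2) ^ 3" for t :: real
  have pos: "0 < 1 + t\<^sup>2" "1 + t\<^sup>2 \<noteq> 0" for t :: real
    by (auto simp: add_pos_nonneg intro!: less_imp_neq[symmetric])
  have [measurable]: "g \<in> borel_measurable borel" unfolding g_def by measurable
  have "(\<integral>\<^sup>+u. ennreal (2 / (1 + (cmod u)\<^sup>2)\<^sup>2) \<partial>lborel)
      = (\<integral>\<^sup>+z. (\<integral>\<^sup>+t. ennreal (g t) * indicator {cmod z..} t \<partial>lborel) \<partial>lborel)"
  proof (rule nn_integral_cong)
    fix u :: complex
    have "(\<integral>\<^sup>+t. ennreal (g t) * indicator {cmod u..} t \<partial>lborel) = ennreal (0 - (- 2 / (1 + (cmod u)\<^sup>2)\<^sup>2))"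
    proof (rule nn_integral_FTC_atLeast)
      show "((\<lambda>t::real. - 2 / (1 + t\<^sup>2)\<^sup>2) \<longlongrightarrow> 0) at_top" by real_asymp
      show "((\<lambda>t. - 2 / (1 + t\<^sup>2)\<^sup>2) has_real_derivative g t) (at t)" if "cmod u \<le> t" for t
      proof -
        have "((\<lambda>t. - 2 / (1 + t\<^sup>2)\<^sup>2) has_real_derivative
          (0 * (1 + t\<^sup>2)\<^sup>2 - (- 2) * (2 * (1 + t\<^sup>2) * (2 * t))) / ((1 + t\<^sup>2)\<^sup>2 * (1 + t\<^sup>2)\<^sup>2)) (at t)"
          using pos[of t] by (auto intro!: derivative_eq_intros)
        also have "(0 * (1 + t\<^sup>2)\<^sup>2 - (- 2) * (2 * (1 + t\<^sup>2) * (2 * t))) / ((1 + t\<^sup>2)\<^sup>2 * (1 + t\<^sup>2)\<^sup>2) = g t"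
        proof -
          have "0 * (1 + t\<^sup>2)\<^sup>2 - (- 2) * (2 * (1 + t\<^sup>2) * (2 * t)) = (1 + t\<^sup>2) * (8 * t)" by algebra
          moreover have "(1 + t\<^sup>2)\<^sup>2 * (1 + t\<^sup>2)\<^sup>2 = (1 + t\<^sup>2) * (1 + t\<^sup>2) ^ 3" by algebra
          ultimately show ?thesis unfolding g_def by (simp only: mult_divide_mult_cancel_left[OF pos(2)])
        qed
        finally show ?thesis .
      qed
      show "0 \<le> g t" if "cmod u \<le> t" for t
        using order_trans[OF norm_ge_zero that] pos[of t] unfolding g_def by (intro divide_nonneg_nonneg) auto
    qed simp
    then show "ennreal (2 / (1 + (cmod u)\<^sup>2)\<^sup>2) = (\<integral>\<^sup>+t. ennreal (g t) * indicator {cmod u..} t \<partial>lborel)"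
      by simp
  qed
  also have "\<dots> = (\<integral>\<^sup>+t. ennreal (g t) * ennreal (pi * t\<^sup>2) * indicator {0..} t \<partial>lborel)"
    by (rule nn_integral_layer_cake) measurable
  also have "\<dots> = (\<integral>\<^sup>+t. ennreal (g t * (pi * t\<^sup>2)) * indicator {0..} t \<partial>lborel)"
    by (intro nn_integral_cong) (auto simp: indicator_def g_def simp flip: ennreal_mult)
  also have "\<dots> = ennreal (2 * pi - 2 * pi * 0 ^ 4 / (1 + 0\<^sup>2)\<^sup>2)"
  proof (rule nn_integral_FTC_atLeast)
    show "((\<lambda>t::real. 2 * pi * t ^ 4 / (1 + t\<^sup>2)\<^sup>2) \<longlongrightarrow> 2 * pi) at_top" by real_asymp
    show "((\<lambda>t. 2 * pi * t ^ 4 / (1 + t\<^sup>2)\<^sup>2) has_real_derivative g t * (pi * t\<^sup>2)) (at t)" for t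
    proof -
      have "((\<lambda>t. 2 * pi * t ^ 4 / (1 + t\<^sup>2)\<^sup>2) has_real_derivative
        (8 * pi * t ^ 3 * (1 + t\<^sup>2)\<^sup>2 - 2 * pi * t ^ 4 * (2 * (1 + t\<^sup>2) * (2 * t))) / ((1 + t\<^sup>2)\<^sup>2 * (1 + t\<^sup>2)\<^sup>2)) (at t)"
        using pos[of t] by (auto intro!: derivative_eq_intros)
      also have "(8 * pi * t ^ 3 * (1 + t\<^sup>2)\<^sup>2 - 2 * pi * t ^ 4 * (2 * (1 + t\<^sup>2) * (2 * t))) / ((1 + t\<^sup>2)\<^sup>2 * (1 + t\<^sup>2)\<^sup>2)
         = g t * (pi * t\<^sup>2)"
      proof -
        have "(8 * pi * t ^ 3 * (1 + t\<^sup>2)\<^sup>2 - 2 * pi * t ^ 4 * (2 * (1 + t\<^sup>2) * (2 * t)))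
          = (1 + t\<^sup>2) * (8 * pi * t ^ 3)" by algebra
        moreover have "(1 + t\<^sup>2)\<^sup>2 * (1 + t\<^sup>2)\<^sup>2 = (1 + t\<^sup>2) * (1 + t\<^sup>2) ^ 3" by algebra
        ultimately have "(8 * pi * t ^ 3 * (1 + t\<^sup>2)\<^sup>2 - 2 * pi * t ^ 4 * (2 * (1 + t\<^sup>2) * (2 * t))) / ((1 + t\<^sup>2)\<^sup>2 * (1 + t\<^sup>2)\<^sup>2)
            = 8 * pi * t ^ 3 / (1 + t\<^sup>2) ^ 3"
          by (simp only: mult_divide_mult_cancel_left[OF pos(2)])
        then show ?thesis by (simp add: g_def power2_eq_square power3_eq_cube mult_ac)
      qed
      finally show ?thesis .
    qed
    show "0 \<le> g t * (pi * t\<^sup>2)" if "0 \<le> t" for t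
      using that pos(1)[of t] unfolding g_def by (intro mult_nonneg_nonneg divide_nonneg_nonneg) auto
  qed simp
  finally have *: "(\<integral>\<^sup>+u. ennreal (2 / (1 + (cmod u)\<^sup>2)\<^sup>2) \<partial>lborel) = ennreal (2 * pi)" by simp
  have "has_bochner_integral lborel (\<lambda>u::complex. 2 / (1 + (cmod u)\<^sup>2)\<^sup>2) (2 * pi)"
    by (rule has_bochner_integral_nn_integral[OF _ _ _ *]) auto
  then show "integrable lborel (\<lambda>u::complex. 2 / (1 + (cmod u)\<^sup>2)\<^sup>2)"
    "(\<integral>u. 2 / (1 + (cmod u)\<^sup>2)\<^sup>2 \<partial>lborel) = 2 * pi"
    by (auto simp: has_bochner_integral_iff)
qed

text \<open>The regularised identity is taken to the limit on both sides: dominated convergence on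
  the left, and on the right a rescaling about \<open>p\<close>, after which \<open>f\<close> is
  evaluated ever closer to \<open>p\<close>.\<close>

lemma integral_log_laplacian:
  assumes f: "test_function f"
  shows "integrable lborel (\<lambda>z. ln (cmod (z - p)) * laplacian f z)"
    and "(\<integral>z. ln (cmod (z - p)) * laplacian f z \<partial>lborel) = 2 * pi * f p"
proof -
  obtain K M where KM: "1 \<le> K" "0 \<le> M" "\<And>z. \<bar>laplacian f z\<bar> \<le> M * indicator (cball 0 K) z"
    "laplacian f \<in> borel_measurable borel"
    using laplacian_facts[OF f] by metis
  note [measurable] = KM(4)
  define h where "h n = 1 / real (Suc n)" for n
  have h: "0 < h n" "h n \<le> 1" for n by (auto simp: h_def)
  have h0: "h \<longlonglongrightarrow> 0" unfolding h_def by (rule LIMSEQ_Suc[OF lim_1_over_n])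
  define L where "L n z = 1 / 2 * ln ((cmod (z - p))\<^sup>2 + (h n)\<^sup>2)" for n z
  define H where "H = ln ((K + cmod p)\<^sup>2 + 1)"
  have H0: "0 \<le> H" by (simp add: H_def)
  \<comment> \<open>One integrable majorant for the limit and for all regularisations: above they
    are bounded by \<open>H\<close> on the support, below by the singular logarithm itself.\<close>
  define w where "w z = M * (H * indicator (cball 0 K) z + enn2real (nlog (cmod (z - p))))" for z
  have iw: "integrable lborel w"
  proof -
    have "integrable lborel (\<lambda>z. enn2real (nlog (cmod (z - p))))"
    proof (rule integrableI_nonneg)
      have "(\<integral>\<^sup>+z. ennreal (enn2real (nlog (cmod (z - p)))) \<partial>lborel) \<le> (\<integral>\<^sup>+z. nlog (cmod (z - p)) \<partial>lborel)"
        by (intro nn_integral_mono) (simp add: ennreal_enn2real_if)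
      also have "\<dots> \<le> ennreal pi" by (rule nn_integral_nlog_cmod)
      finally show "(\<integral>\<^sup>+z. ennreal (enn2real (nlog (cmod (z - p)))) \<partial>lborel) < \<infinity>"
        by (auto simp: less_top intro: le_less_trans)
    qed auto
    moreover have "emeasure lborel (cball (0::complex) K) < \<infinity>"
      by (rule emeasure_bounded_finite[OF bounded_cball])
    ultimately show ?thesis unfolding w_def by (intro integrable_mult_right Bochner_Integration.integrable_add) auto
  qed
  have bd: "\<bar>l * laplacian f z\<bar> \<le> w z"
    if l: "z \<in> cball 0 K \<Longrightarrow> l \<le> H" "ln (cmod (z - p)) \<le> l" and z: "z \<noteq> p" for l z
  proof (cases "z \<in> cball 0 K")
    case True
    have e: "enn2real (nlog (cmod (z - p))) = max 0 (- ln (cmod (z - p)))"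
      using z by (cases "0 \<le> - ln (cmod (z - p))") (auto simp: nlog_pos ennreal_neg max_def)
    have "\<bar>l\<bar> \<le> H + enn2real (nlog (cmod (z - p)))" unfolding e using l True H0 by auto
    then have "\<bar>l\<bar> * \<bar>laplacian f z\<bar> \<le> (H + enn2real (nlog (cmod (z - p)))) * M"
      using KM(3)[of z] True H0 by (intro mult_mono) auto
    then show ?thesis using True by (simp add: w_def abs_mult mult.commute)
  next
    case False
    then have "laplacian f z = 0" using KM(3)[of z] by simp
    then show ?thesis using KM(2) H0 by (simp add: w_def)
  qed
  have ub: "ln x \<le> 2 * H" if "z \<in> cball 0 K" "0 < x" "x \<le> (cmod (z - p))\<^sup>2 + 1" for x z
  proof -
    have "cmod (z - p) \<le> K + cmod p" using that norm_triangle_ineq4[of z p] by simp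
    then have "(cmod (z - p))\<^sup>2 \<le> (K + cmod p)\<^sup>2" by (intro power_mono) auto
    then have "ln x \<le> H" unfolding H_def using that by (subst ln_le_cancel_iff) (auto intro: add_nonneg_pos)
    then show ?thesis using H0 by simp
  qed
  have bL: "ln (cmod (z - p)) \<le> L n z" "z \<in> cball 0 K \<Longrightarrow> L n z \<le> H" if "z \<noteq> p" for z n
  proof -
    have pos: "0 < (cmod (z - p))\<^sup>2" using that by simp
    have "ln (cmod (z - p)) = 1 / 2 * ln ((cmod (z - p))\<^sup>2)" using that by (simp add: ln_realpow)
    also have "\<dots> \<le> L n z"
    proof -
      have "ln ((cmod (z - p))\<^sup>2) \<le> ln ((cmod (z - p))\<^sup>2 + (h n)\<^sup>2)"
        using pos by (subst ln_le_cancel_iff) (auto intro: add_pos_nonneg)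
      then show ?thesis by (simp add: L_def)
    qed
    finally show "ln (cmod (z - p)) \<le> L n z" .
    have "(h n)\<^sup>2 \<le> 1" using h[of n] by (simp add: power_le_one)
    then show "L n z \<le> H" if "z \<in> cball 0 K"
      using ub[OF that, of "(cmod (z - p))\<^sup>2 + (h n)\<^sup>2"] pos by (simp add: L_def add_pos_nonneg)
  qed
  have bl: "z \<in> cball 0 K \<Longrightarrow> ln (cmod (z - p)) \<le> H" if "z \<noteq> p" for z
    using bL[OF that, of 0] by linarith
  have AEp: "AE z in lborel. z \<noteq> p" by (rule AE_lborel_singleton)
  show int: "integrable lborel (\<lambda>z. ln (cmod (z - p)) * laplacian f z)"
  proof (rule Bochner_Integration.integrable_bound[OF iw])
    show "AE z in lborel. norm (ln (cmod (z - p)) * laplacian f z) \<le> norm (w z)"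
      using AEp
    proof eventually_elim
      case (elim z)
      have "\<bar>ln (cmod (z - p)) * laplacian f z\<bar> \<le> w z" by (rule bd[OF bl[OF elim] _ elim]) auto
      then show ?case by simp
    qed
  qed simp
  have "(\<lambda>n. \<integral>z. L n z * laplacian f z \<partial>lborel) \<longlonglongrightarrow> (\<integral>z. ln (cmod (z - p)) * laplacian f z \<partial>lborel)"
  proof (rule integral_dominated_convergence[OF _ _ iw])
    show "AE z in lborel. (\<lambda>n. L n z * laplacian f z) \<longlonglongrightarrow> ln (cmod (z - p)) * laplacian f z"
      using AEp
    proof eventually_elim
      case (elim z)
      have "(\<lambda>n. 1 / 2 * ln ((cmod (z - p))\<^sup>2 + (h n)\<^sup>2)) \<longlonglongrightarrow> 1 / 2 * ln ((cmod (z - p))\<^sup>2 + 0\<^sup>2)"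
        using elim by (intro tendsto_intros h0) auto
      then have "(\<lambda>n. L n z) \<longlonglongrightarrow> ln (cmod (z - p))" using elim by (simp add: L_def ln_realpow)
      then show ?case by (intro tendsto_intros)
    qed
    show "AE z in lborel. norm (L n z * laplacian f z) \<le> w z" for n
      using AEp
    proof eventually_elim
      case (elim z)
      then show ?case using bd[OF bL(2)[OF elim] bL(1)[OF elim] elim, of n] by simp
    qed
  qed (unfold L_def, measurable)
  moreover have "(\<integral>z. L n z * laplacian f z \<partial>lborel)
     = (\<integral>u. f (p + of_real (h n) * u) * (2 / (1 + (cmod u)\<^sup>2)\<^sup>2) \<partial>lborel)" for n
  proof -
    let ?k = "\<lambda>z. f z * (2 * (h n)\<^sup>2 / ((cmod (z - p))\<^sup>2 + (h n)\<^sup>2)\<^sup>2)"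
    have [measurable]: "f \<in> borel_measurable borel"
      using test_function_facts(2)[OF f] by (rule borel_measurable_continuous_onI)
    have "(\<integral>z. L n z * laplacian f z \<partial>lborel) = (\<integral>z. ?k z \<partial>lborel)"
      unfolding L_def by (rule integral_log_regularised[OF f h(1)])
    \<comment> \<open>Substitution z = p + h u in two real dimensions; the Jacobian is the square of
      h.\<close>
    also have "\<dots> = (\<integral>u. (h n)\<^sup>2 *\<^sub>R ?k (p + h n *\<^sub>R u) \<partial>lborel)"
      using h(1)[of n] by (subst lborel_affine[of "h n" p]) (simp_all add: integral_density integral_distr)
    also have "\<dots> = (\<integral>u. f (p + of_real (h n) * u) * (2 / (1 + (cmod u)\<^sup>2)\<^sup>2) \<partial>lborel)"
    proof (intro Bochner_Integration.integral_cong refl)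
      fix u :: complex
      have pu: "1 + (cmod u)\<^sup>2 \<noteq> 0" by (metis add_pos_nonneg less_irrefl zero_le_power2 zero_less_one)
      have "(cmod (p + h n *\<^sub>R u - p))\<^sup>2 + (h n)\<^sup>2 = (h n)\<^sup>2 * (1 + (cmod u)\<^sup>2)"
        by (simp add: power_mult_distrib algebra_simps)
      then have "(h n)\<^sup>2 * (2 * (h n)\<^sup>2 / ((cmod (p + h n *\<^sub>R u - p))\<^sup>2 + (h n)\<^sup>2)\<^sup>2)
          = (h n)\<^sup>2 * (2 * (h n)\<^sup>2) / ((h n)\<^sup>2 * (h n)\<^sup>2 * (1 + (cmod u)\<^sup>2)\<^sup>2)"
        by (simp add: power2_eq_square mult_ac)
      also have "\<dots> = 2 / (1 + (cmod u)\<^sup>2)\<^sup>2" using h(1)[of n] pu by (simp add: field_simps)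
      finally show "(h n)\<^sup>2 *\<^sub>R ?k (p + h n *\<^sub>R u) = f (p + of_real (h n) * u) * (2 / (1 + (cmod u)\<^sup>2)\<^sup>2)"
        by (simp only: real_scaleR_def scaleR_conv_of_real mult.left_commute[of "(h n)\<^sup>2" "f _"])
    qed
    finally show ?thesis .
  qed
  moreover have "(\<lambda>n. \<integral>u. f (p + of_real (h n) * u) * (2 / (1 + (cmod u)\<^sup>2)\<^sup>2) \<partial>lborel)
     \<longlonglongrightarrow> (\<integral>u. f p * (2 / (1 + (cmod u)\<^sup>2)\<^sup>2) \<partial>lborel)"
  proof -
    note cf = test_function_facts(2)[OF f]
    have [measurable]: "f \<in> borel_measurable borel"
      using cf by (rule borel_measurable_continuous_onI)
    obtain K0 where K0: "\<And>z. K0 < cmod z \<Longrightarrow> f z = 0" using test_function_support[OF f] by metis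
    obtain Mf where Mf: "0 \<le> Mf" "\<And>z. \<bar>f z\<bar> \<le> Mf"
      using continuous_compact_support_bounded[OF cf K0] by metis
    show ?thesis
    proof (rule integral_dominated_convergence[where w="\<lambda>u. Mf * (2 / (1 + (cmod u)\<^sup>2)\<^sup>2)"])
      show "integrable lborel (\<lambda>u. Mf * (2 / (1 + (cmod u)\<^sup>2)\<^sup>2))"
        by (intro integrable_mult_right integral_cauchy_kernel)
      show "AE u in lborel. (\<lambda>n. f (p + of_real (h n) * u) * (2 / (1 + (cmod u)\<^sup>2)\<^sup>2)) \<longlonglongrightarrow> f p * (2 / (1 + (cmod u)\<^sup>2)\<^sup>2)"
      proof (rule AE_I2)
        fix u :: complex
        have "(\<lambda>n. p + of_real (h n) * u) \<longlonglongrightarrow> p + of_real 0 * u" by (intro tendsto_intros h0)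
        then have "(\<lambda>n. f (p + of_real (h n) * u)) \<longlonglongrightarrow> f (p + of_real 0 * u)"
          by (rule continuous_on_tendsto_compose[OF cf]) auto
        then show "(\<lambda>n. f (p + of_real (h n) * u) * (2 / (1 + (cmod u)\<^sup>2)\<^sup>2)) \<longlonglongrightarrow> f p * (2 / (1 + (cmod u)\<^sup>2)\<^sup>2)"
          by (intro tendsto_mult tendsto_const) simp
      qed
      show "AE u in lborel. norm (f (p + of_real (h n) * u) * (2 / (1 + (cmod u)\<^sup>2)\<^sup>2)) \<le> Mf * (2 / (1 + (cmod u)\<^sup>2)\<^sup>2)" for n
        using Mf by (intro AE_I2) (auto simp: abs_mult intro!: mult_right_mono divide_right_mono)
    qed auto
  qed
  moreover have "(\<integral>u. f p * (2 / (1 + (cmod u)\<^sup>2)\<^sup>2) \<partial>lborel) = 2 * pi * f p"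
    by (subst integral_mult_right_zero) (simp only: integral_cauchy_kernel mult.commute)
  ultimately show "(\<integral>z. ln (cmod (z - p)) * laplacian f z \<partial>lborel) = 2 * pi * f p"
    using LIMSEQ_unique by simp
qed

section \<open>The curvature measure of a potential\<close>

lemma fs_le_2: "1 \<le> cmod p \<Longrightarrow> fs p \<le> 2 * cmod p"
proof -
  assume p: "1 \<le> cmod p"
  have "1 + (cmod p)\<^sup>2 \<le> (2 * cmod p)\<^sup>2"
    using power_mono[OF p, of 2] by (simp add: power_mult_distrib)
  then show ?thesis using p by (simp add: fs_def real_le_lsqrt)
qed

text \<open>The bound is uniform in \<open>y\<close>, so it survives integration against any
  probability measure; this justifies Fubini in the curvature identity.\<close>

lemma nn_integral_chord_cball_le:
  assumes K: "1 \<le> K"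
  obtains B where "0 \<le> B" "\<And>\<kappa> y. \<kappa> \<in> charts \<Longrightarrow> (\<integral>\<^sup>+z\<in>cball 0 K. nlog (chord (\<kappa> z) y) \<partial>lborel) \<le> ennreal B"
proof -
  define k where "k = fs (of_real K)"
  \<comment> \<open>\<open>D\<close> covers both cases below: \<open>4 * k\<close> handles poles of
    modulus at least 2 K, where \<open>fs p\<close> is at most 4 |z - p|, and the product with
    \<open>fs (of_real (2 * K))\<close> handles nearer poles.\<close>
  define D where "D = 4 * k * fs (of_real (2 * K))"
  have k1: "1 \<le> k" "1 \<le> fs (of_real (2 * K))" by (simp_all only: k_def fs_ge_1)
  have D: "4 * k \<le> D" "k * fs (of_real (2 * K)) \<le> D" "1 \<le> D"
  proof -
    show 1: "4 * k \<le> D" using k1 mult_left_mono[of 1 "fs (of_real (2 * K))" "4 * k"] by (simp add: D_def)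
    then show "1 \<le> D" using k1 by linarith
    show "k * fs (of_real (2 * K)) \<le> D" using k1 mult_nonneg_nonneg[of k "fs (of_real (2 * K))"] by (simp add: D_def)
  qed
  have fk: "fs z \<le> k" if "cmod z \<le> K" for z
    unfolding k_def using that K by (intro fs_mono) (simp only: norm_of_real)
  have pt: "nlog (chord (\<kappa> z) y) \<le> ennreal (ln D) + nlog (cmod (z - (if y \<in> range \<kappa> then inv \<kappa> y else 0)))"
    if \<kappa>: "\<kappa> \<in> charts" and z: "cmod z \<le> K" for \<kappa> z y
  proof -
    have lnD: "nlog (1 / D) = ennreal (ln D)" using D by (simp add: nlog_pos ln_div)
    have ubound: "nlog (chord (\<kappa> z) y) \<le> ennreal (ln D) + k'" if "1 / D \<le> chord (\<kappa> z) y" for k'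
    proof -
      have "nlog (chord (\<kappa> z) y) \<le> nlog (1 / D)" by (rule nlog_antimono[OF that])
      also have "\<dots> \<le> ennreal (ln D) + k'" unfolding lnD by simp
      finally show ?thesis .
    qed
    show ?thesis
    proof (cases "y \<in> range \<kappa>")
      case False
      have "chord (\<kappa> z) y = 1 / fs z" by (rule chord_chart_outside[OF \<kappa> False])
      moreover have "fs z \<le> D" using fk[OF z] D k1 by linarith
      ultimately show ?thesis using D by (intro ubound) (auto intro!: divide_left_mono)
    next
      case True
      define p where "p = inv \<kappa> y"
      have y: "y = \<kappa> p" using True by (simp add: p_def f_inv_into_f)
      have ch: "chord (\<kappa> z) y = cmod (z - p) / (fs z * fs p)" unfolding y by (rule chord_chart[OF \<kappa>])
      show ?thesis
      proof (cases "2 * K \<le> cmod p")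
        case large: True
        have "cmod p / 2 \<le> cmod (z - p)" using norm_triangle_ineq2[of p z] large z by (simp add: norm_minus_commute)
        moreover have "fs p \<le> 2 * cmod p" using large K by (intro fs_le_2) linarith
        ultimately have "fs p \<le> 4 * cmod (z - p)" by linarith
        then have "fs z * fs p \<le> k * (4 * cmod (z - p))" using fk[OF z] k1
          by (intro mult_mono) (auto simp: less_imp_le)
        also have "\<dots> \<le> D * cmod (z - p)" using mult_right_mono[OF D(1), of "cmod (z - p)"] by (simp add: mult_ac)
        finally have "1 / D \<le> chord (\<kappa> z) y" unfolding ch using D by (simp add: field_simps)
        then show ?thesis by (rule ubound)
      next
        case False
        have "fs p \<le> fs (of_real (2 * K))" using False K by (intro fs_mono) (simp only: norm_of_real)
        then have "fs z * fs p \<le> k * fs (of_real (2 * K))" using fk[OF z] k1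
          by (intro mult_mono) (auto simp: less_imp_le)
        then have "fs z * fs p \<le> D" using D by linarith
        then have "1 / D * cmod (z - p) \<le> chord (\<kappa> z) y"
          unfolding ch using D mult_right_mono[of "fs z * fs p" D "cmod (z - p)"] by (simp add: field_simps)
        then have "nlog (chord (\<kappa> z) y) \<le> nlog (1 / D * cmod (z - p))" by (rule nlog_antimono)
        also have "\<dots> \<le> nlog (1 / D) + nlog (cmod (z - p))"
        proof (cases "cmod (z - p) \<le> 1")
          case True
          then show ?thesis using D by (subst nlog_mult) auto
        next
          case False
          then have "1 / D \<le> 1 / D * cmod (z - p)" using D by (simp add: field_simps)
          then show ?thesis using nlog_antimono add_increasing2 by (metis zero_le)
        qed
        finally show ?thesis using True by (simp add: lnD p_def)
      qed
    qed
  qed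
  define B where "B = ln D * (pi * K\<^sup>2) + pi"
  have B0: "0 \<le> B" using D by (simp add: B_def)
  show thesis
  proof (rule that[OF B0])
    fix \<kappa> y assume \<kappa>: "\<kappa> \<in> charts"
    define p where "p = (if y \<in> range \<kappa> then inv \<kappa> y else 0)"
    have "(\<integral>\<^sup>+z\<in>cball 0 K. nlog (chord (\<kappa> z) y) \<partial>lborel)
        \<le> (\<integral>\<^sup>+z. ennreal (ln D) * indicator (cball 0 K) z + nlog (cmod (z - p)) \<partial>lborel)"
    proof (rule nn_integral_mono)
      fix z
      show "nlog (chord (\<kappa> z) y) * indicator (cball 0 K) z \<le> ennreal (ln D) * indicator (cball 0 K) z + nlog (cmod (z - p))"
        using pt[OF \<kappa>, of z y] by (auto simp: p_def indicator_def)
    qed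
    also have "\<dots> = (\<integral>\<^sup>+z. ennreal (ln D) * indicator (cball 0 K) (z::complex) \<partial>lborel) + (\<integral>\<^sup>+z. nlog (cmod (z - p)) \<partial>lborel)"
      by (rule nn_integral_add) measurable
    also have "(\<integral>\<^sup>+z. ennreal (ln D) * indicator (cball 0 K) (z::complex) \<partial>lborel) = ennreal (ln D * (pi * K\<^sup>2))"
      using K D emeasure_cball[where ?'a=complex, of K 0]
      by (subst nn_integral_cmult) (auto simp: unit_ball_vol_2 ennreal_mult'')
    also have "ennreal (ln D * (pi * K\<^sup>2)) + (\<integral>\<^sup>+z. nlog (cmod (z - p)) \<partial>lborel) \<le> ennreal (ln D * (pi * K\<^sup>2)) + ennreal pi"
      by (intro add_left_mono nn_integral_nlog_cmod)
    also have "\<dots> = ennreal B" using D by (simp add: B_def)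
    finally show "(\<integral>\<^sup>+z\<in>cball 0 K. nlog (chord (\<kappa> z) y) \<partial>lborel) \<le> ennreal B" .
  qed
qed

text \<open>Fubini reduces the identity to one kernel, whose distributional Laplacian is a point
  mass. The constants \<open>C\<close> and \<open>ln (fs p)\<close> disappear because a Laplacian
  has integral 0.\<close>

lemma curvature_pot:
  assumes \<mu>: "sets \<mu> = sets cp1_borel" "finite_measure \<mu>" "emeasure \<mu> UNIV = 1"
  shows "curvature_measure (pot C \<mu>) \<mu>"
proof -
  interpret \<mu>: finite_measure \<mu> by fact
  interpret pair_sigma_finite lborel \<mu> ..
  have space: "space \<mu> = UNIV" using sets_eq_imp_space_eq[OF \<mu>(1)] by simp
  have m1: "measure \<mu> UNIV = 1" using \<mu>(3) by (simp add: measure_def)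
  have [measurable_cong]: "sets \<mu> = sets cp1_borel" by (rule \<mu>(1))
  have "(\<integral>x. ext_zero \<kappa> f x \<partial>\<mu>) = 1 / (2 * pi) * (\<integral>z. real_of_ereal (local_pot (pot C \<mu>) \<kappa> z) * laplacian f z \<partial>lborel)"
    if \<kappa>: "\<kappa> \<in> charts" and f: "test_function f" for \<kappa> f
  proof -
    have [measurable]: "\<kappa> \<in> borel \<rightarrow>\<^sub>M cp1_borel" by (rule chart_measurable[OF \<kappa>])
    obtain K M where KM: "1 \<le> K" "0 \<le> M" "\<And>z. \<bar>laplacian f z\<bar> \<le> M * indicator (cball 0 K) z"
      "laplacian f \<in> borel_measurable borel" "integrable lborel (laplacian f)"
      "(\<integral>z. laplacian f z \<partial>lborel) = 0"
      using laplacian_facts[OF f] by metis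
    note [measurable] = KM(4)
    obtain B where B: "0 \<le> B" "\<And>y. (\<integral>\<^sup>+z\<in>cball 0 K. nlog (chord (\<kappa> z) y) \<partial>lborel) \<le> ennreal B"
      using nn_integral_chord_cball_le[OF KM(1)] \<kappa> by metis
    \<comment> \<open>Here \<open>ln\<close> takes its default value 0 on the diagonal; since
      potentials are finite almost everywhere on the support, the diagonal is seen only on null
      sets.\<close>
    define l where "l z y = ln (fs z) + ln (chord (\<kappa> z) y)" for z y
    define N where "N z = (\<integral>\<^sup>+y. nlog (chord (\<kappa> z) y) \<partial>\<mu>)" for z
    have [measurable]: "N \<in> borel_measurable borel" unfolding N_def by measurable
    have l_le: "ennreal \<bar>l z y\<bar> \<le> ennreal (ln (fs z)) + nlog (chord (\<kappa> z) y)" for z y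
    proof (cases "chord (\<kappa> z) y \<le> 0")
      case True
      then show ?thesis by (simp add: nlog_def)
    next
      case False
      then have "0 \<le> - ln (chord (\<kappa> z) y)" using chord_le_1[of "\<kappa> z" y] by simp
      moreover have "0 \<le> ln (fs z)" using fs_ge_1 by simp
      ultimately have "\<bar>l z y\<bar> \<le> ln (fs z) + - ln (chord (\<kappa> z) y)" unfolding l_def by linarith
      then have "ennreal \<bar>l z y\<bar> \<le> ennreal (ln (fs z) + - ln (chord (\<kappa> z) y))" by (rule ennreal_leI)
      also have "\<dots> = ennreal (ln (fs z)) + ennreal (- ln (chord (\<kappa> z) y))"
        by (rule ennreal_plus) fact+
      finally show ?thesis using False by (simp add: nlog_def)
    qed
    have fk: "ln (fs z) \<le> ln (fs (of_real K))" if "z \<in> cball 0 K" for z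
    proof -
      have "fs z \<le> fs (of_real K)" using that KM(1) by (intro fs_mono) (simp only: norm_of_real mem_cball dist_norm, simp)
      then show ?thesis by simp
    qed
    have fin: "(\<integral>\<^sup>+y. (\<integral>\<^sup>+z. ennreal \<bar>l z y * laplacian f z\<bar> \<partial>lborel) \<partial>\<mu>) < top"
    proof -
      define c where "c = M * (ln (fs (of_real K)) * (pi * K\<^sup>2) + B)"
      have "(\<integral>\<^sup>+z. ennreal \<bar>l z y * laplacian f z\<bar> \<partial>lborel) \<le> ennreal c" for y
      proof -
        have "(\<integral>\<^sup>+z. ennreal \<bar>l z y * laplacian f z\<bar> \<partial>lborel)
           \<le> (\<integral>\<^sup>+z. ennreal M * (ennreal (ln (fs (of_real K))) * indicator (cball 0 K) z + nlog (chord (\<kappa> z) y) * indicator (cball 0 K) z) \<partial>lborel)"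
        proof (rule nn_integral_mono)
          fix z
          show "ennreal \<bar>l z y * laplacian f z\<bar> \<le> ennreal M * (ennreal (ln (fs (of_real K))) * indicator (cball 0 K) z + nlog (chord (\<kappa> z) y) * indicator (cball 0 K) z)"
          proof (cases "z \<in> cball 0 K")
            case True
            have "ennreal \<bar>l z y * laplacian f z\<bar> = ennreal \<bar>laplacian f z\<bar> * ennreal \<bar>l z y\<bar>"
              by (simp add: abs_mult mult.commute flip: ennreal_mult)
            also have "\<dots> \<le> ennreal M * (ennreal (ln (fs (of_real K))) + nlog (chord (\<kappa> z) y))"
              using KM(3)[of z] True fk[OF True]
              by (intro mult_mono order_trans[OF l_le] add_right_mono ennreal_leI) auto
            finally show ?thesis using True by simp
          next
            case False
            then have "laplacian f z = 0" using KM(3)[of z] by simp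
            then show ?thesis by simp
          qed
        qed
        also have "\<dots> = ennreal M * ((\<integral>\<^sup>+z. ennreal (ln (fs (of_real K))) * indicator (cball 0 K) (z::complex) \<partial>lborel) + (\<integral>\<^sup>+z\<in>cball 0 K. nlog (chord (\<kappa> z) y) \<partial>lborel))"
        proof (subst nn_integral_cmult)
          show "(\<lambda>z. ennreal (ln (fs (of_real K))) * indicator (cball 0 K) z + nlog (chord (\<kappa> z) y) * indicator (cball 0 K) z) \<in> borel_measurable lborel"
            by measurable
        qed (simp add: nn_integral_add)
        also have "(\<integral>\<^sup>+z. ennreal (ln (fs (of_real K))) * indicator (cball 0 K) (z::complex) \<partial>lborel) = ennreal (ln (fs (of_real K)) * (pi * K\<^sup>2))"
          using KM(1) fs_ge_1 emeasure_cball[where ?'a=complex, of K 0]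
          by (subst nn_integral_cmult) (auto simp: unit_ball_vol_2 ennreal_mult'')
        also have "ennreal M * (ennreal (ln (fs (of_real K)) * (pi * K\<^sup>2)) + (\<integral>\<^sup>+z\<in>cball 0 K. nlog (chord (\<kappa> z) y) \<partial>lborel))
            \<le> ennreal M * (ennreal (ln (fs (of_real K)) * (pi * K\<^sup>2)) + ennreal B)"
          by (intro mult_left_mono add_left_mono B) auto
        also have "\<dots> = ennreal c"
          using B(1) KM(2) fs_ge_1[of "of_real K"] by (simp add: c_def flip: ennreal_plus ennreal_mult)
        finally show ?thesis .
      qed
      then have "(\<integral>\<^sup>+y. (\<integral>\<^sup>+z. ennreal \<bar>l z y * laplacian f z\<bar> \<partial>lborel) \<partial>\<mu>) \<le> (\<integral>\<^sup>+y. ennreal c \<partial>\<mu>)"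
        by (intro nn_integral_mono)
      also have "\<dots> = ennreal c" by (simp add: space \<mu>(3))
      finally show ?thesis by (simp add: le_less_trans)
    qed
    have mH [measurable]: "(\<lambda>(z, y). l z y * laplacian f z) \<in> borel_measurable (lborel \<Otimes>\<^sub>M \<mu>)"
      unfolding l_def by measurable
    have intH: "integrable (lborel \<Otimes>\<^sub>M \<mu>) (\<lambda>(z, y). l z y * laplacian f z)"
    proof (rule integrableI_bounded[OF mH])
      have "(\<integral>\<^sup>+x. ennreal (norm (case x of (z, y) \<Rightarrow> l z y * laplacian f z)) \<partial>(lborel \<Otimes>\<^sub>M \<mu>))
        = (\<integral>\<^sup>+y. (\<integral>\<^sup>+z. ennreal \<bar>l z y * laplacian f z\<bar> \<partial>lborel) \<partial>\<mu>)"
        by (subst nn_integral_snd[symmetric]) auto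
      then show "(\<integral>\<^sup>+x. ennreal (norm (case x of (z, y) \<Rightarrow> l z y * laplacian f z)) \<partial>(lborel \<Otimes>\<^sub>M \<mu>)) < \<infinity>"
        using fin by simp
    qed
    have inner: "(\<integral>z. l z y * laplacian f z \<partial>lborel) = 2 * pi * ext_zero \<kappa> f y" for y
    proof (cases "y \<in> range \<kappa>")
      case True
      define p where "p = inv \<kappa> y"
      have y: "y = \<kappa> p" using True by (simp add: p_def f_inv_into_f)
      have "(\<integral>z. l z y * laplacian f z \<partial>lborel)
         = (\<integral>z. ln (cmod (z - p)) * laplacian f z - ln (fs p) * laplacian f z \<partial>lborel)"
      proof (rule integral_cong_AE)
        show "AE z in lborel. l z y * laplacian f z = ln (cmod (z - p)) * laplacian f z - ln (fs p) * laplacian f z"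
          using AE_lborel_singleton[of p]
        proof eventually_elim
          case (elim z)
          then have "l z y = ln (cmod (z - p)) - ln (fs p)"
            unfolding l_def y chord_chart[OF \<kappa>] by (simp add: ln_div ln_mult)
          then show ?case by (simp add: left_diff_distrib)
        qed
      qed (unfold l_def, measurable)
      also have "\<dots> = 2 * pi * f p"
        using integral_log_laplacian[OF f, of p] KM(5,6) by simp
      also have "f p = ext_zero \<kappa> f y" using True by (simp add: ext_zero_def p_def)
      finally show ?thesis .
    next
      case False
      \<comment> \<open>The missing point of the chart has kernel \<open>1 / fs z\<close>, which
        cancels the Fubini-Study term; this agrees with the value 0 of \<open>ext_zero\<close>
        there.\<close>
      then have "l z y = 0" for z unfolding l_def chord_chart_outside[OF \<kappa> False] by (simp add: ln_div)
      then show ?thesis using False by (simp add: ext_zero_def)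
    qed
    \<comment> \<open>Almost everywhere on the support the potential is finite, so there its
      real-valued version is an honest integral of \<open>l\<close>.\<close>
    have Nfin: "AE z in lborel. z \<in> cball 0 K \<longrightarrow> N z < top"
    proof -
      have "(\<integral>\<^sup>+z\<in>cball 0 K. N z \<partial>lborel) = (\<integral>\<^sup>+z. (\<integral>\<^sup>+y. nlog (chord (\<kappa> z) y) * indicator (cball 0 K) z \<partial>\<mu>) \<partial>lborel)"
        unfolding N_def by (intro nn_integral_cong nn_integral_multc[symmetric]) measurable
      also have "\<dots> = (\<integral>\<^sup>+y. (\<integral>\<^sup>+z\<in>cball 0 K. nlog (chord (\<kappa> z) y) \<partial>lborel) \<partial>\<mu>)"
        by (rule Fubini'[symmetric]) measurable
      also have "\<dots> \<le> (\<integral>\<^sup>+y. ennreal B \<partial>\<mu>)" by (intro nn_integral_mono B)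
      also have "\<dots> < \<infinity>" by (simp add: space \<mu>(3))
      finally have "AE z in lborel. N z * indicator (cball 0 K) z \<noteq> \<infinity>"
        by (intro nn_integral_PInf_AE) auto
      then show ?thesis by eventually_elim (auto simp: less_top indicator_def split: if_splits)
    qed
    have outer: "AE z in lborel. real_of_ereal (local_pot (pot C \<mu>) \<kappa> z) * laplacian f z
        = C * laplacian f z + (\<integral>y. l z y * laplacian f z \<partial>\<mu>)"
      using Nfin
    proof eventually_elim
      case (elim z)
      show ?case
      proof (cases "z \<in> cball 0 K")
        case False
        then have "laplacian f z = 0" using KM(3)[of z] by simp
        then show ?thesis by simp
      next
        case True
        then have Nz: "N z < top" using elim by simp
        have AEc: "AE y in \<mu>. nlog (chord (\<kappa> z) y) \<noteq> \<infinity>"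
          by (rule nn_integral_PInf_AE) (use Nz in \<open>auto simp: N_def\<close>)
        have "N z = (\<integral>\<^sup>+y. ennreal (- ln (chord (\<kappa> z) y)) \<partial>\<mu>)"
          unfolding N_def
          by (rule nn_integral_cong_AE, use AEc in eventually_elim) (auto simp: nlog_def split: if_splits)
        moreover have "0 \<le> - ln (chord (\<kappa> z) y)" for y
        proof (cases "chord (\<kappa> z) y = 0")
          case False
          then show ?thesis using chord_le_1[of "\<kappa> z" y] chord_nonneg[of "\<kappa> z" y] by simp
        qed simp
        ultimately have "has_bochner_integral \<mu> (\<lambda>y. - ln (chord (\<kappa> z) y)) (enn2real (N z))"
          using Nz by (intro has_bochner_integral_nn_integral) (auto simp: less_top)
        then have h: "integrable \<mu> (\<lambda>y. ln (chord (\<kappa> z) y))" "(\<integral>y. ln (chord (\<kappa> z) y) \<partial>\<mu>) = - enn2real (N z)"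
          by (auto simp: has_bochner_integral_iff)
        then have "(\<integral>y. l z y \<partial>\<mu>) = ln (fs z) - enn2real (N z)"
          unfolding l_def by (subst Bochner_Integration.integral_add) (auto simp: space m1)
        moreover have "real_of_ereal (local_pot (pot C \<mu>) \<kappa> z) = C + ln (fs z) - enn2real (N z)"
          using Nz unfolding pot_local N_def[symmetric] by (cases "N z") auto
        ultimately have eq: "real_of_ereal (local_pot (pot C \<mu>) \<kappa> z) = C + (\<integral>y. l z y \<partial>\<mu>)"
          by simp
        show ?thesis unfolding eq by (simp add: distrib_right)
      qed
    qed
    have i2: "integrable lborel (\<lambda>z. \<integral>y. l z y * laplacian f z \<partial>\<mu>)"
      using integrable_fst'[OF intH] by simp
    have mP: "(\<lambda>z. real_of_ereal (local_pot (pot C \<mu>) \<kappa> z) * laplacian f z) \<in> borel_measurable lborel"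
      unfolding pot_local N_def[symmetric] by measurable
    have mL: "(\<lambda>z. \<integral>y. l z y * laplacian f z \<partial>\<mu>) \<in> borel_measurable lborel"
      using i2 by (rule borel_measurable_integrable)
    have "(\<integral>z. real_of_ereal (local_pot (pot C \<mu>) \<kappa> z) * laplacian f z \<partial>lborel)
        = (\<integral>z. C * laplacian f z + (\<integral>y. l z y * laplacian f z \<partial>\<mu>) \<partial>lborel)"
      by (rule integral_cong_AE[OF mP _ outer]) (use mL in measurable)
    also have "\<dots> = (\<integral>z. (\<integral>y. l z y * laplacian f z \<partial>\<mu>) \<partial>lborel)"
      using KM(5,6) i2 by simp
    also have "\<dots> = (\<integral>y. (\<integral>z. l z y * laplacian f z \<partial>lborel) \<partial>\<mu>)"
      by (rule Fubini_integral[OF intH, symmetric])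
    also have "\<dots> = 2 * pi * (\<integral>y. ext_zero \<kappa> f y \<partial>\<mu>)"
      by (simp add: inner)
    finally show ?thesis by simp
  qed
  then show ?thesis
    using space \<mu> by (auto simp: curvature_measure_def sets_cp1_borel)
qed

section \<open>Domination and model potentials\<close>

text \<open>The mean exceeds the value at the centre by the square of the radius; this surplus makes
  the maximum principle strict.\<close>

lemma has_integral_cmod_sq_circle:
  "((\<lambda>t. (cmod (a + of_real r * cis t))\<^sup>2) has_integral 2 * pi * ((cmod a)\<^sup>2 + r\<^sup>2)) {0..2*pi}"
proof -
  let ?G = "\<lambda>t. ((cmod a)\<^sup>2 + r\<^sup>2) * t + 2 * r * (Re a * sin t - Im a * cos t)"
  have ring: "(x + r * c)\<^sup>2 + (y + r * d)\<^sup>2 = x\<^sup>2 + y\<^sup>2 + r\<^sup>2 * (c\<^sup>2 + d\<^sup>2) + 2 * r * (x * c + y * d)" for x y c d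
    by (simp add: power2_eq_square algebra_simps)
  have eq: "(cmod (a + of_real r * cis t))\<^sup>2 = (cmod a)\<^sup>2 + r\<^sup>2 + 2 * r * (Re a * cos t + Im a * sin t)" for t
  proof -
    have "(cmod (a + of_real r * cis t))\<^sup>2
        = (Re a)\<^sup>2 + (Im a)\<^sup>2 + r\<^sup>2 * ((cos t)\<^sup>2 + (sin t)\<^sup>2) + 2 * r * (Re a * cos t + Im a * sin t)"
    proof -
      have "(cmod (a + of_real r * cis t))\<^sup>2 = (Re a + r * cos t)\<^sup>2 + (Im a + r * sin t)\<^sup>2"
        by (simp only: cmod_power2) simp
      also have "\<dots> = (Re a)\<^sup>2 + (Im a)\<^sup>2 + r\<^sup>2 * ((cos t)\<^sup>2 + (sin t)\<^sup>2) + 2 * r * (Re a * cos t + Im a * sin t)"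
        by (rule ring)
      finally show ?thesis .
    qed
    moreover have "(cos t)\<^sup>2 + (sin t)\<^sup>2 = 1" by simp
    ultimately show ?thesis by (simp only: cmod_power2[of a] mult_1_right)
  qed
  have "((\<lambda>t. (cmod a)\<^sup>2 + r\<^sup>2 + 2 * r * (Re a * cos t + Im a * sin t)) has_integral (?G (2*pi) - ?G 0)) {0..2*pi}"
    by (intro fundamental_theorem_of_calculus)
      (auto intro!: derivative_eq_intros simp flip: has_real_derivative_iff_has_vector_derivative)
  then show ?thesis unfolding eq by (simp add: mult.commute)
qed

text \<open>The maximum principle for \<open>w - (1 - \<eta>) F + \<eta> |z|^2\<close>: removing a small part \<open>\<eta> F\<close> of the poles
  forces the supremum away from them, and the term \<open>\<eta> |z|^2\<close> excludes an interior maximum.\<close>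

lemma log_pole_domination:
  fixes w :: "complex \<Rightarrow> ereal" and \<beta> :: "'i \<Rightarrow> real" and p :: "'i \<Rightarrow> complex" and F :: "complex \<Rightarrow> real"
  assumes w: "subharmonic w" and I: "finite I" and \<beta>: "\<And>i. i \<in> I \<Longrightarrow> 0 < \<beta> i"
    and p: "\<And>i. i \<in> I \<Longrightarrow> cmod (p i) < R"
    and F: "F = (\<lambda>z. \<Sum>i\<in>I. \<beta> i * ln (cmod (z - p i)))"
    and inner: "\<And>z. cmod z \<le> R \<Longrightarrow> z \<notin> p ` I \<Longrightarrow> w z \<le> ereal (F z + C)"
    and boundary: "\<And>z. cmod z = R \<Longrightarrow> w z \<le> ereal (F z + K)"
    and z0: "cmod z0 \<le> R" "z0 \<notin> p ` I"
  shows "w z0 \<le> ereal (F z0 + K)"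
proof (rule ccontr)
  assume "\<not> w z0 \<le> ereal (F z0 + K)"
  then have gt: "ereal (F z0 + K) < w z0" by simp
  have winf: "w z < \<infinity>" for z using w by (simp add: subharmonic_def)
  obtain w0 where w0: "w z0 = ereal w0" using gt winf[of z0] by (cases "w z0") auto
  define d where "d = w0 - F z0 - K"
  have d: "0 < d" using gt w0 by (simp add: d_def)
  have R0: "0 \<le> R" using z0(1) norm_ge_zero order_trans by blast
  define U where "U = (\<Sum>i\<in>I. \<beta> i * ln (2 * R + 1))"
  have lnle: "ln (cmod (z - p i)) \<le> ln (2 * R + 1)" if "cmod z \<le> R" "i \<in> I" for z i
  proof (cases "z = p i")
    case True
    then show ?thesis using R0 by simp
  next
    case False
    have "cmod (z - p i) \<le> 2 * R + 1" using norm_triangle_ineq4[of z "p i"] that p[OF that(2)] by linarith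
    then show ?thesis using False by (subst ln_le_cancel_iff) (use R0 in auto)
  qed
  have FU: "F z \<le> U" if "cmod z \<le> R" for z
    unfolding F U_def using that \<beta> by (intro sum_mono mult_left_mono lnle) (auto simp: less_imp_le)
  have FUi: "F z \<le> \<beta> i * ln (cmod (z - p i)) + U" if "cmod z \<le> R" "i \<in> I" for z i
  proof -
    have "F z = \<beta> i * ln (cmod (z - p i)) + (\<Sum>j\<in>I - {i}. \<beta> j * ln (cmod (z - p j)))"
      unfolding F using I that(2) by (rule sum.remove)
    also have "(\<Sum>j\<in>I - {i}. \<beta> j * ln (cmod (z - p j))) \<le> (\<Sum>j\<in>I - {i}. \<beta> j * ln (2 * R + 1))"
      using that \<beta> by (intro sum_mono mult_left_mono lnle) (auto simp: less_imp_le)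
    also have "\<dots> \<le> U" unfolding U_def using I \<beta> R0
      by (intro sum_mono2) (auto intro!: mult_nonneg_nonneg simp: less_imp_le)
    finally show ?thesis by simp
  qed
  \<comment> \<open>Small enough that the perturbation costs less than the gap \<open>d\<close> at
    \<open>z0\<close>; this is spent in the boundary case.\<close>
  define \<eta> where "\<eta> = d / (d + (U + R\<^sup>2 - F z0) + 1)"
  have nn: "0 \<le> U + R\<^sup>2 - F z0" using FU[OF z0(1)] zero_le_power2[of R] by linarith
  have \<eta>: "0 < \<eta>" "\<eta> < 1" and \<eta>d: "\<eta> * (U + R\<^sup>2 - F z0) < d"
  proof -
    show "0 < \<eta>" "\<eta> < 1" using d nn by (auto simp: \<eta>_def)
    have "d * (U + R\<^sup>2 - F z0) < d * (d + (U + R\<^sup>2 - F z0) + 1)"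
      using d by (intro mult_strict_left_mono) auto
    then show "\<eta> * (U + R\<^sup>2 - F z0) < d" using d nn by (simp add: \<eta>_def pos_divide_less_eq)
  qed
  define e where "e z = (1 - \<eta>) * F z - \<eta> * (cmod z)\<^sup>2" for z
  define W where "W z = real_of_ereal (w z)" for z
  define X where "X = {z. cmod z \<le> R \<and> z \<notin> p ` I \<and> w z \<noteq> -\<infinity>}"
  have wW: "w z = ereal (W z)" if "w z \<noteq> -\<infinity>" for z
    using that winf[of z] unfolding W_def by (cases "w z") auto
  have DX: "W z - e z \<le> \<eta> * F z + (C + R\<^sup>2)" if "z \<in> X" for z
  proof -
    have "W z \<le> F z + C" using inner[of z] that wW[of z] by (simp add: X_def)
    moreover have "\<eta> * (cmod z)\<^sup>2 \<le> 1 * R\<^sup>2"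
      using that \<eta> by (intro mult_mono power_mono) (auto simp: X_def)
    ultimately show ?thesis by (simp add: e_def algebra_simps)
  qed
  have bdd: "bdd_above ((\<lambda>z. W z - e z) ` X)"
  proof (rule bdd_aboveI2)
    fix z assume z: "z \<in> X"
    have "\<eta> * F z \<le> \<eta> * U" using z \<eta> FU by (intro mult_left_mono) (auto simp: X_def)
    then show "W z - e z \<le> \<eta> * U + (C + R\<^sup>2)" using DX[OF z] by linarith
  qed
  define s where "s = (SUP z\<in>X. W z - e z)"
  have z0X: "z0 \<in> X" using z0 w0 by (simp add: X_def)
  have sX: "W z - e z \<le> s" if "z \<in> X" for z unfolding s_def by (rule cSUP_upper[OF that bdd])
  \<comment> \<open>\<open>X\<close> is not closed, so the supremum is approached by a sequence.
    Compactness of the disc yields a limit point, which must still be shown to lie in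
    \<open>X\<close>.\<close>
  have "\<exists>z\<in>X. s - 1 / real (Suc n) < W z - e z" for n
  proof -
    have "s - 1 / real (Suc n) < s" by simp
    then show ?thesis unfolding s_def using less_cSUP_iff[OF _ bdd] z0X by blast
  qed
  then obtain Z where Z: "\<And>n. Z n \<in> X" "\<And>n. s - 1 / real (Suc n) < W (Z n) - e (Z n)" by metis
  have "compact (cball (0::complex) R)" by simp
  moreover have "\<forall>n. Z n \<in> cball 0 R" using Z(1) by (simp add: X_def)
  ultimately obtain a r where a: "a \<in> cball 0 R" "strict_mono r" "(Z \<circ> r) \<longlonglongrightarrow> a"
    unfolding compact_def by metis
  define Y where "Y = Z \<circ> r"
  have YX: "Y n \<in> X" for n using Z(1) by (simp add: Y_def)
  have Ylim: "Y \<longlonglongrightarrow> a" using a(3) by (simp add: Y_def)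
  have Ys: "s - 1 / real (Suc n) < W (Y n) - e (Y n)" for n
  proof -
    have "1 / real (Suc (r n)) \<le> 1 / real (Suc n)"
      using seq_suble[OF a(2), of n] by (intro divide_left_mono) auto
    then show ?thesis using Z(2)[of "r n"] by (simp add: Y_def)
  qed
  \<comment> \<open>By \<open>DX\<close> the difference is at most \<eta> F plus a constant, which
    tends to minus infinity at a pole; points that nearly attain \<open>s\<close> thus keep the
    distance \<open>exp c\<close> from \<open>p i\<close>.\<close>
  have aP: "a \<notin> p ` I"
  proof
    assume "a \<in> p ` I"
    then obtain i where i: "i \<in> I" "a = p i" by blast
    define c where "c = (s - 1 - \<eta> * U - (C + R\<^sup>2)) / (\<eta> * \<beta> i)"
    have "exp c \<le> cmod (Y n - p i)" for n
    proof -
      have Yn: "cmod (Y n) \<le> R" "Y n \<noteq> p i" using YX[of n] i by (auto simp: X_def)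
      have "s - 1 \<le> s - 1 / real (Suc n)" by simp
      also have "\<dots> \<le> \<eta> * F (Y n) + (C + R\<^sup>2)" using Ys[of n] DX[OF YX, of n] by linarith
      also have "\<dots> \<le> \<eta> * (\<beta> i * ln (cmod (Y n - p i)) + U) + (C + R\<^sup>2)"
        using \<eta> FUi[OF Yn(1) i(1)] by simp
      finally have "s - 1 - \<eta> * U - (C + R\<^sup>2) \<le> (\<eta> * \<beta> i) * ln (cmod (Y n - p i))"
        by (simp add: algebra_simps)
      then have "c \<le> ln (cmod (Y n - p i))"
        unfolding c_def using \<eta> \<beta>[OF i(1)] by (simp add: pos_divide_le_eq mult.commute)
      then have "exp c \<le> exp (ln (cmod (Y n - p i)))" by simp
      then show ?thesis using Yn by simp
    qed
    moreover have "(\<lambda>n. cmod (Y n - p i)) \<longlonglongrightarrow> cmod (a - p i)" by (intro tendsto_intros Ylim)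
    ultimately have "exp c \<le> cmod (a - p i)" by (intro LIMSEQ_le_const) auto
    then show False using i by simp
  qed
  have Fc: "isCont F x" if "x \<notin> p ` I" for x
    unfolding F using that by (intro continuous_intros) auto
  have elim: "(\<lambda>n. e (Y n)) \<longlonglongrightarrow> e a"
    unfolding e_def by (intro tendsto_intros Ylim isCont_tendsto_compose[OF Fc[OF aP]])
  \<comment> \<open>Upper semicontinuity of \<open>w\<close> and continuity of \<open>e\<close> off
    the poles show that the supremum is attained at \<open>a\<close>.\<close>
  have wa: "ereal (s + e a) \<le> w a"
  proof (rule ccontr)
    assume "\<not> ereal (s + e a) \<le> w a"
    then have "w a < ereal (s + e a)" by simp
    then obtain k where k: "w a < ereal k" "ereal k < ereal (s + e a)" using ereal_dense2 by blast
    have "open {z. w z < ereal k}" using w by (simp add: subharmonic_def usc_def)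
    then have "eventually (\<lambda>n. Y n \<in> {z. w z < ereal k}) sequentially"
      using k(1) by (intro topological_tendstoD[OF Ylim]) auto
    then have "eventually (\<lambda>n. s - 1 / real (Suc n) + e (Y n) \<le> k) sequentially"
    proof eventually_elim
      case (elim n)
      then have "W (Y n) < k" using wW[of "Y n"] YX[of n] by (simp add: X_def)
      then show ?case using Ys[of n] by linarith
    qed
    moreover have "(\<lambda>n. s - 1 / real (Suc n) + e (Y n)) \<longlonglongrightarrow> s - 0 + e a"
      by (intro tendsto_intros elim LIMSEQ_Suc[OF lim_1_over_n])
    ultimately have "s - 0 + e a \<le> k" by (intro tendsto_upperbound) auto
    then show False using k(2) by simp
  qed
  have aX: "a \<in> X" using a(1) aP wa by (auto simp: X_def)
  then have Wa: "w a = ereal (W a)" "s + e a \<le> W a" using wW[of a] wa by (auto simp: X_def)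
  show False
  proof (cases "cmod a = R")
    case True
    have "W a \<le> F a + K" using boundary[OF True] Wa by simp
    then have "s \<le> \<eta> * F a + K + \<eta> * R\<^sup>2" using Wa(2) True by (simp add: e_def algebra_simps)
    also have "\<dots> \<le> \<eta> * U + K + \<eta> * R\<^sup>2" using \<eta> FU[of a] True by simp
    finally have 1: "s \<le> \<eta> * U + K + \<eta> * R\<^sup>2" .
    have "W z0 = w0" using w0 by (simp add: W_def)
    then have "w0 - (1 - \<eta>) * F z0 + \<eta> * (cmod z0)\<^sup>2 \<le> s" using sX[OF z0X] by (simp add: e_def)
    moreover have "0 \<le> \<eta> * (cmod z0)\<^sup>2" using \<eta> by simp
    ultimately have "d \<le> \<eta> * (U + R\<^sup>2 - F z0)" using 1 by (simp add: d_def algebra_simps)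
    then show False using \<eta>d by linarith
  next
    case False
    then have aR: "cmod a < R" using a(1) by simp
    have "open (ball 0 R - p ` I)" using I by (intro open_Diff finite_imp_closed) auto
    then obtain r' where r': "0 < r'" "cball a r' \<subseteq> ball 0 R - p ` I"
      using aR aP by (metis DiffI dist_0_norm mem_ball open_contains_cball_eq)
    have Pdist: "r' < cmod (a - p i)" if "i \<in> I" for i
    proof (rule ccontr)
      assume "\<not> r' < cmod (a - p i)"
      then have "p i \<in> cball a r'" by (simp add: dist_norm)
      then show False using r' that by blast
    qed
    have circ: "a + of_real r' * cis t \<in> cball a r'" for t using r' by (simp add: dist_norm norm_mult)
    \<comment> \<open>The mean of \<open>F\<close> over a small circle reproduces its value at the
      centre, while the quadratic term gains \<eta> times the squared radius. The supremum bound on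
      the circle then contradicts \<open>wa\<close>.\<close>
    have "W a \<le> s + (1 - \<eta>) * F a - \<eta> * ((cmod a)\<^sup>2 + r'\<^sup>2)"
    proof -
      have "w a \<le> circle_mean w a r'" using w r' by (simp add: subharmonic_def)
      also have "\<dots> \<le> circle_mean (\<lambda>z. ereal (s + e z)) a r'"
      proof (rule circle_mean_mono[OF r'(1)])
        fix t
        let ?z = "a + of_real r' * cis t"
        have z: "?z \<in> ball 0 R - p ` I" using circ[of t] r'(2) by blast
        show "w ?z \<le> ereal (s + e ?z)"
        proof (cases "w ?z = -\<infinity>")
          case False
          then have "?z \<in> X" using z by (auto simp: X_def)
          from sX[OF this] show ?thesis unfolding wW[OF False] by simp
        qed simp
      qed
      also have "\<dots> = ereal (2 * pi * (s + (1 - \<eta>) * F a - \<eta> * ((cmod a)\<^sup>2 + r'\<^sup>2)) / (2 * pi))"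
      proof (rule circle_mean_real)
        have c: "continuous_on {0..2*pi} (\<lambda>t. F (a + of_real r' * cis t))"
        proof (rule continuous_at_imp_continuous_on, rule ballI)
          fix t
          have "isCont F (a + of_real r' * cis t)" using circ[of t] r'(2) by (intro Fc) blast
          moreover have "continuous_on UNIV (\<lambda>t. a + of_real r' * cis t)" by (intro continuous_intros)
          then have "isCont (\<lambda>t. a + of_real r' * cis t) t"
            by (simp add: continuous_on_eq_continuous_at)
          ultimately show "isCont (\<lambda>t. F (a + of_real r' * cis t)) t" by (rule isCont_o2[rotated])
        qed
        show "continuous_on {0..2*pi} (\<lambda>t. s + e (a + of_real r' * cis t))"
          unfolding e_def by (intro continuous_intros c)
        have "((\<lambda>t. F (a + of_real r' * cis t)) has_integral (\<Sum>i\<in>I. \<beta> i * (2 * pi * ln (cmod (a - p i))))) {0..2*pi}"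
          unfolding F
        proof (intro has_integral_sum I has_integral_mult_right)
          fix i assume "i \<in> I"
          from circle_ln_mean_real[OF r'(1) Pdist[OF this]]
          show "((\<lambda>t. ln (cmod (a + of_real r' * cis t - p i))) has_integral 2 * pi * ln (cmod (a - p i))) {0..2*pi}"
            by (simp add: algebra_simps)
        qed
        moreover have "(\<Sum>i\<in>I. \<beta> i * (2 * pi * ln (cmod (a - p i)))) = 2 * pi * F a"
          unfolding F sum_distrib_left by (intro sum.cong) auto
        ultimately have iF: "((\<lambda>t. F (a + of_real r' * cis t)) has_integral 2 * pi * F a) {0..2*pi}" by simp
        have "((\<lambda>t. s + ((1 - \<eta>) * F (a + of_real r' * cis t) - \<eta> * (cmod (a + of_real r' * cis t))\<^sup>2)) has_integral
            ((2 * pi - 0) * s + ((1 - \<eta>) * (2 * pi * F a) - \<eta> * (2 * pi * ((cmod a)\<^sup>2 + r'\<^sup>2))))) {0..2*pi}"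
          by (intro has_integral_add has_integral_diff has_integral_mult_right iF has_integral_cmod_sq_circle)
            (use has_integral_const_real[of s 0 "2*pi"] in simp)
        then show "((\<lambda>t. s + e (a + of_real r' * cis t)) has_integral
            2 * pi * (s + (1 - \<eta>) * F a - \<eta> * ((cmod a)\<^sup>2 + r'\<^sup>2))) {0..2*pi}"
          unfolding e_def by (simp add: algebra_simps)
      qed
      finally show ?thesis using Wa(1) by simp
    qed
    moreover have "0 < \<eta> * r'\<^sup>2" using \<eta> r' by simp
    ultimately show False using Wa(2) by (simp add: e_def algebra_simps)
  qed
qed

section \<open>From domination to the model property\<close>

lemma usc_reg_eq:
  assumes u: "usc X u" and x: "x \<in> topspace X"
  shows "usc_reg X u x = u x"
proof (rule antisym)
  show "usc_reg X u x \<le> u x"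
  proof (rule dense_ge)
    fix c assume "u x < c"
    moreover have "openin X {x \<in> topspace X. u x < c}" using u by (simp add: usc_def)
    ultimately have "eventually (\<lambda>y. u y < c) (nhdsin X x)"
      unfolding eventually_nhdsin using x by (intro disjI2 exI[of _ "{x \<in> topspace X. u x < c}"]) auto
    then have "eventually (\<lambda>y. u y \<le> c) (nhdsin X x)" by eventually_elim simp
    then show "usc_reg X u x \<le> c" unfolding usc_reg_def by (rule Limsup_bounded)
  qed
  show "u x \<le> usc_reg X u x"
    unfolding usc_reg_def Limsup_def
  proof (rule INF_greatest)
    fix P assume "P \<in> {P. eventually P (nhdsin X x)}"
    then have "P x" using x by (auto simp: eventually_nhdsin)
    then show "u x \<le> Sup (u ` Collect P)" by (intro SUP_upper) simp
  qed
qed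

text \<open>For \<open>C >= 0\<close> the function \<open>u\<close> competes in its own envelope,
  and \<open>dom\<close> makes it the largest competitor. All these envelopes equal
  \<open>u\<close>, so limit and regularisation change nothing.\<close>

lemma model_potentialI:
  assumes u: "u \<in> PSH" "(SUP x. u x) = 0"
    and dom: "\<And>v C. v \<in> PSH \<Longrightarrow> (\<And>x. v x \<le> 0) \<Longrightarrow> (\<And>x. v x \<le> u x + ereal C) \<Longrightarrow> v \<le> u"
  shows "model_potential u"
proof -
  have usc: "usc_reg cp1_top u = u"
    using u(1) by (intro ext usc_reg_eq) (auto simp: PSH_def)
  have u0: "u x \<le> 0" for x using u(2) by (metis SUP_upper UNIV_I)
  have env: "P_env (\<lambda>y. min (u y + ereal C) 0) = u" if C: "0 \<le> C" for C
  proof -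
    have "(SUP v \<in> {v \<in> PSH. v \<le> (\<lambda>y. min (u y + ereal C) 0)}. v x) = u x" for x
    proof (rule antisym)
      show "(SUP v \<in> {v \<in> PSH. v \<le> (\<lambda>y. min (u y + ereal C) 0)}. v x) \<le> u x"
      proof (rule SUP_least)
        fix v assume "v \<in> {v \<in> PSH. v \<le> (\<lambda>y. min (u y + ereal C) 0)}"
        then have "v \<in> PSH" "v y \<le> 0" "v y \<le> u y + ereal C" for y by (auto simp: le_fun_def)
        then have "v \<le> u" by (rule dom)
        then show "v x \<le> u x" by (simp add: le_fun_def)
      qed
      have "u y \<le> u y + ereal C" for y using C by (cases "u y") auto
      then have "u \<in> {v \<in> PSH. v \<le> (\<lambda>y. min (u y + ereal C) 0)}" using u(1) u0 by (auto simp: le_fun_def)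
      then show "u x \<le> (SUP v \<in> {v \<in> PSH. v \<le> (\<lambda>y. min (u y + ereal C) 0)}. v x)" by (rule SUP_upper)
    qed
    then have "P_env (\<lambda>y. min (u y + ereal C) 0) = usc_reg cp1_top u" by (simp add: P_env_def)
    then show ?thesis using usc by simp
  qed
  have "Lim at_top (\<lambda>C::real. P_env (\<lambda>y. min (u y + ereal C) 0) x) = u x" for x
  proof (rule tendsto_Lim)
    have "eventually (\<lambda>C::real. P_env (\<lambda>y. min (u y + ereal C) 0) x = u x) at_top"
      using eventually_ge_at_top[of 0] by eventually_elim (simp add: env)
    then show "((\<lambda>C::real. P_env (\<lambda>y. min (u y + ereal C) 0) x) \<longlongrightarrow> u x) at_top"
      by (rule tendsto_eventually)
  qed simp
  then have "P_model u = usc_reg cp1_top u" by (simp add: P_model_def)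
  then show ?thesis using u usc by (simp add: model_potential_def normalized_def)
qed

section \<open>The potential of the Fubini-Study measure on a cap\<close>

text \<open>The closed disc of Fubini-Study mass \<open>q\<close> about 0 has radius \<open>sqrt (q / (1 - q))\<close>, so for \<open>q\<close>
  and the angle \<open>s\<close> uniformly distributed this parametrises the normalised Fubini-Study measure.\<close>

definition disc_point :: "real \<Rightarrow> real \<Rightarrow> cp1" where
  "disc_point q s = Some (of_real (sqrt (q / (1 - q))) * cis s)"

lemma disc_point_measurable [measurable]:
  "(\<lambda>x. disc_point (fst x) (snd x)) \<in> borel \<Otimes>\<^sub>M borel \<rightarrow>\<^sub>M cp1_borel"
  unfolding disc_point_def by measurable

text \<open>The mean of - log chord over the circle that bounds the disc of mass \<open>q\<close>;
  the term in \<open>1 - q\<close> is the value of \<open>ln (fs _)\<close> on that circle.\<close>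

definition mean_kernel :: "complex \<Rightarrow> real \<Rightarrow> real" where
  "mean_kernel w q = ln (fs w) - 1 / 2 * ln (1 - q) - ln (max (cmod w) (sqrt (q / (1 - q))))"

lemma fs_disc_radius:
  assumes "0 \<le> q" "q < 1"
  shows "fs (of_real (sqrt (q / (1 - q)))) = 1 / sqrt (1 - q)"
proof -
  have "1 + (cmod (of_real (sqrt (q / (1 - q)))))\<^sup>2 = 1 / (1 - q)"
    using assms by (simp add: field_simps)
  then show ?thesis unfolding fs_def by (simp only: real_sqrt_divide real_sqrt_one)
qed

lemma nn_integral_disc_point:
  assumes q: "0 \<le> q" "q < 1" and ne: "cmod w \<noteq> sqrt (q / (1 - q))"
  shows "(\<integral>\<^sup>+s\<in>{0..2*pi}. nlog (chord (Some w) (disc_point q s)) \<partial>lborel) = ennreal (2 * pi) * ennreal (mean_kernel w q)"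
    and "0 \<le> mean_kernel w q"
proof -
  define t where "t = sqrt (q / (1 - q))"
  have t0: "0 \<le> t" using q by (simp add: t_def)
  have ft: "fs (of_real t) = 1 / sqrt (1 - q)" unfolding t_def by (rule fs_disc_radius[OF q])
  have eq: "chord (Some w) (disc_point q s) = cmod (w + - of_real t * cis s) / (fs w * fs (of_real t))" for s
  proof -
    have "fs (of_real t * cis s) = fs (of_real t)" by (simp add: fs_def norm_mult)
    then show ?thesis by (simp add: disc_point_def chord_def t_def)
  qed
  have ne': "cmod w \<noteq> cmod (- of_real t)" using ne t0 by (simp add: t_def)
  have S: "cmod w + cmod (- of_real t) \<le> fs w * fs (of_real t)"
    using cmod_add_le_fs[of w "of_real t"] by simp
  have mx: "max (cmod w) (cmod (- of_real t)) = max (cmod w) t" using t0 by simp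
  have mx0: "0 < max (cmod w) t" using ne' t0 by (smt (verit) norm_ge_zero norm_minus_cancel norm_of_real)
  have mk: "mean_kernel w q = - ln (max (cmod w) t / (fs w * fs (of_real t)))"
    using mx0 q by (simp add: mean_kernel_def t_def[symmetric] ln_div ln_mult ft ln_sqrt)
  have "max (cmod w) t \<le> fs w * fs (of_real t)" using S mx by (smt (verit) norm_ge_zero)
  then have "max (cmod w) t / (fs w * fs (of_real t)) \<le> 1" by (simp add: divide_le_eq_1)
  then show "0 \<le> mean_kernel w q" unfolding mk using mx0 by (simp add: ln_le_zero_iff)
  show "(\<integral>\<^sup>+s\<in>{0..2*pi}. nlog (chord (Some w) (disc_point q s)) \<partial>lborel) = ennreal (2 * pi) * ennreal (mean_kernel w q)"
    unfolding eq nn_integral_nlog_circle[OF ne' S] mx using mx0 by (simp add: nlog_pos mk)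
qed

text \<open>Continuity at 0 is needed for the second primitive in
  \<open>mean_kernel_integral\<close> when \<open>w = 0\<close>.\<close>

lemma continuous_on_x_ln_x: "continuous_on {0..} (\<lambda>x::real. x * ln x)"
  unfolding continuous_on_eq_continuous_within
proof
  fix x :: real assume x: "x \<in> {0..}"
  show "continuous (at x within {0..}) (\<lambda>x. x * ln x)"
  proof (cases "x = 0")
    case True
    have "((\<lambda>x::real. x * ln x) \<longlongrightarrow> 0) (at_right 0)" by real_asymp
    moreover have "at (0::real) within {0..} = at_right 0"
      by (rule at_within_Ici_at_right)
    ultimately show ?thesis using True by (simp add: continuous_within)
  next
    case False
    then show ?thesis using x by (intro continuous_intros) auto
  qed
qed

text \<open>The closed form of the integral of \<open>nlog\<close> of the chord against the
  Fubini-Study measure of the cap, a disc of mass \<open>1 - \<rho>\<close>.\<close>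

definition cap_integral :: "real \<Rightarrow> complex \<Rightarrow> real" where
  "cap_integral \<rho> w = (1 - \<rho>) * ln (fs w) +
     (if w \<in> cap \<rho> then - ln (fs w) + 1 / 2 * ((1 - \<rho>) - (1 - \<rho>) * ln (1 - \<rho>))
      else 1 / 2 * (\<rho> * ln \<rho> + (1 - \<rho>)) - (1 - \<rho>) * ln (cmod w))"

lemma mean_kernel_integral:
  assumes \<rho>: "0 < \<rho>" "\<rho> < 1"
  shows "(mean_kernel w has_integral cap_integral \<rho> w) {0..1 - \<rho>}"
proof -
  \<comment> \<open>The Fubini-Study mass of the disc bounded by the circle through
    \<open>w\<close>. For \<open>q <= Q\<close> the maximum in the kernel is |w|, beyond it is the
    radius of the circle.\<close>
  define Q where "Q = (cmod w)\<^sup>2 / (1 + (cmod w)\<^sup>2)"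
  have w1: "0 < 1 + (cmod w)\<^sup>2" by (simp add: add_pos_nonneg)
  have Q: "0 \<le> Q" "Q < 1" using w1 by (auto simp: Q_def)
  have Q1: "1 - Q = 1 / (1 + (cmod w)\<^sup>2)" using w1 by (simp add: Q_def field_simps)
  have le_iff: "sqrt (q / (1 - q)) \<le> cmod w \<longleftrightarrow> q \<le> Q" if "0 \<le> q" "q < 1" for q
  proof -
    have "sqrt (q / (1 - q)) \<le> cmod w \<longleftrightarrow> q / (1 - q) \<le> (cmod w)\<^sup>2"
      using real_sqrt_le_iff[of "q / (1 - q)" "(cmod w)\<^sup>2"] by simp
    also have "\<dots> \<longleftrightarrow> q \<le> Q" using that w1 by (simp add: Q_def field_simps)
    finally show ?thesis .
  qed
  have k1: "mean_kernel w q = ln (fs w) - 1 / 2 * ln (1 - q) - ln (cmod w)" if "0 \<le> q" "q < 1" "q \<le> Q" for q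
    using that le_iff[of q] by (simp add: mean_kernel_def max_def)
  have k2: "mean_kernel w q = ln (fs w) - 1 / 2 * ln q" if "0 < q" "q < 1" "Q < q" for q
  proof -
    have "\<not> sqrt (q / (1 - q)) \<le> cmod w" using that le_iff[of q] by simp
    then have "max (cmod w) (sqrt (q / (1 - q))) = sqrt (q / (1 - q))" by simp
    then show ?thesis using that by (simp add: mean_kernel_def ln_sqrt ln_div diff_divide_distrib)
  qed
  define G1 where "G1 q = q * ln (fs w) + 1 / 2 * ((1 - q) * ln (1 - q) + q) - q * ln (cmod w)" for q
  define G2 where "G2 q = q * ln (fs w) + 1 / 2 * (q - q * ln q)" for q
  have i1: "(mean_kernel w has_integral (G1 b - G1 0)) {0..b}" if b: "0 \<le> b" "b \<le> Q" "b < 1" for b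
  proof (rule fundamental_theorem_of_calculus_interior[OF b(1)])
    show "continuous_on {0..b} G1" unfolding G1_def using b by (intro continuous_intros) auto
    fix q assume "q \<in> {0<..<b}"
    then have q: "0 < q" "q < 1" "q \<le> Q" using b by auto
    have q1: "1 - q \<noteq> 0" using q by simp
    define h where "h x = (1 - x) * ln (1 - x)" for x :: real
    have "(h has_real_derivative - ln (1 - q) - 1) (at q)"
      unfolding h_def using q q1 by (auto intro!: derivative_eq_intros)
    then have "(G1 has_real_derivative ln (fs w) + 1 / 2 * ((- ln (1 - q) - 1) + 1) - ln (cmod w)) (at q)"
      unfolding G1_def h_def[symmetric] by (auto intro!: derivative_eq_intros)
    moreover have "ln (fs w) + 1 / 2 * ((- ln (1 - q) - 1) + 1) - ln (cmod w) = mean_kernel w q"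
      using q by (simp add: k1)
    ultimately show "(G1 has_vector_derivative mean_kernel w q) (at q)"
      by (simp add: has_real_derivative_iff_has_vector_derivative)
  qed
  have i2: "(mean_kernel w has_integral (G2 (1 - \<rho>) - G2 Q)) {Q..1 - \<rho>}" if "Q \<le> 1 - \<rho>"
  proof (rule fundamental_theorem_of_calculus_interior[OF that])
    define h where "h x = x * ln x" for x :: real
    have "continuous_on {Q..1 - \<rho>} h"
      unfolding h_def by (rule continuous_on_subset[OF continuous_on_x_ln_x]) (use Q in auto)
    then show "continuous_on {Q..1 - \<rho>} G2" unfolding G2_def h_def[symmetric] by (intro continuous_intros)
    fix q assume "q \<in> {Q<..<1 - \<rho>}"
    then have q: "0 < q" "q < 1" "Q < q" using \<rho> Q by auto
    have "(G2 has_real_derivative ln (fs w) + 1 / 2 * (1 - (ln q + q * (1 / q)))) (at q)"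
      unfolding G2_def using q by (auto intro!: derivative_eq_intros simp: field_simps)
    moreover have "ln (fs w) + 1 / 2 * (1 - (ln q + q * (1 / q))) = mean_kernel w q"
      using q by (simp add: k2)
    ultimately show "(G2 has_vector_derivative mean_kernel w q) (at q)"
      by (simp add: has_real_derivative_iff_has_vector_derivative)
  qed
  have G10: "G1 0 = 0" by (simp add: G1_def)
  have lnf: "ln (fs w) = - 1 / 2 * ln (1 - Q)" using w1 by (simp add: ln_fs Q1 ln_div)
  have capQ: "w \<in> cap \<rho> \<longleftrightarrow> Q \<le> 1 - \<rho>"
  proof -
    have "(cmod w)\<^sup>2 \<le> (1 - \<rho>) / \<rho> \<longleftrightarrow> (cmod w)\<^sup>2 * \<rho> \<le> 1 - \<rho>" using \<rho> by (simp add: field_simps)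
    also have "\<dots> \<longleftrightarrow> Q \<le> 1 - \<rho>" unfolding Q_def pos_divide_le_eq[OF w1] by (simp add: algebra_simps)
    finally show ?thesis by (simp add: cap_def)
  qed
  show ?thesis
  proof (cases "w \<in> cap \<rho>")
    case True
    have Qr: "Q \<le> 1 - \<rho>" using True capQ by simp
    have "(mean_kernel w has_integral ((G1 Q - G1 0) + (G2 (1 - \<rho>) - G2 Q))) {0..1 - \<rho>}"
      by (rule has_integral_combine[OF Q(1) Qr i1[OF Q(1) order_refl Q(2)] i2[OF Qr]])
    moreover have "(G1 Q - G1 0) + (G2 (1 - \<rho>) - G2 Q) = cap_integral \<rho> w"
    proof (cases "w = 0")
      case True
      then have "Q = 0" by (simp add: Q_def)
      then show ?thesis using \<open>w \<in> cap \<rho>\<close> True by (simp add: G1_def G2_def cap_integral_def)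
    next
      case False
      then have "0 < Q" using w1 by (simp add: Q_def)
      have "ln Q = 2 * ln (cmod w) - ln (1 + (cmod w)\<^sup>2)"
        using False w1 by (simp add: Q_def ln_div ln_realpow)
      also have "\<dots> = 2 * ln (cmod w) + ln (1 - Q)" using w1 by (simp add: Q1 ln_div)
      finally have lnQ: "ln Q = 2 * ln (cmod w) + ln (1 - Q)" .
      show ?thesis using \<open>w \<in> cap \<rho>\<close> unfolding G1_def G2_def cap_integral_def lnf lnQ
        by (simp add: algebra_simps)
    qed
    ultimately show ?thesis by simp
  next
    case False
    then have Qr: "1 - \<rho> \<le> Q" using capQ by simp
    have "(mean_kernel w has_integral (G1 (1 - \<rho>) - G1 0)) {0..1 - \<rho>}"
      using i1[of "1 - \<rho>"] Qr \<rho> by simp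
    moreover have "G1 (1 - \<rho>) - G1 0 = cap_integral \<rho> w"
      using False by (simp add: G10 G1_def cap_integral_def)
    ultimately show ?thesis by simp
  qed
qed

lemma nn_integral_cap:
  assumes \<rho>: "0 < \<rho>" "\<rho> < 1"
  shows "(\<integral>\<^sup>+q\<in>{0..1 - \<rho>}. (\<integral>\<^sup>+s\<in>{0..2*pi}. nlog (chord (Some w) (disc_point q s)) \<partial>lborel) \<partial>lborel)
      = ennreal (2 * pi) * ennreal (cap_integral \<rho> w)" and "0 \<le> cap_integral \<rho> w"
proof -
  define Q where "Q = (cmod w)\<^sup>2 / (1 + (cmod w)\<^sup>2)"
  have w1: "0 < 1 + (cmod w)\<^sup>2" by (simp add: add_pos_nonneg)
  have ne: "cmod w \<noteq> sqrt (q / (1 - q))" if "0 \<le> q" "q < 1" "q \<noteq> Q" for q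
  proof
    assume "cmod w = sqrt (q / (1 - q))"
    then have "(cmod w)\<^sup>2 = q / (1 - q)" using that by simp
    then have "(cmod w)\<^sup>2 * (1 - q) = q" using that by simp
    then have "q = Q" unfolding Q_def using w1 by (simp add: field_simps)
    then show False using that by simp
  qed
  define k where "k q = (if q = Q then 0 else mean_kernel w q)" for q
  have ki: "(k has_integral cap_integral \<rho> w) {0..1 - \<rho>}"
    by (rule has_integral_spike_finite[OF _ _ mean_kernel_integral[OF \<rho>], of "{Q}"]) (auto simp: k_def)
  have k0: "0 \<le> k q" if "q \<in> {0..1 - \<rho>}" for q
    using that \<rho> nn_integral_disc_point(2)[OF _ _ ne] by (auto simp: k_def)
  show "0 \<le> cap_integral \<rho> w" using has_integral_nonneg[OF ki] k0 by simp
  have "(\<integral>\<^sup>+q\<in>{0..1 - \<rho>}. (\<integral>\<^sup>+s\<in>{0..2*pi}. nlog (chord (Some w) (disc_point q s)) \<partial>lborel) \<partial>lborel)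
     = (\<integral>\<^sup>+q. ennreal (2 * pi) * (ennreal (k q) * indicator {0..1 - \<rho>} q) \<partial>lborel)"
  proof (rule nn_integral_cong_AE, use AE_lborel_singleton[of Q] in eventually_elim)
    case (elim q)
    then show ?case
      using \<rho> nn_integral_disc_point(1)[OF _ _ ne, of q] by (auto simp: k_def indicator_def)
  qed
  also have "\<dots> = ennreal (2 * pi) * (\<integral>\<^sup>+q. ennreal (k q) * indicator {0..1 - \<rho>} q \<partial>lborel)"
  proof (rule nn_integral_cmult)
    have "k \<in> borel_measurable borel" unfolding k_def mean_kernel_def by measurable
    then show "(\<lambda>q. ennreal (k q) * indicator {0..1 - \<rho>} q) \<in> borel_measurable lborel" by measurable
  qed
  also have "(\<integral>\<^sup>+q. ennreal (k q) * indicator {0..1 - \<rho>} q \<partial>lborel) = ennreal (cap_integral \<rho> w)"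
    by (rule nn_integral_has_integral_lebesgue'[OF k0 ki])
  finally show "(\<integral>\<^sup>+q\<in>{0..1 - \<rho>}. (\<integral>\<^sup>+s\<in>{0..2*pi}. nlog (chord (Some w) (disc_point q s)) \<partial>lborel) \<partial>lborel)
      = ennreal (2 * pi) * ennreal (cap_integral \<rho> w)" .
qed

text \<open>The cap potential is a constant minus the integral for the cap minus that of a point
  mass \<rho> at infinity, whose kernel is \<open>ln (fs w)\<close>. This exhibits its curvature
  measure.\<close>

lemma cap_potential_eq_cap_integral:
  assumes \<rho>: "0 < \<rho>" "\<rho> < 1"
  shows "cap_potential \<rho> (Some w) =
    ereal (1 / 2 * ((1 - \<rho>) - (1 - \<rho>) * ln (1 - \<rho>)) - cap_integral \<rho> w - \<rho> * ln (fs w))"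
proof (cases "w \<in> cap \<rho>")
  case True
  then show ?thesis by (simp add: cap_potential_def cap_integral_def algebra_simps)
next
  case False
  then have "w \<noteq> 0" using \<rho> by (auto simp: cap_def)
  then show ?thesis using False
    by (simp add: cap_potential_def cap_integral_def ln_fs ln_realpow add_divide_distrib diff_divide_distrib algebra_simps)
qed

lemma cap_potential_nonpos:
  assumes \<rho>: "0 < \<rho>" "\<rho> < 1" shows "cap_potential \<rho> x \<le> 0"
proof (cases x)
  case None
  then show ?thesis by (simp add: cap_potential_def)
next
  case (Some w)
  show ?thesis
  proof (cases "w \<in> cap \<rho>")
    case True
    then show ?thesis using Some by (simp add: cap_potential_def)
  next
    case False
    text \<open>Concavity of the logarithm, with weights \<open>\<rho>\<close> and \<open>1 - \<rho>\<close>.\<close>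
    have w: "0 < (cmod w)\<^sup>2" using False \<rho> by (auto simp: cap_def)
    have "\<rho> * ln (1 / \<rho>) + (1 - \<rho>) * ln ((cmod w)\<^sup>2 / (1 - \<rho>)) \<le> ln (\<rho> * (1 / \<rho>) + (1 - \<rho>) * ((cmod w)\<^sup>2 / (1 - \<rho>)))"
    proof -
      have "concave_on {0<..} (ln :: real \<Rightarrow> real)" by (rule ln_concave)
      from concave_onD[OF this, of "1 - \<rho>" "1 / \<rho>" "(cmod w)\<^sup>2 / (1 - \<rho>)"] show ?thesis
        using \<rho> w by simp
    qed
    also have "\<rho> * (1 / \<rho>) + (1 - \<rho>) * ((cmod w)\<^sup>2 / (1 - \<rho>)) = 1 + (cmod w)\<^sup>2" using \<rho> by simp
    finally have "\<rho> * ln (1 / \<rho>) + (1 - \<rho>) * ln ((cmod w)\<^sup>2 / (1 - \<rho>)) \<le> ln (1 + (cmod w)\<^sup>2)" .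
    moreover have "ln (1 / \<rho>) = - ln \<rho>" "ln ((cmod w)\<^sup>2 / (1 - \<rho>)) = ln ((cmod w)\<^sup>2) - ln (1 - \<rho>)"
      using \<rho> w by (auto simp: ln_div)
    ultimately have "- ln (1 + (cmod w)\<^sup>2) + (1 - \<rho>) * ln ((cmod w)\<^sup>2) - \<rho> * ln \<rho> - (1 - \<rho>) * ln (1 - \<rho>) \<le> 0"
      by (simp add: algebra_simps)
    then show ?thesis using False Some by (simp add: cap_potential_def)
  qed
qed

section \<open>Perturbing the pole of a cap potential\<close>

context packing
begin

definition atom_kernel :: "cp1 \<Rightarrow> ennreal" where
  "atom_kernel x = (\<Sum>k. ennreal (\<alpha> k) * nlog (chord x (chart_inf (c k))))"

text \<open>The value of \<open>atom_kernel\<close> at \<open>Some 0\<close>, hence the constant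
  that normalises \<open>V\<close>.\<close>

definition a\<^sub>0 :: real where
  "a\<^sub>0 = (\<Sum>k. \<alpha> k * ln (fs (c k)))"

text \<open>Moving the unit mass at infinity to the packing centres changes the logarithmic potential by
  this function, normalised to vanish at \<open>Some 0\<close>; the value at infinity is irrelevant, because the
  cap potentials are \<open>-\<infinity>\<close> there.\<close>

definition V :: "cp1 \<Rightarrow> ereal" where
  "V x = (case x of None \<Rightarrow> 0 | Some w \<Rightarrow> ereal (a\<^sub>0 + ln (fs w)) - enn2ereal (atom_kernel x))"

lemma \<alpha>_sums: "\<alpha> sums 1"
proof -
  have "summable \<alpha>" using suminf_\<alpha> \<alpha>_nonneg by (intro summable_suminf_not_top) auto
  moreover have "ennreal (suminf \<alpha>) = 1"
    using suminf_ennreal2[OF \<alpha>_nonneg \<open>summable \<alpha>\<close>] suminf_\<alpha> by simp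
  then have "suminf \<alpha> = 1" by (simp add: ennreal_eq_1)
  ultimately show ?thesis using summable_sums by metis
qed

lemma a\<^sub>0_sums: "(\<lambda>k. \<alpha> k * ln (fs (c k))) sums a\<^sub>0"
  unfolding a\<^sub>0_def
proof (rule summable_sums, rule summable_comparison_test')
  show "summable (\<lambda>k. \<alpha> k * ln (fs (of_real R)))"
    using \<alpha>_sums by (intro summable_mult2) (rule sums_summable)
  fix k :: nat
  have "fs (c k) \<le> fs (of_real R)" using c_less[of k] R by (intro fs_mono) (simp add: less_imp_le)
  then have "ln (fs (c k)) \<le> ln (fs (of_real R))" by simp
  then show "norm (\<alpha> k * ln (fs (c k))) \<le> \<alpha> k * ln (fs (of_real R))"
    using \<alpha>_nonneg[of k] ln_fs_nonneg[of "c k"] by (simp add: abs_mult mult_left_mono)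
qed

lemma ennreal_a\<^sub>0: "(\<Sum>k. ennreal (\<alpha> k * ln (fs (c k)))) = ennreal a\<^sub>0" "0 \<le> a\<^sub>0"
proof -
  have nn: "0 \<le> \<alpha> k * ln (fs (c k))" for k using \<alpha>_nonneg ln_fs_nonneg by simp
  show "(\<Sum>k. ennreal (\<alpha> k * ln (fs (c k)))) = ennreal a\<^sub>0"
    by (rule suminf_ennreal_eq[OF nn a\<^sub>0_sums])
  show "0 \<le> a\<^sub>0" unfolding a\<^sub>0_def using a\<^sub>0_sums nn by (intro suminf_nonneg sums_summable)
qed

lemma atom_kernel_zero: "atom_kernel (Some 0) = ennreal a\<^sub>0"
proof -
  have "nlog (chord (Some 0) (chart_inf (c k))) = ennreal (ln (fs (c k)))" for k
  proof -
    have "chord (Some 0) (chart_inf (c k)) = 1 / fs (c k)"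
      using c_nonzero[of k] by (simp add: chart_inf_def chord_def fs_divide norm_divide)
    then show ?thesis by (simp add: nlog_pos ln_div)
  qed
  then show ?thesis unfolding atom_kernel_def
    using ennreal_a\<^sub>0 \<alpha>_nonneg by (simp flip: ennreal_mult')
qed

text \<open>This translates between the chordal kernel and the scaled planar kernel of the packing
  lemmas, using that the weights sum to 1.\<close>

lemma atom_kernel_chart:
  assumes S: "1 \<le> S" "cmod z + R \<le> S"
  shows "(\<Sum>k. ennreal (\<alpha> k) * nlog (cmod (z - c k) / S)) + ennreal (ln (fs z) + a\<^sub>0)
    = atom_kernel (chart_inf z) + ennreal (ln S)"
proof -
  have pt: "ennreal (\<alpha> k) * nlog (cmod (z - c k) / S) + (ennreal (\<alpha> k) * ennreal (ln (fs z)) + ennreal (\<alpha> k * ln (fs (c k))))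
      = ennreal (\<alpha> k) * nlog (chord (chart_inf z) (chart_inf (c k))) + ennreal (\<alpha> k) * ennreal (ln S)" for k
  proof -
    have "nlog (cmod (z - c k) / S) + (ennreal (ln (fs z)) + ennreal (ln (fs (c k))))
        = nlog (chord (chart_inf z) (chart_inf (c k))) + ennreal (ln S)"
    proof (cases "z = c k")
      \<comment> \<open>At an atom both sides are \<open>top\<close>; this is why the identity is
        stated without subtraction.\<close>
      case True
      then show ?thesis unfolding chord_chart[OF chart_inf_in_charts] by (simp add: nlog_def)
    next
      case False
      have le: "cmod (z - c k) \<le> S" using norm_triangle_ineq4[of z "c k"] c_less[of k] S(2) by linarith
      have 1: "nlog (cmod (z - c k) / S) = ennreal (ln S - ln (cmod (z - c k)))"
        using False S(1) by (simp add: nlog_pos ln_div)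
      have 2: "nlog (chord (chart_inf z) (chart_inf (c k))) = ennreal (ln (fs z) + ln (fs (c k)) - ln (cmod (z - c k)))"
        unfolding chord_chart[OF chart_inf_in_charts] using False by (simp add: nlog_pos ln_div ln_mult)
      have "0 \<le> ln S - ln (cmod (z - c k))" using False le S(1) by simp
      moreover have "0 \<le> ln (fs z) + ln (fs (c k)) - ln (cmod (z - c k))"
      proof -
        have "cmod (z - c k) \<le> fs z * fs (c k)"
          using cmod_add_le_fs[of z "c k"] norm_triangle_ineq4[of z "c k"] by linarith
        then have "ln (cmod (z - c k)) \<le> ln (fs z * fs (c k))" using False by (subst ln_le_cancel_iff) auto
        then show ?thesis by (simp add: ln_mult)
      qed
      moreover have "0 \<le> ln S" using S(1) by simp
      ultimately show ?thesis unfolding 1 2 using ln_fs_nonneg[of z] ln_fs_nonneg[of "c k"]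
        by (simp flip: ennreal_plus)
    qed
    then have "ennreal (\<alpha> k) * (nlog (cmod (z - c k) / S) + (ennreal (ln (fs z)) + ennreal (ln (fs (c k)))))
      = ennreal (\<alpha> k) * (nlog (chord (chart_inf z) (chart_inf (c k))) + ennreal (ln S))" by simp
    moreover have "ennreal (\<alpha> k * ln (fs (c k))) = ennreal (\<alpha> k) * ennreal (ln (fs (c k)))"
      using \<alpha>_nonneg ln_fs_nonneg by (intro ennreal_mult)
    ultimately show ?thesis by (simp only: distrib_left)
  qed
  have "(\<Sum>k. ennreal (\<alpha> k) * nlog (cmod (z - c k) / S)) + (ennreal (ln (fs z)) + ennreal a\<^sub>0)
     = (\<Sum>k. ennreal (\<alpha> k) * nlog (cmod (z - c k) / S) + (ennreal (\<alpha> k) * ennreal (ln (fs z)) + ennreal (\<alpha> k * ln (fs (c k)))))"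
    by (simp add: suminf_add[symmetric] summableI ennreal_suminf_multc suminf_\<alpha> ennreal_a\<^sub>0 del: suminf_ennreal)
  also have "\<dots> = atom_kernel (chart_inf z) + ennreal (ln S)"
    unfolding pt atom_kernel_def by (simp add: suminf_add[symmetric] summableI ennreal_suminf_multc suminf_\<alpha>)
  finally show ?thesis using ennreal_a\<^sub>0(2) ln_fs_nonneg by simp
qed

lemma V_less_top: "V x < \<infinity>"
  unfolding V_def by (cases x; cases "atom_kernel x") auto

lemma V_chart:
  assumes z: "z \<noteq> 0"
  shows "V (chart_inf z) = ereal (a\<^sub>0 + ln (fs z) - ln (cmod z)) - enn2ereal (atom_kernel (chart_inf z))"
proof -
  have "ln (fs (1 / z)) = ln (fs z) - ln (cmod z)" using z by (simp add: fs_divide ln_div)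
  then show ?thesis using z by (simp add: V_def chart_inf_divide add_diff_eq)
qed

text \<open>In the coordinate at infinity these are the points where the packing atoms and a unit
  mass at 0 have equal potentials, by \<open>suminf_nlog_eq\<close>.\<close>

lemma V_outside:
  assumes z: "R \<le> cmod z"
  shows "atom_kernel (chart_inf z) = ennreal (ln (fs z) + a\<^sub>0 - ln (cmod z))" "V (chart_inf z) = 0"
proof -
  have z0: "z \<noteq> 0" using z R by auto
  define S where "S = 1 + cmod z + R"
  have S: "1 \<le> S" "cmod z + R \<le> S" "cmod z \<le> S" using R by (auto simp: S_def)
  have "nlog (cmod z / S) = ennreal (ln S - ln (cmod z))" using z0 S by (simp add: nlog_pos ln_div)
  then have eq: "ennreal (ln S - ln (cmod z)) + ennreal (ln (fs z) + a\<^sub>0) = atom_kernel (chart_inf z) + ennreal (ln S)"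
    using atom_kernel_chart[OF S(1,2)] suminf_nlog_eq[OF z S(2)] by simp
  have nn: "0 \<le> ln S - ln (cmod z)" "0 \<le> ln S" "0 \<le> ln (fs z) + a\<^sub>0"
    using z0 S ln_fs_nonneg ennreal_a\<^sub>0(2) by auto
  then have "atom_kernel (chart_inf z) \<noteq> top" using eq by (auto simp flip: ennreal_plus)
  then obtain x where x: "atom_kernel (chart_inf z) = ennreal x" "0 \<le> x"
    unfolding top.not_eq_extremum less_top_ennreal by blast
  have "ln S - ln (cmod z) + (ln (fs z) + a\<^sub>0) = x + ln S"
    using eq x nn by (simp flip: ennreal_plus)
  then have xe: "x = ln (fs z) + a\<^sub>0 - ln (cmod z)" by simp
  show "atom_kernel (chart_inf z) = ennreal (ln (fs z) + a\<^sub>0 - ln (cmod z))" using x xe by simp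
  show "V (chart_inf z) = 0" unfolding V_chart[OF z0] x(1) using x(2) xe by simp
qed

text \<open>The lower bound \<open>suminf_nlog_ge\<close> for the atoms becomes an upper bound for
  \<open>V\<close>; the pole at infinity shows up as - ln |z|.\<close>

lemma V_inside:
  assumes z: "z \<noteq> 0" "cmod z \<le> R"
  shows "V (chart_inf z) \<le> ereal (ln R - ln (cmod z))"
proof -
  define S where "S = 1 + cmod z + R"
  have S: "1 \<le> S" "cmod z + R \<le> S" "R \<le> S" using R by (auto simp: S_def)
  have "nlog (R / S) = ennreal (ln S - ln R)" using R S by (simp add: nlog_pos ln_div)
  then have le: "ennreal (ln S - ln R) + ennreal (ln (fs z) + a\<^sub>0) \<le> atom_kernel (chart_inf z) + ennreal (ln S)"
    unfolding atom_kernel_chart[OF S(1,2), symmetric]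
    using suminf_nlog_ge[OF z(2) S(2)] by (intro add_right_mono) simp
  have nn: "0 \<le> ln S - ln R" "0 \<le> ln S" "0 \<le> ln (fs z) + a\<^sub>0"
    using R S ln_fs_nonneg ennreal_a\<^sub>0(2) by auto
  show ?thesis
  proof (cases "atom_kernel (chart_inf z)")
    case (real x)
    then have "ln S - ln R + (ln (fs z) + a\<^sub>0) \<le> x + ln S"
      using le nn by (simp flip: ennreal_plus)
    then show ?thesis unfolding V_chart[OF z(1)] real(2) using real(1) by simp
  qed (simp add: V_chart[OF z(1)])
qed

lemma V_Some_eq_0:
  assumes "cmod w \<le> 1 / R"
  shows "V (Some w) = 0"
proof (cases "w = 0")
  case True
  then show ?thesis using ennreal_a\<^sub>0(2) by (simp add: V_def atom_kernel_zero)
next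
  case False
  then have "R \<le> cmod (1 / w)" using assms R by (simp add: norm_divide field_simps)
  then show ?thesis unfolding chart_inf_inverse[OF False] by (rule V_outside)
qed

lemma V_Some_le:
  assumes "1 / R \<le> cmod w"
  shows "V (Some w) \<le> ereal (ln (R * cmod w))"
proof -
  have w0: "w \<noteq> 0" using assms R by (auto simp: divide_le_0_iff)
  then have "cmod (1 / w) \<le> R" using assms R by (simp add: norm_divide field_simps)
  then have "V (Some w) \<le> ereal (ln R - ln (cmod (1 / w)))"
    unfolding chart_inf_inverse[OF w0] using w0 by (intro V_inside) auto
  then show ?thesis using w0 R by (simp add: norm_divide ln_div ln_mult)
qed

text \<open>A finite value of \<open>V\<close> converts the series in \<open>ennreal\<close> into a
  convergent real series. Atoms of weight 0 must be exempted in the last claim, since 0 times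
  \<open>top\<close> is 0.\<close>

lemma V_summable:
  assumes z: "z \<noteq> 0" and fin: "V (chart_inf z) \<noteq> -\<infinity>"
  obtains E where "(\<lambda>k. \<alpha> k * ln (cmod (z - c k))) sums E" "V (chart_inf z) = ereal (E - ln (cmod z))"
    "\<And>k. 0 < \<alpha> k \<Longrightarrow> z \<noteq> c k"
proof -
  have "atom_kernel (chart_inf z) \<noteq> top" using fin unfolding V_chart[OF z] by auto
  then obtain x where x: "atom_kernel (chart_inf z) = ennreal x" "0 \<le> x"
    unfolding top.not_eq_extremum less_top_ennreal by blast
  have ne: "z \<noteq> c k" if "0 < \<alpha> k" for k
  proof
    assume zk: "z = c k"
    have "(\<Sum>j\<in>{k}. ennreal (\<alpha> j) * nlog (chord (chart_inf z) (chart_inf (c j)))) \<le> atom_kernel (chart_inf z)"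
      unfolding atom_kernel_def by (rule sum_le_suminf) auto
    moreover have "nlog (chord (chart_inf z) (chart_inf (c k))) = top"
      unfolding chord_chart[OF chart_inf_in_charts] zk by (simp add: nlog_def)
    ultimately have "top \<le> atom_kernel (chart_inf z)"
      using that by (simp add: ennreal_mult_top)
    then show False using x by (simp add: top_unique)
  qed
  define g where "g k = \<alpha> k * (ln (fs z) + ln (fs (c k)) - ln (cmod (z - c k)))" for k
  have g: "0 \<le> g k" "ennreal (g k) = ennreal (\<alpha> k) * nlog (chord (chart_inf z) (chart_inf (c k)))" for k
  proof -
    show "0 \<le> g k"
    proof (cases "z = c k")
      case True
      then have "\<alpha> k = 0" using ne[of k] \<alpha>_nonneg[of k] by (cases "0 < \<alpha> k") auto
      then show ?thesis by (simp add: g_def)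
    next
      case False
      have "cmod (z - c k) \<le> fs z * fs (c k)"
        using cmod_add_le_fs[of z "c k"] norm_triangle_ineq4[of z "c k"] by linarith
      then have "ln (cmod (z - c k)) \<le> ln (fs z * fs (c k))" using False by (subst ln_le_cancel_iff) auto
      then show ?thesis unfolding g_def using \<alpha>_nonneg by (intro mult_nonneg_nonneg) (auto simp: ln_mult)
    qed
    show "ennreal (g k) = ennreal (\<alpha> k) * nlog (chord (chart_inf z) (chart_inf (c k)))"
    proof (cases "\<alpha> k = 0")
      case False
      then have "z \<noteq> c k" using ne[of k] \<alpha>_nonneg[of k] by simp
      then have "nlog (chord (chart_inf z) (chart_inf (c k))) = ennreal (ln (fs z) + ln (fs (c k)) - ln (cmod (z - c k)))"
        unfolding chord_chart[OF chart_inf_in_charts] by (simp add: nlog_pos ln_div ln_mult)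
      then show ?thesis unfolding g_def using \<alpha>_nonneg by (simp add: ennreal_mult')
    qed (simp add: g_def)
  qed
  have gs: "(\<Sum>k. ennreal (g k)) = ennreal x" using x g(2) by (simp add: atom_kernel_def)
  then have sg: "summable g" using g(1) by (intro summable_suminf_not_top) auto
  then have "suminf g = x" using suminf_ennreal2[OF g(1) sg] gs x(2) suminf_nonneg[OF sg g(1)] by simp
  then have "g sums x" using summable_sums[OF sg] by simp
  then have "(\<lambda>k. \<alpha> k * ln (fs z) + \<alpha> k * ln (fs (c k)) - g k) sums (1 * ln (fs z) + a\<^sub>0 - x)"
    by (intro sums_diff sums_add a\<^sub>0_sums sums_mult2 \<alpha>_sums)
  moreover have "\<alpha> k * ln (fs z) + \<alpha> k * ln (fs (c k)) - g k = \<alpha> k * ln (cmod (z - c k))" for k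
    by (simp add: g_def algebra_simps)
  ultimately have "(\<lambda>k. \<alpha> k * ln (cmod (z - c k))) sums (ln (fs z) + a\<^sub>0 - x)" by simp
  moreover have "V (chart_inf z) = ereal (ln (fs z) + a\<^sub>0 - x - ln (cmod z))"
    unfolding V_chart[OF z] x(1) using x(2) by simp
  ultimately show thesis using ne by (intro that)
qed

lemma V_centre: "0 < \<alpha> k \<Longrightarrow> V (chart_inf (c k)) = -\<infinity>"
  using V_summable[OF c_nonzero[of k]] by metis

lemma exists_positive_weight: "\<exists>k. 0 < \<alpha> k"
proof (rule ccontr)
  assume "\<not> ?thesis"
  then have "\<alpha> k = 0" for k using \<alpha>_nonneg[of k] by (meson antisym not_le)
  then show False using suminf_\<alpha> by simp
qed

section \<open>The measure behind a perturbed cap potential\<close>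

text \<open>Here \<open>m\<close> is the part of the pole mass \<rho> that moves from infinity to
  the atoms.\<close>

definition perturbed :: "real \<Rightarrow> real \<Rightarrow> cp1 \<Rightarrow> ereal" where
  "perturbed \<rho> m x = cap_potential \<rho> x + ereal m * V x"

text \<open>Index 0 stands for the cap, index 1 for the remaining pole at infinity, and index k + 2
  for the k-th atom.\<close>

fun weight :: "real \<Rightarrow> real \<Rightarrow> nat \<Rightarrow> real" where
  "weight \<rho> m 0 = 1 - \<rho>"
| "weight \<rho> m (Suc 0) = \<rho> - m"
| "weight \<rho> m (Suc (Suc k)) = m * \<alpha> k"

fun site :: "nat \<times> real \<times> real \<Rightarrow> cp1" where
  "site (0, q, s) = disc_point q s"
| "site (Suc 0, q, s) = None"
| "site (Suc (Suc k), q, s) = chart_inf (c k)"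

text \<open>Choosing a component at random together with a mass and an angle, of which only the cap
  reads the last two, presents the measure as one pushforward of a product; Tonelli then handles all
  components at once.\<close>

definition mixture :: "real \<Rightarrow> real \<Rightarrow> cp1 measure" where
  "mixture \<rho> m = distr (density (count_space UNIV) (\<lambda>n. ennreal (weight \<rho> m n)) \<Otimes>\<^sub>M
     (uniform_measure lborel {0..1 - \<rho>} \<Otimes>\<^sub>M uniform_measure lborel {0..2*pi})) cp1_borel site"

lemma sets_mixture: "sets (mixture \<rho> m) = sets cp1_borel"
  by (simp add: mixture_def)

lemma nn_integral_mixture:
  assumes \<rho>: "0 < \<rho>" "\<rho> < 1" and m: "0 \<le> m" "m \<le> \<rho>" and f [measurable]: "f \<in> borel_measurable cp1_borel"
  shows "(\<integral>\<^sup>+y. f y \<partial>mixture \<rho> m) = ennreal (1 / (2 * pi)) *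
      (\<integral>\<^sup>+q\<in>{0..1 - \<rho>}. (\<integral>\<^sup>+s\<in>{0..2*pi}. f (disc_point q s) \<partial>lborel) \<partial>lborel)
      + (ennreal (\<rho> - m) * f None + ennreal m * (\<Sum>k. ennreal (\<alpha> k) * f (chart_inf (c k))))"
proof -
  define D where "D = density (count_space UNIV) (\<lambda>n. ennreal (weight \<rho> m n))"
  define A where "A = uniform_measure lborel {0..1 - \<rho>}"
  define B where "B = uniform_measure lborel {0..2*pi}"
  have sets [measurable_cong]: "sets A = sets borel" "sets B = sets borel" by (auto simp: A_def B_def)
  have A1: "(\<integral>\<^sup>+x. k \<partial>A) = k" and B1: "(\<integral>\<^sup>+x. k \<partial>B) = k" for k
    using \<rho> by (auto simp: A_def B_def nn_integral_uniform_measure nn_integral_cmult_indicator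
      ennreal_mult_divide_eq)
  have tot: "emeasure A (space A) = 1" "emeasure B (space B) = 1" using A1[of 1] B1[of 1] by auto
  have "finite_measure B" "finite_measure A"
    using A1[of 1] B1[of 1] by (auto intro!: finite_measureI)
  then interpret A: finite_measure A + B: finite_measure B by auto
  have "finite_measure (A \<Otimes>\<^sub>M B)" by (rule finite_measure_pair_measure) fact+
  then interpret AB: finite_measure "A \<Otimes>\<^sub>M B" .
  have AB: "(\<integral>\<^sup>+x. g x \<partial>(A \<Otimes>\<^sub>M B)) = (\<integral>\<^sup>+q. (\<integral>\<^sup>+s. g (q, s) \<partial>B) \<partial>A)"
    if "g \<in> borel_measurable (A \<Otimes>\<^sub>M B)" for g
    using B.nn_integral_fst[OF that] by simp
  have site_m [measurable]: "site \<in> D \<Otimes>\<^sub>M (A \<Otimes>\<^sub>M B) \<rightarrow>\<^sub>M cp1_borel"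
  proof -
    have "site \<in> count_space UNIV \<Otimes>\<^sub>M (A \<Otimes>\<^sub>M B) \<rightarrow>\<^sub>M cp1_borel"
    proof (rule measurable_pair_measure_countable1)
      fix n :: nat
      show "(\<lambda>x. site (n, x)) \<in> A \<Otimes>\<^sub>M B \<rightarrow>\<^sub>M cp1_borel"
      proof (cases n)
        case 0
        have "(\<lambda>x. site (0, x)) = (\<lambda>x. disc_point (fst x) (snd x))" by (auto simp: fun_eq_iff)
        moreover have "(\<lambda>x. disc_point (fst x) (snd x)) \<in> A \<Otimes>\<^sub>M B \<rightarrow>\<^sub>M cp1_borel" by measurable
        ultimately show ?thesis using 0 by simp
      next
        case (Suc n')
        have "(\<lambda>x. site (n, x)) = (\<lambda>_. site (n, 0, 0))"
          unfolding Suc by (cases n') (auto simp: fun_eq_iff)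
        then show ?thesis by simp
      qed
    qed simp
    moreover have "sets (D \<Otimes>\<^sub>M (A \<Otimes>\<^sub>M B)) = sets (count_space UNIV \<Otimes>\<^sub>M (A \<Otimes>\<^sub>M B))"
      unfolding D_def by (intro sets_pair_measure_cong) auto
    ultimately show ?thesis using measurable_cong_sets by blast
  qed
  have w0: "0 \<le> weight \<rho> m n" for n
    using \<rho> m \<alpha>_nonneg by (cases "(\<rho>, m, n)" rule: weight.cases) auto
  define I where "I n = (\<integral>\<^sup>+x. f (site (n, x)) \<partial>(A \<Otimes>\<^sub>M B))" for n
  have "(\<integral>\<^sup>+y. f y \<partial>mixture \<rho> m) = (\<integral>\<^sup>+x. f (site x) \<partial>(D \<Otimes>\<^sub>M (A \<Otimes>\<^sub>M B)))"
    unfolding mixture_def D_def[symmetric] A_def[symmetric] B_def[symmetric]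
    by (rule nn_integral_distr) measurable
  also have "\<dots> = (\<integral>\<^sup>+n. I n \<partial>D)"
    unfolding I_def by (rule AB.nn_integral_fst[symmetric]) measurable
  also have "\<dots> = (\<Sum>n. ennreal (weight \<rho> m n) * I n)"
    unfolding D_def by (simp add: nn_integral_density nn_integral_count_space_nat)
  also have "\<dots> = (\<Sum>n. ennreal (weight \<rho> m (n + 2)) * I (n + 2)) + (\<Sum>n<2. ennreal (weight \<rho> m n) * I n)"
    by (rule suminf_offset[OF summableI])
  also have "(\<Sum>n<2. ennreal (weight \<rho> m n) * I n) = ennreal (1 - \<rho>) * I 0 + ennreal (\<rho> - m) * I 1"
    by (simp add: numeral_2_eq_2)
  also have "I 1 = f None"
  proof -
    have "I 1 = (\<integral>\<^sup>+x. f None \<partial>(A \<Otimes>\<^sub>M B))"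
      unfolding I_def by (intro nn_integral_cong) (auto simp: One_nat_def simp del: One_nat_def[symmetric])
    also have "\<dots> = f None" by (subst AB) (auto simp: tot)
    finally show ?thesis .
  qed
  also have "(\<Sum>n. ennreal (weight \<rho> m (n + 2)) * I (n + 2)) = ennreal m * (\<Sum>k. ennreal (\<alpha> k) * f (chart_inf (c k)))"
  proof -
    have "I (n + 2) = f (chart_inf (c n))" for n
    proof -
      have "I (n + 2) = (\<integral>\<^sup>+x. f (chart_inf (c n)) \<partial>(A \<Otimes>\<^sub>M B))"
        unfolding I_def by (intro nn_integral_cong) auto
      also have "\<dots> = f (chart_inf (c n))" by (subst AB) (auto simp: tot)
      finally show ?thesis .
    qed
    then show ?thesis using m \<alpha>_nonneg by (simp add: ennreal_mult mult.assoc flip: ennreal_suminf_cmult)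
  qed
  \<comment> \<open>The weight of the cap cancels the normalisation of the uniform measure on masses
    up to \<open>1 - \<rho>\<close>.\<close>
  also have "ennreal (1 - \<rho>) * I 0 = ennreal (1 / (2 * pi)) *
      (\<integral>\<^sup>+q\<in>{0..1 - \<rho>}. (\<integral>\<^sup>+s\<in>{0..2*pi}. f (disc_point q s) \<partial>lborel) \<partial>lborel)"
  proof -
    have p: "inverse (ennreal (2 * pi)) = ennreal (1 / (2 * pi))"
      using inverse_ennreal[of "2 * pi"] by (simp only: inverse_eq_divide) simp
    have "I 0 = (\<integral>\<^sup>+x. f (disc_point (fst x) (snd x)) \<partial>(A \<Otimes>\<^sub>M B))"
      unfolding I_def by (intro nn_integral_cong) auto
    also have "\<dots> = (\<integral>\<^sup>+q. (\<integral>\<^sup>+s. f (disc_point q s) \<partial>B) \<partial>A)"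
    proof (subst AB)
      show "(\<lambda>x. f (disc_point (fst x) (snd x))) \<in> borel_measurable (A \<Otimes>\<^sub>M B)" by measurable
    qed simp
    also have "\<dots> = (\<integral>\<^sup>+q. ennreal (1 / (2 * pi)) * (\<integral>\<^sup>+s\<in>{0..2*pi}. f (disc_point q s) \<partial>lborel) \<partial>A)"
    proof (rule nn_integral_cong)
      fix q
      have [measurable]: "(\<lambda>s. f (disc_point q s)) \<in> borel_measurable borel"
        unfolding disc_point_def by measurable
      show "(\<integral>\<^sup>+s. f (disc_point q s) \<partial>B) = ennreal (1 / (2 * pi)) * (\<integral>\<^sup>+s\<in>{0..2*pi}. f (disc_point q s) \<partial>lborel)"
      proof -
        have "(\<integral>\<^sup>+s. f (disc_point q s) \<partial>B) = (\<integral>\<^sup>+s\<in>{0..2*pi}. f (disc_point q s) \<partial>lborel) / emeasure lborel {0..2*pi}"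
          unfolding B_def by (rule nn_integral_uniform_measure) auto
        also have "emeasure lborel {0..2*pi} = ennreal (2 * pi)" by simp
        finally show ?thesis by (simp only: divide_ennreal_def p mult.commute[of "ennreal (1 / (2 * pi))"])
      qed
    qed
    also have "\<dots> = ennreal (1 / (2 * pi)) * (\<integral>\<^sup>+q. (\<integral>\<^sup>+s\<in>{0..2*pi}. f (disc_point q s) \<partial>lborel) \<partial>A)"
    proof (rule nn_integral_cmult)
      show "(\<lambda>q. \<integral>\<^sup>+s\<in>{0..2*pi}. f (disc_point q s) \<partial>lborel) \<in> borel_measurable A"
        unfolding disc_point_def by measurable
    qed
    also have "(\<integral>\<^sup>+q. (\<integral>\<^sup>+s\<in>{0..2*pi}. f (disc_point q s) \<partial>lborel) \<partial>A)
       = (\<integral>\<^sup>+q\<in>{0..1 - \<rho>}. (\<integral>\<^sup>+s\<in>{0..2*pi}. f (disc_point q s) \<partial>lborel) \<partial>lborel) / ennreal (1 - \<rho>)"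
      unfolding A_def using \<rho>
      by (subst nn_integral_uniform_measure) (auto simp: disc_point_def)
    finally have "ennreal (1 - \<rho>) * I 0 = ennreal (1 / (2 * pi)) *
      (ennreal (1 - \<rho>) * ((\<integral>\<^sup>+q\<in>{0..1 - \<rho>}. (\<integral>\<^sup>+s\<in>{0..2*pi}. f (disc_point q s) \<partial>lborel) \<partial>lborel) / ennreal (1 - \<rho>)))"
      by (simp only: mult.left_commute)
    also have "ennreal (1 - \<rho>) * (z / ennreal (1 - \<rho>)) = z" for z
      using \<rho> by (subst ennreal_times_divide) (simp add: ennreal_mult_divide_eq mult.commute[of "ennreal (1 - \<rho>)"])
    finally show ?thesis .
  qed
  finally show ?thesis by (simp add: add_ac)
qed

lemma mixture_total:
  assumes \<rho>: "0 < \<rho>" "\<rho> < 1" and m: "0 \<le> m" "m \<le> \<rho>"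
  shows "emeasure (mixture \<rho> m) UNIV = 1"
proof -
  have sp: "space (mixture \<rho> m) = UNIV" by (simp add: mixture_def)
  have "emeasure (mixture \<rho> m) UNIV = (\<integral>\<^sup>+y. 1 \<partial>mixture \<rho> m)" using sp by simp
  also have "\<dots> = ennreal (1 / (2 * pi)) * (\<integral>\<^sup>+q\<in>{0..1 - \<rho>}. (\<integral>\<^sup>+s\<in>{0..2*pi}. 1 \<partial>lborel) \<partial>lborel)
      + (ennreal (\<rho> - m) * 1 + ennreal m * (\<Sum>k. ennreal (\<alpha> k) * 1))"
    by (rule nn_integral_mixture[OF \<rho> m]) simp
  also have "(\<integral>\<^sup>+q\<in>{0..1 - \<rho>}. (\<integral>\<^sup>+s\<in>{0..2*pi}. 1 \<partial>lborel) \<partial>lborel) = ennreal (2 * pi) * ennreal (1 - \<rho>)"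
    using \<rho> by (simp add: nn_integral_cmult_indicator)
  also have "ennreal (1 / (2 * pi)) * (ennreal (2 * pi) * ennreal (1 - \<rho>)) + (ennreal (\<rho> - m) * 1 + ennreal m * (\<Sum>k. ennreal (\<alpha> k) * 1)) = 1"
  proof -
    have "ennreal (1 / (2 * pi)) * (ennreal (2 * pi) * ennreal (1 - \<rho>)) = ennreal (1 - \<rho>)"
      using \<rho> by (simp flip: ennreal_mult)
    then show ?thesis using \<rho> m by (simp add: suminf_\<alpha> flip: ennreal_plus)
  qed
  finally show ?thesis .
qed

lemma finite_mixture:
  assumes "0 < \<rho>" "\<rho> < 1" "0 \<le> m" "m \<le> \<rho>"
  shows "finite_measure (mixture \<rho> m)"
  using mixture_total[OF assms] by (intro finite_measureI) (simp add: mixture_def)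

lemma kernel_mixture:
  assumes \<rho>: "0 < \<rho>" "\<rho> < 1" and m: "0 \<le> m" "m \<le> \<rho>"
  shows "(\<integral>\<^sup>+y. nlog (chord (Some w) y) \<partial>mixture \<rho> m)
    = ennreal (cap_integral \<rho> w) + (ennreal ((\<rho> - m) * ln (fs w)) + ennreal m * atom_kernel (Some w))"
proof -
  have "nlog (chord (Some w) None) = ennreal (ln (fs w))"
    by (simp add: chord_def nlog_pos ln_div)
  moreover have "ennreal (1 / (2 * pi)) * (ennreal (2 * pi) * ennreal (cap_integral \<rho> w)) = ennreal (cap_integral \<rho> w)"
    using nn_integral_cap(2)[OF \<rho>] by (simp flip: ennreal_mult)
  ultimately show ?thesis
    using m ln_fs_nonneg unfolding nn_integral_mixture[OF \<rho> m nlog_chord_measurable] nn_integral_cap(1)[OF \<rho>] atom_kernel_def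
    by (simp add: ennreal_mult)
qed

text \<open>Of the constant, the first part belongs to the cap potential and the second normalises
  \<open>V\<close>.\<close>

lemma perturbed_eq_pot:
  assumes \<rho>: "0 < \<rho>" "\<rho> < 1" and m: "0 \<le> m" "m < \<rho>"
  shows "perturbed \<rho> m = pot (1 / 2 * ((1 - \<rho>) - (1 - \<rho>) * ln (1 - \<rho>)) + m * a\<^sub>0) (mixture \<rho> m)"
proof
  fix x
  show "perturbed \<rho> m x = pot (1 / 2 * ((1 - \<rho>) - (1 - \<rho>) * ln (1 - \<rho>)) + m * a\<^sub>0) (mixture \<rho> m) x"
  proof (cases x)
    case None
    \<comment> \<open>Because \<open>m < \<rho>\<close>, some mass remains at infinity, so both
      sides are minus infinity there.\<close>
    have "nlog (chord None None) = top" by (simp add: chord_def nlog_def)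
    then have "(\<integral>\<^sup>+y. nlog (chord None y) \<partial>mixture \<rho> m) = top"
      using m unfolding nn_integral_mixture[OF \<rho> m(1) less_imp_le[OF m(2)] nlog_chord_measurable]
      by (simp add: ennreal_mult_top)
    then show ?thesis using None by (simp add: perturbed_def pot_def cap_potential_def V_def)
  next
    case (Some w)
    have T: "(\<integral>\<^sup>+y. nlog (chord (Some w) y) \<partial>mixture \<rho> m)
      = ennreal (cap_integral \<rho> w) + (ennreal ((\<rho> - m) * ln (fs w)) + ennreal m * atom_kernel (Some w))"
      using kernel_mixture[OF \<rho> m(1)] m by simp
    have nn: "0 \<le> cap_integral \<rho> w" "0 \<le> (\<rho> - m) * ln (fs w)"
      using nn_integral_cap(2)[OF \<rho>] m ln_fs_nonneg by auto
    show ?thesis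
    proof (cases "atom_kernel (Some w)")
      case (real b)
      define X where "X = cap_integral \<rho> w + ((\<rho> - m) * ln (fs w) + m * b)"
      have X0: "0 \<le> X" using nn real(1) m by (simp add: X_def)
      have "(\<integral>\<^sup>+y. nlog (chord (Some w) y) \<partial>mixture \<rho> m) = ennreal X"
        unfolding T real(2) X_def using nn real(1) m by (simp flip: ennreal_plus ennreal_mult)
      then have "pot (1 / 2 * ((1 - \<rho>) - (1 - \<rho>) * ln (1 - \<rho>)) + m * a\<^sub>0) (mixture \<rho> m) x
          = ereal (1 / 2 * ((1 - \<rho>) - (1 - \<rho>) * ln (1 - \<rho>)) + m * a\<^sub>0 - X)"
        using X0 unfolding Some pot_def by simp
      also have "\<dots> = ereal (1 / 2 * ((1 - \<rho>) - (1 - \<rho>) * ln (1 - \<rho>)) - cap_integral \<rho> w - \<rho> * ln (fs w))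
          + ereal m * ereal (a\<^sub>0 + ln (fs w) - b)"
        by (simp add: X_def algebra_simps)
      also have "\<dots> = perturbed \<rho> m x"
        using real(1) unfolding Some perturbed_def cap_potential_eq_cap_integral[OF \<rho>] by (simp add: V_def real(2))
      finally show ?thesis ..
    next
      \<comment> \<open>An infinite atomic sum is harmless for \<open>m = 0\<close>, where the
        product is 0, and otherwise makes both sides minus infinity.\<close>
      case top
      show ?thesis
      proof (cases "m = 0")
        case True
        define X where "X = cap_integral \<rho> w + \<rho> * ln (fs w)"
        have X0: "0 \<le> X" using nn True by (simp add: X_def)
        have "(\<integral>\<^sup>+y. nlog (chord (Some w) y) \<partial>mixture \<rho> m) = ennreal X"
          unfolding T X_def using True nn by (simp flip: ennreal_plus)
        then have "pot (1 / 2 * ((1 - \<rho>) - (1 - \<rho>) * ln (1 - \<rho>)) + m * a\<^sub>0) (mixture \<rho> m) x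
            = ereal (1 / 2 * ((1 - \<rho>) - (1 - \<rho>) * ln (1 - \<rho>)) - X)"
          using X0 True unfolding Some pot_def by simp
        also have "\<dots> = perturbed \<rho> m x"
          using True unfolding Some perturbed_def cap_potential_eq_cap_integral[OF \<rho>]
          by (simp add: X_def flip: zero_ereal_def)
        finally show ?thesis ..
      next
        case False
        then have "(\<integral>\<^sup>+y. nlog (chord (Some w) y) \<partial>mixture \<rho> m) = top"
          unfolding T top using m by (simp add: ennreal_mult_top)
        then show ?thesis using False m top unfolding Some
          by (simp add: perturbed_def pot_def V_def cap_potential_eq_cap_integral[OF \<rho>])
      qed
    qed
  qed
qed

lemma perturbed_PSH:
  assumes \<rho>: "0 < \<rho>" "\<rho> < 1" and m: "0 \<le> m" "m < \<rho>"
  shows "perturbed \<rho> m \<in> PSH"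
proof -
  have "(\<integral>\<^sup>+y. nlog (chord (Some 0) y) \<partial>mixture \<rho> m) < top"
    using m unfolding kernel_mixture[OF \<rho> m(1) less_imp_le[OF m(2)]] atom_kernel_zero
    by (simp add: ennreal_mult_less_top)
  then show ?thesis unfolding perturbed_eq_pot[OF assms]
    using \<rho> m by (intro pot_PSH sets_mixture finite_mixture mixture_total) auto
qed

text \<open>The potential vanishes on the cap, so the mass \<open>1 - \<rho>\<close> of the cap
  component survives the restriction to finite values.\<close>

lemma perturbed_positive_mass:
  assumes \<rho>: "0 < \<rho>" "\<rho> < 1" and m: "0 \<le> m" "m < \<rho>"
    and cap0: "\<And>w. w \<in> cap \<rho> \<Longrightarrow> perturbed \<rho> m (Some w) = 0"
  shows "positive_mass (perturbed \<rho> m)"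
  unfolding positive_mass_def
proof (intro exI conjI)
  show "curvature_measure (perturbed \<rho> m) (mixture \<rho> m)"
    unfolding perturbed_eq_pot[OF \<rho> m]
    using \<rho> m by (intro curvature_pot sets_mixture finite_mixture mixture_total) auto
  let ?S = "{x. perturbed \<rho> m x > -\<infinity>}"
  have "openin cp1_top {x \<in> topspace cp1_top. perturbed \<rho> m x < e}" for e
    using perturbed_PSH[OF \<rho> m] by (simp add: PSH_def usc_def)
  then have lt: "{x. perturbed \<rho> m x < e} \<in> sets cp1_borel" for e
    using openin_sets_cp1[of "{x. perturbed \<rho> m x < e}"] by simp
  \<comment> \<open>Sublevel sets are open by upper semicontinuity, so the minus-infinity set is a
    countable intersection of open sets.\<close>
  have "?S = UNIV - (\<Inter>n. {x. perturbed \<rho> m x < ereal (- real n)})"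
  proof -
    have "-\<infinity> < y \<longleftrightarrow> \<not> (\<forall>n::nat. y < ereal (- real n))" for y :: ereal
    proof (cases y)
      case (real r)
      obtain n :: nat where "- r < real n" using reals_Archimedean2 by blast
      then have "\<not> y < ereal (- real n)" using real by simp
      then show ?thesis using real by auto
    qed auto
    then show ?thesis by blast
  qed
  moreover have "(\<Inter>n. {x. perturbed \<rho> m x < ereal (- real n)}) \<in> sets cp1_borel"
    using lt by (intro sets.countable_INT') auto
  ultimately have S: "?S \<in> sets cp1_borel"
    using sets.compl_sets[of _ cp1_borel] by (metis space_cp1_borel)
  have "emeasure (nonpluripolar (perturbed \<rho> m) (mixture \<rho> m)) UNIV = (\<integral>\<^sup>+y. indicator ?S y \<partial>mixture \<rho> m)"
    unfolding nonpluripolar_def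
    using S by (subst emeasure_density) (auto simp: sets_mixture measurable_cong_sets[OF sets_mixture refl] sets.top[of cp1_borel, simplified])
  also have "\<dots> \<ge> ennreal (1 / (2 * pi)) * (\<integral>\<^sup>+q\<in>{0..1 - \<rho>}. (\<integral>\<^sup>+s\<in>{0..2*pi}. indicator ?S (disc_point q s) \<partial>lborel) \<partial>lborel)"
    using S m by (subst nn_integral_mixture[OF \<rho> m(1)]) (auto intro!: add_increasing2)
  also (xtrans) have "(\<integral>\<^sup>+q\<in>{0..1 - \<rho>}. (\<integral>\<^sup>+s\<in>{0..2*pi}. indicator ?S (disc_point q s) \<partial>lborel) \<partial>lborel)
     = (\<integral>\<^sup>+q\<in>{0..1 - \<rho>}. (\<integral>\<^sup>+s\<in>{0..2*pi}. 1 \<partial>lborel) \<partial>lborel)"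
  proof (rule nn_integral_cong)
    fix q :: real
    have "disc_point q s \<in> ?S" if q: "q \<in> {0..1 - \<rho>}" for s
    proof -
      have "q / (1 - q) \<le> (1 - \<rho>) / \<rho>" using q \<rho> by (simp add: field_simps)
      moreover have "0 \<le> q / (1 - q)" using q \<rho> by simp
      ultimately have "of_real (sqrt (q / (1 - q))) * cis s \<in> cap \<rho>"
        by (simp add: cap_def norm_mult)
      then show ?thesis using cap0 by (simp add: disc_point_def)
    qed
    then show "(\<integral>\<^sup>+s\<in>{0..2*pi}. indicator ?S (disc_point q s) \<partial>lborel) * indicator {0..1 - \<rho>} q
        = (\<integral>\<^sup>+s\<in>{0..2*pi}. 1 \<partial>lborel) * indicator {0..1 - \<rho>} q"
      by (cases "q \<in> {0..1 - \<rho>}") auto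
  qed
  also have "\<dots> = ennreal (2 * pi) * ennreal (1 - \<rho>)"
    using \<rho> by (simp add: nn_integral_cmult_indicator)
  also have "ennreal (1 / (2 * pi)) * (ennreal (2 * pi) * ennreal (1 - \<rho>)) = ennreal (1 - \<rho>)"
    using \<rho> by (simp flip: ennreal_mult)
  finally show "0 < emeasure (nonpluripolar (perturbed \<rho> m) (mixture \<rho> m)) UNIV"
    using \<rho> by (simp add: less_le_trans[of 0 "ennreal (1 - \<rho>)"])
qed

lemma perturbed_0: "perturbed \<rho> 0 x = cap_potential \<rho> x"
  by (simp add: perturbed_def flip: zero_ereal_def)

end

text \<open>Every affine point lies in some cap. There the cap potential equals 0, elsewhere it is
  at most 0, so its sub-mean inequality at that point passes to the zero function.\<close>

lemma zero_PSH: "(\<lambda>_. 0) \<in> PSH"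
proof -
  \<comment> \<open>Any packing gives access to \<open>perturbed_PSH\<close>, which for
    \<open>m = 0\<close> speaks of cap potentials.\<close>
  obtain c :: "nat \<Rightarrow> complex" and r where "packing 1 c r"
    by (rule disc_packing[of 1]) (auto simp: packing_def)
  then interpret packing 1 c r .
  have loc: "local_pot (\<lambda>_. 0) \<kappa> z = ereal (ln (fs z))" for \<kappa> :: "complex \<Rightarrow> cp1" and z
    by (simp add: local_pot_def ln_fs)
  have "openin cp1_top UNIV" using openin_topspace[of cp1_top] by simp
  then have "usc cp1_top (\<lambda>_. 0)" by (auto simp: usc_def)
  moreover have "subharmonic (\<lambda>z. ereal (ln (fs z)))"
    unfolding subharmonic_def
  proof (intro conjI allI impI)
    have "continuous_on UNIV (\<lambda>z. ln (fs z))" by (intro continuous_intros) auto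
    from usc_minus_lsc[OF this, of "\<lambda>_. 0"] show "usc euclidean (\<lambda>z. ereal (ln (fs z)))"
      by (simp add: usc_def zero_ennreal.rep_eq)
    fix a :: complex and r :: real assume r: "0 < r"
    \<comment> \<open>With this value the squared radius of the cap is 1 + 2 |a|^2, so
      \<open>a\<close> lies in it.\<close>
    define \<rho> where "\<rho> = 1 / (2 * (1 + (cmod a)\<^sup>2))"
    have a1: "0 < 1 + (cmod a)\<^sup>2" by (simp add: add_pos_nonneg)
    have \<rho>: "0 < \<rho>" "\<rho> < 1" using a1 by (auto simp: \<rho>_def field_simps add_pos_nonneg)
    have "(1 - \<rho>) / \<rho> = 2 * (1 + (cmod a)\<^sup>2) - 1" using a1 by (simp add: \<rho>_def field_simps)
    then have a: "a \<in> cap \<rho>" by (simp add: cap_def)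
    have sub: "subharmonic (local_pot (perturbed \<rho> 0) Some)"
      using perturbed_PSH[of \<rho> 0] \<rho> by (simp add: PSH_def charts_def)
    have "ereal (ln (fs a)) = local_pot (perturbed \<rho> 0) Some a"
      using a by (simp add: local_pot_def perturbed_0 cap_potential_def ln_fs)
    also have "\<dots> \<le> circle_mean (local_pot (perturbed \<rho> 0) Some) a r"
      using sub r by (simp add: subharmonic_def)
    also have "\<dots> \<le> circle_mean (\<lambda>z. ereal (ln (fs z))) a r"
    proof (rule circle_mean_mono[OF r])
      fix t
      show "local_pot (perturbed \<rho> 0) Some (a + of_real r * cis t) \<le> ereal (ln (fs (a + of_real r * cis t)))"
        using add_right_mono[OF cap_potential_nonpos[OF \<rho>]]
        by (fastforce simp: local_pot_def perturbed_0 ln_fs)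
    qed
    finally show "ereal (ln (fs a)) \<le> circle_mean (\<lambda>z. ereal (ln (fs z))) a r" .
  qed simp
  ultimately show ?thesis unfolding PSH_def by (auto simp: loc[abs_def] fun_eq_iff)
qed

section \<open>Domination of competitors in the coordinate at infinity\<close>

text \<open>Half the binary entropy of \<rho>, the constant term of the cap potential.\<close>

definition entropy_const :: "real \<Rightarrow> real" where
  "entropy_const \<rho> = - 1 / 2 * (\<rho> * ln \<rho> + (1 - \<rho>) * ln (1 - \<rho>))"

text \<open>In this coordinate the pole of mass \<rho> is visible as a logarithm. The formula
  includes the boundary circle of the cap, where the two branches match.\<close>

lemma cap_potential_chart:
  assumes \<rho>: "0 < \<rho>" "\<rho> < 1" and z: "z \<noteq> 0" "(cmod z)\<^sup>2 \<le> \<rho> / (1 - \<rho>)"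
  shows "cap_potential \<rho> (chart_inf z) = ereal (entropy_const \<rho> - ln (fs z) + \<rho> * ln (cmod z))"
proof -
  have z2: "0 < (cmod z)\<^sup>2" using z by simp
  have S: "chart_inf z = Some (1 / z)" using z by (simp add: chart_inf_def)
  have capiff: "1 / z \<in> cap \<rho> \<longleftrightarrow> (cmod z)\<^sup>2 = \<rho> / (1 - \<rho>)"
  proof -
    have "1 / z \<in> cap \<rho> \<longleftrightarrow> \<rho> / (1 - \<rho>) \<le> (cmod z)\<^sup>2"
      using z2 \<rho> by (simp add: cap_def norm_divide power_divide field_simps)
    then show ?thesis using z(2) by auto
  qed
  show ?thesis
  proof (cases "1 / z \<in> cap \<rho>")
    case True
    then have e: "(cmod z)\<^sup>2 = \<rho> / (1 - \<rho>)" using capiff by simp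
    have "1 + (cmod z)\<^sup>2 = 1 / (1 - \<rho>)" unfolding e using \<rho> by (simp add: field_simps)
    then have "ln (fs z) = - 1 / 2 * ln (1 - \<rho>)" using \<rho> by (simp add: ln_fs ln_div)
    moreover have "2 * ln (cmod z) = ln \<rho> - ln (1 - \<rho>)"
      using arg_cong[OF e, of ln] z \<rho> by (simp add: ln_realpow ln_div)
    then have lz: "ln (cmod z) = 1 / 2 * ln \<rho> - 1 / 2 * ln (1 - \<rho>)" by linarith
    ultimately have "entropy_const \<rho> - ln (fs z) + \<rho> * ln (cmod z) = 0"
      unfolding lz by (simp add: entropy_const_def algebra_simps add_divide_distrib diff_divide_distrib)
    then show ?thesis using True by (simp add: S cap_potential_def flip: zero_ereal_def)
  next
    case False
    have "ln (1 + (cmod (1 / z))\<^sup>2) = 2 * (ln (fs z) - ln (cmod z))"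
    proof -
      have "ln (fs (1 / z)) = ln (fs z) - ln (cmod z)" using z by (simp add: fs_divide ln_div)
      moreover have "ln (1 + (cmod (1 / z))\<^sup>2) = 2 * ln (fs (1 / z))" by (simp only: ln_fs)
      ultimately show ?thesis by (simp only:)
    qed
    moreover have "ln ((cmod (1 / z))\<^sup>2) = - 2 * ln (cmod z)"
      using z by (simp add: norm_divide power_divide ln_div ln_realpow)
    ultimately show ?thesis using False
      by (simp add: S cap_potential_def entropy_const_def algebra_simps add_divide_distrib diff_divide_distrib)
  qed
qed

context packing
begin

text \<open>The condition \<open>mR\<close> says that the packed disc stays off the interior of the
  cap, so \<open>V\<close> vanishes on the cap.\<close>

lemma perturbed_cap:
  assumes \<rho>: "0 < \<rho>" "\<rho> < 1" and mR: "m = 0 \<or> R\<^sup>2 \<le> \<rho> / (1 - \<rho>)" and w: "w \<in> cap \<rho>"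
  shows "perturbed \<rho> m (Some w) = 0"
proof (cases "m = 0")
  case True
  then show ?thesis using w by (simp add: perturbed_0 cap_potential_def)
next
  case False
  then have "R\<^sup>2 \<le> \<rho> / (1 - \<rho>)" using mR by simp
  then have "(1 - \<rho>) / \<rho> \<le> 1 / R\<^sup>2" using \<rho> R by (simp add: field_simps)
  then have "(cmod w)\<^sup>2 \<le> (1 / R)\<^sup>2" using w by (simp add: cap_def power_divide)
  moreover have "0 \<le> 1 / R" using R by simp
  ultimately have "cmod w \<le> 1 / R" by (rule power2_le_imp_le)
  then show ?thesis using w by (simp add: perturbed_def V_Some_eq_0 cap_potential_def)
qed

definition tail :: "nat \<Rightarrow> real" where
  "tail N = 1 - (\<Sum>k<N. \<alpha> k)"

lemma tail_tendsto: "tail \<longlonglongrightarrow> 0"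
proof -
  have "(\<lambda>N. 1 - (\<Sum>k<N. \<alpha> k)) \<longlonglongrightarrow> 1 - 1"
    using \<alpha>_sums by (intro tendsto_intros) (simp add: sums_def)
  then show ?thesis by (simp add: tail_def[abs_def])
qed

text \<open>Every distance |z - c k| is at most 1 + B + R, so the atoms left out contribute at most
  their total mass times the logarithm of that bound.\<close>

lemma sum_log_tail_le:
  assumes E: "(\<lambda>k. \<alpha> k * ln (cmod (z - c k))) sums E" and z: "cmod z \<le> B"
  shows "E \<le> (\<Sum>k<N. \<alpha> k * ln (cmod (z - c k))) + tail N * ln (1 + B + R)"
proof -
  define L where "L = ln (1 + B + R)"
  have B0: "0 \<le> B" using z norm_ge_zero order_trans by blast
  have le: "ln (cmod (z - c k)) \<le> L" for k
  proof (cases "z = c k")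
    case True
    then show ?thesis using B0 R by (simp add: L_def)
  next
    case False
    have "cmod (z - c k) \<le> 1 + B + R" using norm_triangle_ineq4[of z "c k"] c_less[of k] z by linarith
    then show ?thesis unfolding L_def using False by (subst ln_le_cancel_iff) (use B0 R in auto)
  qed
  have s: "(\<lambda>k. \<alpha> k * L - \<alpha> k * ln (cmod (z - c k))) sums (1 * L - E)"
    by (intro sums_diff sums_mult2 \<alpha>_sums E)
  have "(\<Sum>k<N. \<alpha> k * L - \<alpha> k * ln (cmod (z - c k))) \<le> suminf (\<lambda>k. \<alpha> k * L - \<alpha> k * ln (cmod (z - c k)))"
    using \<alpha>_nonneg le by (intro sum_le_suminf sums_summable[OF s]) (auto intro!: mult_left_mono)
  then have "(\<Sum>k<N. \<alpha> k) * L - (\<Sum>k<N. \<alpha> k * ln (cmod (z - c k))) \<le> 1 * L - E"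
    using sums_unique[OF s] by (simp add: sum_subtractf sum_distrib_right)
  then show ?thesis unfolding tail_def L_def[symmetric] by (simp add: algebra_simps)
qed

lemma perturbed_domination:
  assumes \<rho>: "0 < \<rho>" "\<rho> < 1" and m: "0 \<le> m" "m < \<rho>" and mR: "m = 0 \<or> R\<^sup>2 \<le> \<rho> / (1 - \<rho>)"
    and v: "v \<in> PSH" "\<And>x. v x \<le> 0" "\<And>x. v x \<le> perturbed \<rho> m x + ereal C"
  shows "v \<le> perturbed \<rho> m"
proof (rule le_funI)
  fix x
  \<comment> \<open>The radius, in the coordinate 1 / w, of the closed complement of the cap; the
    maximum principle is applied on this disc.\<close>
  define B where "B = sqrt (\<rho> / (1 - \<rho>))"
  have B: "0 < B" "B\<^sup>2 = \<rho> / (1 - \<rho>)" using \<rho> by (auto simp: B_def)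
  have RB: "R \<le> B" if "m \<noteq> 0"
  proof (rule power2_le_imp_le)
    show "R\<^sup>2 \<le> B\<^sup>2" unfolding B(2) using that mR by blast
  qed (use B in simp)
  define k where "k = entropy_const \<rho>"
  have capB: "cap_potential \<rho> (chart_inf z) = ereal (k - ln (fs z) + \<rho> * ln (cmod z))" if "z \<noteq> 0" "cmod z \<le> B" for z
    unfolding k_def
  proof (rule cap_potential_chart[OF \<rho> that(1)])
    show "(cmod z)\<^sup>2 \<le> \<rho> / (1 - \<rho>)" unfolding B(2)[symmetric] using that(2) by (intro power_mono) auto
  qed
  show "v x \<le> perturbed \<rho> m x"
  proof (cases "perturbed \<rho> m x = -\<infinity>")
    case True
    then show ?thesis using v(3)[of x] by simp
  next
    case fin: False
    show ?thesis
    proof (cases "x \<in> Some ` cap \<rho>")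
      case True
      then show ?thesis using v(2)[of x] perturbed_cap[OF \<rho> mR] by auto
    next
      case False
      have "perturbed \<rho> m None = -\<infinity>" by (simp add: perturbed_def cap_potential_def V_def)
      have "x \<noteq> None"
      proof
        assume "x = None"
        then show False using fin \<open>perturbed \<rho> m None = -\<infinity>\<close> by simp
      qed
      then obtain w where w: "x = Some w" "w \<notin> cap \<rho>" using False by auto
      have w0: "w \<noteq> 0" using w(2) \<rho> by (auto simp: cap_def)
      define z where "z = 1 / w"
      have z: "z \<noteq> 0" "x = chart_inf z" using w w0 by (auto simp: z_def chart_inf_def)
      have zB: "cmod z \<le> B"
      proof (rule power2_le_imp_le)
        have "(1 - \<rho>) / \<rho> < (cmod w)\<^sup>2" using w(2) by (simp add: cap_def)
        then show "(cmod z)\<^sup>2 \<le> B\<^sup>2"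
          using \<rho> w0 unfolding B(2) z_def by (simp add: norm_divide power_divide field_simps)
      qed (use B in simp)
      define u where "u = local_pot v chart_inf"
      have u_eq: "u y = v (chart_inf y) + ereal (ln (fs y))" for y by (simp add: u_def local_pot_def ln_fs)
      have usub: "subharmonic u" using v(1) by (simp add: u_def PSH_def charts_def)
      \<comment> \<open>\<open>None\<close> indexes the pole at infinity, \<open>Some j\<close> the
        j-th atom. Atoms of zero weight are dropped because \<open>log_pole_domination\<close> needs
        positive coefficients.\<close>
      define I where "I N = insert None (Some ` {j. j < N \<and> 0 < m * \<alpha> j})" for N :: nat
      define \<beta> where "\<beta> i = (case i of None \<Rightarrow> \<rho> - m | Some j \<Rightarrow> m * \<alpha> j)" for i
      define p where "p i = (case i of None \<Rightarrow> 0 | Some j \<Rightarrow> c j)" for i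
      define F where "F N y = (\<Sum>i\<in>I N. \<beta> i * ln (cmod (y - p i)))" for N y
      define L where "L = ln (1 + B + R)"
      have F_eq: "F N y = (\<rho> - m) * ln (cmod y) + m * (\<Sum>j<N. \<alpha> j * ln (cmod (y - c j)))" for N y
      proof -
        have "F N y = (\<rho> - m) * ln (cmod y) + (\<Sum>j\<in>{j. j < N \<and> 0 < m * \<alpha> j}. m * \<alpha> j * ln (cmod (y - c j)))"
          unfolding F_def I_def by (subst sum.insert) (auto simp: \<beta>_def p_def sum.reindex)
        also have "(\<Sum>j\<in>{j. j < N \<and> 0 < m * \<alpha> j}. m * \<alpha> j * ln (cmod (y - c j))) = (\<Sum>j<N. m * \<alpha> j * ln (cmod (y - c j)))"
          using m(1) \<alpha>_nonneg by (intro sum.mono_neutral_left) (auto simp: not_less zero_less_mult_iff less_le)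
        finally show ?thesis by (simp add: sum_distrib_left mult.assoc)
      qed
      have pole: "y \<noteq> 0" if "y \<notin> p ` I N" for y N
        using that by (auto simp: p_def I_def)
      \<comment> \<open>\<open>C\<close> enters only the a priori bound near the poles. The
        conclusion carries the boundary constant, which exceeds \<open>k\<close> by the omitted mass
        times \<open>L\<close>.\<close>
      have bound: "u z \<le> ereal (F N z + (k + m * (tail N * L)))" for N
      proof (rule log_pole_domination[where I="I N" and \<beta>=\<beta> and p=p and R=B and C="k + m * (tail N * L) + C"])
        show "subharmonic u" by (rule usub)
        show "finite (I N)" by (simp add: I_def)
        show "0 < \<beta> i" if "i \<in> I N" for i using that m by (auto simp: I_def \<beta>_def)
        show "cmod (p i) < B" if "i \<in> I N" for i
        proof (cases i)
          case (Some j)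
          then have "m \<noteq> 0" using that by (auto simp: I_def)
          from RB[OF this] show ?thesis using c_less[of j] Some by (simp add: p_def)
        qed (use B in \<open>simp add: p_def\<close>)
        show "F N = (\<lambda>z. \<Sum>i\<in>I N. \<beta> i * ln (cmod (z - p i)))" by (simp add: F_def[abs_def])
        show "cmod z \<le> B" by (rule zB)
        show "z \<notin> p ` I N"
        proof
          assume "z \<in> p ` I N"
          then obtain j where j: "0 < m * \<alpha> j" "z = c j" using z(1) by (auto simp: I_def p_def)
          then have "0 < m" "0 < \<alpha> j" using m \<alpha>_nonneg[of j] by (auto simp: zero_less_mult_iff)
          then have "perturbed \<rho> m x = -\<infinity>"
            unfolding z(2) j(2) perturbed_def using V_centre[of j] capB[of z] z zB j by simp
          then show False using fin by simp
        qed
      next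
        fix y assume y: "cmod y \<le> B" "y \<notin> p ` I N"
        note y0 = pole[OF y(2)]
        have V_le: "ereal m * V (chart_inf y) \<le> ereal (m * ((\<Sum>j<N. \<alpha> j * ln (cmod (y - c j))) + tail N * L - ln (cmod y)))"
        proof (cases "m = 0")
          case True
          then show ?thesis by (simp flip: zero_ereal_def)
        next
          case False
          show ?thesis
          proof (cases "V (chart_inf y) = -\<infinity>")
            case True
            then show ?thesis using False m by simp
          next
            case fy: False
            obtain E where E: "(\<lambda>k. \<alpha> k * ln (cmod (y - c k))) sums E" "V (chart_inf y) = ereal (E - ln (cmod y))"
              using V_summable[OF y0 fy] by metis
            have "E \<le> (\<Sum>j<N. \<alpha> j * ln (cmod (y - c j))) + tail N * L"
              unfolding L_def by (rule sum_log_tail_le[OF E(1) y(1)])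
            then show ?thesis using E(2) m by (simp add: mult_left_mono)
          qed
        qed
        have "u y \<le> (perturbed \<rho> m (chart_inf y) + ereal C) + ereal (ln (fs y))"
          unfolding u_eq by (intro add_right_mono v)
        also have "\<dots> \<le> (ereal (k - ln (fs y) + \<rho> * ln (cmod y))
           + ereal (m * ((\<Sum>j<N. \<alpha> j * ln (cmod (y - c j))) + tail N * L - ln (cmod y))) + ereal C) + ereal (ln (fs y))"
          unfolding perturbed_def capB[OF y0 y(1)] by (intro add_right_mono add_left_mono V_le)
        also have "\<dots> = ereal (F N y + (k + m * (tail N * L) + C))"
          unfolding F_eq by (simp add: algebra_simps)
        finally show "u y \<le> ereal (F N y + (k + m * (tail N * L) + C))" .
      next
        fix y assume y: "cmod y = B"
        then have y0: "y \<noteq> 0" using B by auto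
        have "1 / y \<in> cap \<rho>"
          using y y0 \<rho> B(2) by (simp add: cap_def norm_divide power_divide)
        then have "cap_potential \<rho> (chart_inf y) = 0"
          using y0 by (simp add: cap_potential_def chart_inf_def)
        \<comment> \<open>The cap potential is 0 on the boundary circle, which turns
          \<open>v <= 0\<close> into a bound by the pole term. As \<open>V\<close> is 0 there too,
          \<open>ln (cmod y)\<close> may next be exchanged for the atomic sum.\<close>
        then have lf: "ln (fs y) = k + \<rho> * ln (cmod y)"
          using capB[OF y0] y by (simp flip: zero_ereal_def)
        have "m * ln (cmod y) \<le> m * ((\<Sum>j<N. \<alpha> j * ln (cmod (y - c j))) + tail N * L)"
        proof (cases "m = 0")
          case False
          have V0: "V (chart_inf y) = 0" using RB[OF False] y by (intro V_outside) simp
          then obtain E where E: "(\<lambda>k. \<alpha> k * ln (cmod (y - c k))) sums E" "V (chart_inf y) = ereal (E - ln (cmod y))"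
            using V_summable[OF y0] by (metis MInfty_neq_ereal(1) zero_ereal_def)
          have "E \<le> (\<Sum>j<N. \<alpha> j * ln (cmod (y - c j))) + tail N * L"
            unfolding L_def using y by (intro sum_log_tail_le[OF E(1)]) simp
          then show ?thesis using E(2) V0 m by (intro mult_left_mono) (auto simp flip: zero_ereal_def)
        qed simp
        then have "ln (fs y) \<le> F N y + (k + m * (tail N * L))"
          unfolding lf F_eq by (simp add: algebra_simps)
        moreover have "u y \<le> 0 + ereal (ln (fs y))" unfolding u_eq by (intro add_right_mono v)
        ultimately show "u y \<le> ereal (F N y + (k + m * (tail N * L)))"
          by (simp add: order_trans[of "u y" "ereal (ln (fs y))"])
      qed
      obtain E where E: "m \<noteq> 0 \<Longrightarrow> (\<lambda>k. \<alpha> k * ln (cmod (z - c k))) sums E"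
        "perturbed \<rho> m x = ereal (k - ln (fs z) + \<rho> * ln (cmod z) + m * (E - ln (cmod z)))"
      proof (cases "m = 0")
        case True
        then show thesis using that[of 0] capB[OF z(1) zB] by (simp add: perturbed_0 z(2))
      next
        case False
        have "V (chart_inf z) \<noteq> -\<infinity>"
        proof
          assume "V (chart_inf z) = -\<infinity>"
          then have "perturbed \<rho> m x = -\<infinity>" unfolding z(2) perturbed_def using False m capB[OF z(1) zB] by simp
          then show False using fin by simp
        qed
        then obtain E where "(\<lambda>k. \<alpha> k * ln (cmod (z - c k))) sums E" "V (chart_inf z) = ereal (E - ln (cmod z))"
          using V_summable[OF z(1)] by metis
        then show thesis using that[of E] capB[OF z(1) zB] by (simp add: perturbed_def z(2))
      qed
      \<comment> \<open>As the number of atoms grows, the tail error vanishes and the bounds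
        converge to the local form of the perturbed potential.\<close>
      have lim: "(\<lambda>N. F N z + (k + m * (tail N * L))) \<longlonglongrightarrow> (\<rho> - m) * ln (cmod z) + m * E + (k + m * (0 * L))"
      proof (cases "m = 0")
        case True
        then show ?thesis by (simp add: F_eq)
      next
        case False
        then have "(\<lambda>N. \<Sum>j<N. \<alpha> j * ln (cmod (z - c j))) \<longlonglongrightarrow> E" using E(1) by (simp add: sums_def)
        then show ?thesis unfolding F_eq by (intro tendsto_intros tail_tendsto)
      qed
      show ?thesis
      proof (cases "v x")
        case (real r)
        then have "r + ln (fs z) \<le> F N z + (k + m * (tail N * L))" for N
          using bound[of N] unfolding u_eq z(2)[symmetric] by simp
        then have "r + ln (fs z) \<le> (\<rho> - m) * ln (cmod z) + m * E + (k + m * (0 * L))"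
          by (intro LIMSEQ_le_const[OF lim]) auto
        then show ?thesis using real E(2) by (simp add: algebra_simps)
      next
        case PInf
        then show ?thesis using v(2)[of x] by simp
      qed simp
    qed
  qed
qed

lemma perturbed_model:
  assumes \<rho>: "0 < \<rho>" "\<rho> < 1" and m: "0 \<le> m" "m < \<rho>" and mR: "m = 0 \<or> R\<^sup>2 \<le> \<rho> / (1 - \<rho>)"
    and le: "\<And>x. perturbed \<rho> m x \<le> 0"
  shows "model_potential (perturbed \<rho> m)"
proof (rule model_potentialI)
  show "perturbed \<rho> m \<in> PSH" by (rule perturbed_PSH[OF \<rho> m])
  have "0 \<in> cap \<rho>" using \<rho> by (simp add: cap_def)
  then have "perturbed \<rho> m (Some 0) = 0" by (rule perturbed_cap[OF \<rho> mR])
  then show "(SUP x. perturbed \<rho> m x) = 0"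
    using le by (intro antisym SUP_least) (auto intro: SUP_upper2[of "Some 0"])
qed (rule perturbed_domination[OF \<rho> m mR])

end

lemma zero_model: "model_potential (\<lambda>_. 0)"
  by (rule model_potentialI) (auto simp: zero_PSH le_fun_def)

section \<open>Concavity in the curve parameter\<close>

text \<open>The end point \<open>b\<close> belongs to the finite part, so superlevel sets stay
  closed. A value of minus infinity makes the concavity inequality trivial.\<close>

lemma cutoff_test_curve:
  fixes g :: "real \<Rightarrow> real"
  assumes cont: "continuous_on {..b} g" and conc: "concave_on {..b} g" and anti: "antimono_on {..b} g"
    and f: "f = (\<lambda>\<tau>. if \<tau> \<le> b then ereal (g \<tau>) else -\<infinity>)"
  shows "usc euclidean f \<and> ext_concave f \<and> antimono f"
proof (intro conjI)
  show "antimono f"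
    using anti by (auto simp: f monotone_on_def)
  show "usc euclidean f"
    unfolding usc_def
  proof (intro allI)
    fix e :: ereal
    show "openin euclidean {\<tau> \<in> topspace euclidean. f \<tau> < e}"
    proof (cases e)
      case (real r)
      have "closed {\<tau> \<in> {..b}. g \<tau> \<in> {r..}}"
        using cont by (intro continuous_closed_preimage[unfolded vimage_def Int_def, simplified]) auto
      moreover have "{\<tau>. f \<tau> < e} = - {\<tau> \<in> {..b}. g \<tau> \<in> {r..}}" by (auto simp: f real)
      ultimately show ?thesis by (simp add: open_Compl)
    next
      case PInf
      then have "{\<tau>. f \<tau> < e} = UNIV" by (auto simp: f)
      then show ?thesis by simp
    qed simp
  qed
  show "ext_concave f"
    unfolding ext_concave_def
  proof (intro allI impI)
    fix \<sigma> \<tau> t :: real assume t: "0 < t \<and> t < 1"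
    show "ereal (1 - t) * f \<sigma> + ereal t * f \<tau> \<le> f ((1 - t) * \<sigma> + t * \<tau>)"
    proof (cases "\<sigma> \<le> b \<and> \<tau> \<le> b")
      case True
      then have "(1 - t) * \<sigma> + t * \<tau> \<le> b" using t by (intro convex_bound_le) auto
      moreover have "(1 - t) * g \<sigma> + t * g \<tau> \<le> g ((1 - t) * \<sigma> + t * \<tau>)"
        using concave_onD[OF conc, of t \<sigma> \<tau>] True t by simp
      ultimately show ?thesis using True by (simp add: f)
    next
      case False
      then have "f \<sigma> = -\<infinity> \<or> f \<tau> = -\<infinity>" "f \<sigma> \<noteq> \<infinity>" "f \<tau> \<noteq> \<infinity>" by (auto simp: f)
      then have eq: "ereal (1 - t) * f \<sigma> + ereal t * f \<tau> = -\<infinity>"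
        using t by (cases "f \<sigma>"; cases "f \<tau>") auto
      show ?thesis unfolding eq by simp
    qed
  qed
qed

text \<open>At the joint the truncated difference quotient is dominated by that of \<open>h\<close>,
  which tends to 0; hence the glued function is differentiable there.\<close>

lemma has_real_derivative_truncated:
  assumes h: "\<And>x. t \<le> x \<Longrightarrow> x < b \<Longrightarrow> (h has_real_derivative h' x) (at x)" and t: "h t = 0" "h' t = 0" and x: "x < b"
  shows "((\<lambda>\<tau>. if \<tau> \<le> t then 0 else h \<tau>) has_real_derivative (if x \<le> t then 0 else h' x)) (at x)"
proof (cases x t rule: linorder_cases)
  case less
  have "eventually (\<lambda>\<tau>. \<tau> < t) (nhds x)" using less by (intro eventually_nhds_in_open[of "{..<t}", simplified])
  then have ev: "eventually (\<lambda>\<tau>. (if \<tau> \<le> t then 0 else h \<tau>) = 0) (nhds x)" by eventually_elim simp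
  show ?thesis using less by (subst DERIV_cong_ev[OF refl ev refl]) simp
next
  case greater
  have "eventually (\<lambda>\<tau>. t < \<tau>) (nhds x)" using greater by (intro eventually_nhds_in_open[of "{t<..}", simplified])
  then have ev: "eventually (\<lambda>\<tau>. (if \<tau> \<le> t then 0 else h \<tau>) = h \<tau>) (nhds x)" by eventually_elim simp
  show ?thesis using greater h[of x] x by (subst DERIV_cong_ev[OF refl ev refl]) simp
next
  case equal
  have "((\<lambda>y. (h y - h t) / (y - t)) \<longlongrightarrow> 0) (at t)"
    using h[of t] t x equal by (simp add: has_field_derivative_iff)
  then have "((\<lambda>y. ((if y \<le> t then 0 else h y) - 0) / (y - t)) \<longlongrightarrow> 0) (at t)"
    by (rule Lim_null_comparison[OF _ tendsto_rabs_zero, rotated]) (auto intro!: always_eventually simp: t)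
  then show ?thesis using equal by (simp add: has_field_derivative_iff)
qed

section \<open>The profile of the curves at a fixed point\<close>

definition cap_branch :: "real \<Rightarrow> real \<Rightarrow> real" where
  "cap_branch a \<tau> = 1 / 2 * (- ln (1 + a) + (1 - \<tau>\<^sup>2) * ln a - \<tau>\<^sup>2 * ln (\<tau>\<^sup>2) - (1 - \<tau>\<^sup>2) * ln (1 - \<tau>\<^sup>2))"

text \<open>Up to the factor minus \<tau>, the derivative of \<open>cap_branch\<close> in the
  parameter. It vanishes when the point leaves the cap.\<close>

definition slope :: "real \<Rightarrow> real \<Rightarrow> real" where
  "slope a \<tau> = ln a + ln (\<tau>\<^sup>2) - ln (1 - \<tau>\<^sup>2)"

lemma sq_less_1: "0 \<le> \<tau> \<Longrightarrow> \<tau> < 1 \<Longrightarrow> (\<tau>::real)\<^sup>2 < 1"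
  by (simp add: power_less_one_iff)

lemma cap_branch_derivative:
  assumes a: "0 < a" and \<tau>: "0 < \<tau>" "\<tau> < 1"
  shows "(cap_branch a has_real_derivative - \<tau> * slope a \<tau>) (at \<tau>)"
proof -
  have p: "0 < \<tau>\<^sup>2" "0 < 1 - \<tau>\<^sup>2" using \<tau> sq_less_1[of \<tau>] by auto
  have "((\<lambda>y. y * ln y) has_real_derivative ln y + 1) (at y)" if "0 < y" for y :: real
    using that by (auto intro!: derivative_eq_intros)
  note d = this
  have sq: "((\<lambda>\<tau>::real. \<tau>\<^sup>2) has_real_derivative 2 * \<tau>) (at \<tau>)"
    by (auto intro!: derivative_eq_intros)
  have sq': "((\<lambda>\<tau>::real. 1 - \<tau>\<^sup>2) has_real_derivative - 2 * \<tau>) (at \<tau>)"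
    by (auto intro!: derivative_eq_intros)
  have d1: "((\<lambda>\<tau>. \<tau>\<^sup>2 * ln (\<tau>\<^sup>2)) has_real_derivative (ln (\<tau>\<^sup>2) + 1) * (2 * \<tau>)) (at \<tau>)"
    by (rule DERIV_chain2[where f="\<lambda>y. y * ln y" and g="\<lambda>\<tau>. \<tau>\<^sup>2", OF d[OF p(1)] sq])
  have d2: "((\<lambda>\<tau>. (1 - \<tau>\<^sup>2) * ln (1 - \<tau>\<^sup>2)) has_real_derivative (ln (1 - \<tau>\<^sup>2) + 1) * (- 2 * \<tau>)) (at \<tau>)"
    by (rule DERIV_chain2[where f="\<lambda>y. y * ln y" and g="\<lambda>\<tau>. 1 - \<tau>\<^sup>2", OF d[OF p(2)] sq'])
  have "(cap_branch a has_real_derivative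
     1 / 2 * (0 + (- 2 * \<tau>) * ln a - (ln (\<tau>\<^sup>2) + 1) * (2 * \<tau>) - (ln (1 - \<tau>\<^sup>2) + 1) * (- 2 * \<tau>))) (at \<tau>)"
    unfolding cap_branch_def
    by (intro DERIV_cmult DERIV_diff DERIV_add DERIV_const d1 d2 DERIV_cmult_right sq')
  then show ?thesis by (simp add: slope_def algebra_simps)
qed

lemma slope_less:
  assumes "0 < a" "0 < x" "x < y" "y < 1" shows "slope a x < slope a y"
proof -
  have "x\<^sup>2 < y\<^sup>2" using assms by (intro power_strict_mono) auto
  moreover have "0 < x\<^sup>2" "y\<^sup>2 < 1" using assms sq_less_1[of y] by auto
  ultimately have "ln (x\<^sup>2) < ln (y\<^sup>2)" "ln (1 - y\<^sup>2) < ln (1 - x\<^sup>2)" by (intro ln_less_cancel_iff[THEN iffD2]; linarith)+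
  then show ?thesis by (simp add: slope_def)
qed

text \<open>Here \<open>t\<close> is the parameter at which a point with \<open>|w|^2 = a\<close> leaves the contact set, and \<open>v\<close> is
  the value of the perturbation there.\<close>

locale curve_profile =
  fixes a t s v :: real
  assumes a: "0 < a" and t: "0 < t" "t < 1" "t\<^sup>2 = 1 / (1 + a)" and s: "0 < s" "s < 1"
    and v: "s \<le> t \<Longrightarrow> v = 0" "t < s \<Longrightarrow> v \<le> 1 / 2 * slope a s"
begin

definition g :: "real \<Rightarrow> real" where
  "g \<tau> = (if \<tau> \<le> t then 0 else cap_branch a \<tau>) + v * (if \<tau> \<le> s then 0 else (\<tau> - s)\<^sup>2)"

definition g' :: "real \<Rightarrow> real" where
  "g' \<tau> = (if \<tau> \<le> t then 0 else - \<tau> * slope a \<tau>) + v * (if \<tau> \<le> s then 0 else 2 * (\<tau> - s))"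

lemma slope_t: "slope a t = 0" and cap_branch_t: "cap_branch a t = 0"
proof -
  have 1: "1 - t\<^sup>2 = a / (1 + a)" using a t(3) by (simp add: field_simps)
  have "slope a t = ln a + ln (1 / (1 + a)) - ln (a / (1 + a))"
    by (simp only: slope_def 1) (simp only: t(3))
  then show "slope a t = 0" using a by (simp add: ln_div)
  have "cap_branch a t = 1 / 2 * (- ln (1 + a) + a / (1 + a) * ln a
      - 1 / (1 + a) * ln (1 / (1 + a)) - a / (1 + a) * ln (a / (1 + a)))"
    by (simp only: cap_branch_def 1) (simp only: t(3))
  also have "\<dots> = 1 / 2 * (- ln (1 + a) + (1 / (1 + a) + a / (1 + a)) * ln (1 + a))"
    using a by (simp add: ln_div algebra_simps)
  also have "1 / (1 + a) + a / (1 + a) = 1" using a by (simp add: field_simps)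
  finally show "cap_branch a t = 0" by simp
qed

lemma slope_pos: "t < \<tau> \<Longrightarrow> \<tau> < 1 \<Longrightarrow> 0 < slope a \<tau>"
  using slope_less[OF a t(1)] slope_t by fastforce

lemma derivative: "\<tau> < 1 \<Longrightarrow> (g has_real_derivative g' \<tau>) (at \<tau>)"
proof -
  assume \<tau>: "\<tau> < 1"
  have 1: "((\<lambda>\<tau>. if \<tau> \<le> t then 0 else cap_branch a \<tau>) has_real_derivative (if \<tau> \<le> t then 0 else - \<tau> * slope a \<tau>)) (at \<tau>)"
    using t(1) by (intro has_real_derivative_truncated[where b=1] cap_branch_derivative a \<tau>)
      (auto simp: cap_branch_t slope_t)
  have 2: "((\<lambda>\<tau>. if \<tau> \<le> s then 0 else (\<tau> - s)\<^sup>2) has_real_derivative (if \<tau> \<le> s then 0 else 2 * (\<tau> - s))) (at \<tau>)"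
    by (intro has_real_derivative_truncated[where b=1] \<tau>) (auto intro!: derivative_eq_intros)
  show ?thesis unfolding g_def[abs_def] g'_def by (intro DERIV_add DERIV_cmult 1 2)
qed

text \<open>Since \<open>slope\<close> increases, the product \<tau> \<open>slope\<close> grows at
  least at the rate \<open>slope a x\<close>; this surplus pays for a positive
  \<open>v\<close>.\<close>

lemma scaled_slope_mono:
  assumes "t < x" "x \<le> y" "y < 1" shows "x * slope a x + (y - x) * slope a x \<le> y * slope a y"
proof -
  have "slope a x \<le> slope a y" using slope_less[OF a, of x y] assms t by (cases "x = y") auto
  then have "y * slope a x \<le> y * slope a y" using assms t by (intro mult_left_mono) auto
  then show ?thesis by (simp add: algebra_simps)
qed

text \<open>For \<open>v <= 0\<close> both summands decrease. A positive \<open>v\<close> forces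
  \<open>t < s\<close>, and then the hypothesis \<open>2 * v <= slope a s\<close> lets the growth of
  \<tau> \<open>slope\<close> outweigh that of the perturbation.\<close>

lemma g'_antimono: "x \<le> y \<Longrightarrow> y < 1 \<Longrightarrow> g' y \<le> g' x"
proof -
  assume xy: "x \<le> y" "y < 1"
  have A: "(if x \<le> t then 0 else x * slope a x) \<le> (if y \<le> t then 0 else y * slope a y)"
  proof (cases "x \<le> t")
    case True
    then show ?thesis using slope_pos[of y] xy t by (auto intro!: mult_nonneg_nonneg simp: less_imp_le)
  next
    case False
    then have "0 \<le> (y - x) * slope a x" using slope_pos[of x] xy by (intro mult_nonneg_nonneg) auto
    then show ?thesis using False scaled_slope_mono[of x y] xy by simp
  qed
  show "g' y \<le> g' x"
  proof (cases "v \<le> 0")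
    case True
    have "v * (if y \<le> s then 0 else 2 * (y - s)) \<le> v * (if x \<le> s then 0 else 2 * (x - s))"
      using xy True by (intro mult_left_mono_neg) auto
    then show ?thesis using A by (simp add: g'_def split: if_splits)
  next
    case False
    then have ts: "t < s" using v(1) by fastforce
    then have vs: "2 * v \<le> slope a s" using v(2) by simp
    \<comment> \<open>Past \<open>s\<close> the perturbation adds 2 v per unit of parameter, which
      is at most \<open>slope a x'\<close>.\<close>
    have beyond: "g' y' \<le> g' x'" if "s \<le> x'" "x' \<le> y'" "y' < 1" for x' y'
    proof -
      have "2 * v \<le> slope a x'" using vs slope_less[OF a s(1), of x'] that by (cases "s = x'") auto
      then have "2 * v * (y' - x') \<le> slope a x' * (y' - x')" using that by (intro mult_right_mono) auto
      then show ?thesis using scaled_slope_mono[of x' y'] that ts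
        by (cases "x' = y'") (auto simp: g'_def algebra_simps)
    qed
    show ?thesis
    proof (cases "s \<le> x")
      case True
      then show ?thesis using beyond xy by blast
    next
      case x: False
      have le_s: "g' z \<le> g' x" if "x \<le> z" "z \<le> s" for z
      proof -
        have "(if x \<le> t then 0 else x * slope a x) \<le> (if z \<le> t then 0 else z * slope a z)"
        proof (cases "x \<le> t")
          case True
          then show ?thesis using slope_pos[of z] that s t by (auto intro!: mult_nonneg_nonneg simp: less_imp_le)
        next
          case False
          then have "0 \<le> (z - x) * slope a x" using slope_pos[of x] that s by (intro mult_nonneg_nonneg) auto
          then show ?thesis using False scaled_slope_mono[of x z] that s by simp
        qed
        then show ?thesis using that x by (simp add: g'_def split: if_splits)
      qed
      show ?thesis
      proof (cases "y \<le> s")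
        case True
        then show ?thesis using le_s xy by blast
      next
        case False
        then have "g' y \<le> g' s" using beyond[of s y] xy by simp
        also have "\<dots> \<le> g' x" using le_s[of s] x by simp
        finally show ?thesis .
      qed
    qed
  qed
qed

lemma g'_nonpos: "\<tau> < 1 \<Longrightarrow> g' \<tau> \<le> 0"
proof -
  assume "\<tau> < 1"
  \<comment> \<open>Far enough to the left both truncations are inactive, so \<open>g'\<close> is 0
    there and monotonicity does the rest.\<close>
  obtain x where x: "x \<le> \<tau>" "x \<le> t" "x \<le> s"
    using that[of "min \<tau> (min t s)"] by auto
  have "g' \<tau> \<le> g' x" using x \<open>\<tau> < 1\<close> by (intro g'_antimono) auto
  also have "g' x = 0" using x by (simp add: g'_def)
  finally show ?thesis .
qed

lemma g_eq_0: "\<tau> \<le> t \<Longrightarrow> g \<tau> = 0"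
  unfolding g_def using v by (cases "s \<le> t") auto

lemma concave: "concave_on {..<1} g"
  unfolding concave_on_def
proof (rule convex_on_realI)
  show "((\<lambda>x. - g x) has_real_derivative - g' x) (at x)" if "x \<in> {..<1}" for x
    using derivative[of x] that by (intro DERIV_minus) auto
qed (use g'_antimono in auto)

lemma antimono: "antimono_on {..<1} g"
proof (rule monotone_onI)
  fix x y :: real assume "x \<in> {..<1}" "y \<in> {..<1}" "x \<le> y"
  then show "g y \<le> g x"
  proof (intro DERIV_nonpos_imp_nonincreasing[of x y g])
    fix z assume "z \<le> y"
    then have "z < 1" using \<open>y \<in> {..<1}\<close> by simp
    then show "\<exists>d. (g has_real_derivative d) (at z) \<and> d \<le> 0" using derivative g'_nonpos by blast
  qed
qed

text \<open>Strictness keeps the contact set from growing: when \<open>v\<close> is positive,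
  \<open>g'\<close> past \<open>s\<close> is bounded by its strictly negative value at
  \<open>s\<close>.\<close>

lemma g_neg: assumes "t < \<tau>" "\<tau> < 1" shows "g \<tau> < 0"
proof -
  have neg: "g' x < 0" if "t < x" "x < 1" for x
  proof -
    have x0: "0 < x * slope a x" using that slope_pos t by simp
    show ?thesis
    proof (cases "v \<le> 0 \<or> x \<le> s")
      case True
      then have "v * (if x \<le> s then 0 else 2 * (x - s)) \<le> 0" by (auto intro: mult_nonpos_nonneg)
      then show ?thesis using x0 that by (simp add: g'_def)
    next
      case False
      then have ts: "t < s" using v by (auto simp: not_le[symmetric])
      have "g' x \<le> g' s" using False that by (intro g'_antimono) auto
      also have "g' s < 0" using ts slope_pos[OF ts s(2)] s(1) by (simp add: g'_def)
      finally show ?thesis .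
    qed
  qed
  obtain z where z: "t < z" "z < \<tau>" "g \<tau> - g t = (\<tau> - t) * g' z"
    using MVT2[OF assms(1), of g g'] derivative assms(2) by force
  have "(\<tau> - t) * g' z < 0" using z assms neg by (intro mult_pos_neg) auto
  then show ?thesis using z(3) g_eq_0[of t] by simp
qed

lemma cutoff:
  assumes b: "b < 1" and f: "f = (\<lambda>\<tau>. if \<tau> \<le> b then ereal (g \<tau>) else -\<infinity>)"
  shows "usc euclidean f \<and> ext_concave f \<and> antimono f"
proof (rule cutoff_test_curve[OF _ _ _ f])
  have sub: "{..b} \<subseteq> {..<1}" using b by auto
  show "continuous_on {..b} g"
    using derivative b by (intro continuous_at_imp_continuous_on) (auto intro: DERIV_isCont[OF derivative])
  show "concave_on {..b} g" using concave unfolding concave_on_def by (rule convex_on_subset) (use sub in auto)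
  show "antimono_on {..b} g" using antimono sub by (rule monotone_on_subset)
qed

end

section \<open>The two test curves\<close>

text \<open>This identifies \<open>1 / fs w\<close> as the parameter at which \<open>w\<close>
  leaves the shrinking caps.\<close>

lemma mem_cap_iff:
  assumes "0 < \<tau>" shows "w \<in> cap (\<tau>\<^sup>2) \<longleftrightarrow> \<tau> \<le> 1 / fs w"
proof -
  have w1: "0 < 1 + (cmod w)\<^sup>2" by (simp add: add_pos_nonneg)
  have "w \<in> cap (\<tau>\<^sup>2) \<longleftrightarrow> \<tau>\<^sup>2 \<le> 1 / (1 + (cmod w)\<^sup>2)"
    using assms w1 by (simp add: cap_def field_simps)
  also have "1 / (1 + (cmod w)\<^sup>2) = (1 / fs w)\<^sup>2"
    using w1 by (simp add: fs_def power_divide)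
  also have "\<tau>\<^sup>2 \<le> (1 / fs w)\<^sup>2 \<longleftrightarrow> \<tau> \<le> 1 / fs w"
    using assms by (intro power2_le_iff_abs_le[THEN trans]) (auto simp: less_imp_le)
  finally show ?thesis .
qed

text \<open>In the coordinate 1 / w the complement of the cap of parameter s squared is the open
  disc of radius R with R^2 = s^2 / (1 - s^2), which is the disc that was packed.\<close>

locale test_curves = packing +
  fixes s T :: real
  assumes s: "0 < s" "s < T" and T: "T < 1" and R_s: "R\<^sup>2 = s\<^sup>2 / (1 - s\<^sup>2)"
begin

text \<open>\<open>e = 0\<close> gives the curve of cap potentials and \<open>e = 1\<close> its perturbation.\<close>

definition bend :: "real \<Rightarrow> real \<Rightarrow> real" where
  "bend e \<tau> = e * (if \<tau> \<le> s then 0 else (\<tau> - s)\<^sup>2)"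

definition curve :: "real \<Rightarrow> real \<Rightarrow> cp1 \<Rightarrow> ereal" where
  "curve e \<tau> = (if \<tau> \<le> 0 then (\<lambda>_. 0) else if \<tau> \<le> T then perturbed (\<tau>\<^sup>2) (bend e \<tau>) else (\<lambda>_. -\<infinity>))"

lemma bend_bounds:
  assumes "e \<in> {0, 1}" "0 < \<tau>" "\<tau> \<le> T"
  shows "0 \<le> bend e \<tau>" "bend e \<tau> < \<tau>\<^sup>2" "bend e \<tau> = 0 \<or> R\<^sup>2 \<le> \<tau>\<^sup>2 / (1 - \<tau>\<^sup>2)"
proof -
  show "0 \<le> bend e \<tau>" using assms by (auto simp: bend_def)
  have "(\<tau> - s)\<^sup>2 < \<tau>\<^sup>2" if "s < \<tau>" using that s by (intro power_strict_mono) auto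
  then show "bend e \<tau> < \<tau>\<^sup>2" using assms by (auto simp: bend_def)
  have "R\<^sup>2 \<le> \<tau>\<^sup>2 / (1 - \<tau>\<^sup>2)" if "s < \<tau>"
  proof -
    have "s\<^sup>2 \<le> \<tau>\<^sup>2" using that s by (intro power_mono) auto
    moreover have "\<tau>\<^sup>2 < 1" using assms T by (intro sq_less_1) auto
    ultimately show ?thesis unfolding R_s by (intro frac_le) auto
  qed
  then show "bend e \<tau> = 0 \<or> R\<^sup>2 \<le> \<tau>\<^sup>2 / (1 - \<tau>\<^sup>2)" by (auto simp: bend_def)
qed

lemma sq_bounds: "0 < \<tau> \<Longrightarrow> \<tau> \<le> T \<Longrightarrow> 0 < \<tau>\<^sup>2 \<and> \<tau>\<^sup>2 < 1"
  using T sq_less_1[of \<tau>] by simp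

lemma s_cap: "1 / R < cmod w \<longleftrightarrow> 1 / fs w < s"
proof -
  have s1: "0 < s\<^sup>2" "s\<^sup>2 < 1" using s T sq_less_1[of s] by auto
  have "cmod w \<le> 1 / R \<longleftrightarrow> (cmod w)\<^sup>2 \<le> (1 / R)\<^sup>2"
    using R by (intro power2_le_iff_abs_le[THEN trans, symmetric]) auto
  also have "(1 / R)\<^sup>2 = (1 - s\<^sup>2) / s\<^sup>2" unfolding power_divide R_s by simp
  also have "(cmod w)\<^sup>2 \<le> (1 - s\<^sup>2) / s\<^sup>2 \<longleftrightarrow> w \<in> cap (s\<^sup>2)" by (simp add: cap_def)
  also have "\<dots> \<longleftrightarrow> s \<le> 1 / fs w" by (rule mem_cap_iff[OF s(1)])
  finally show ?thesis by (simp flip: not_le)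
qed

text \<open>Half of \<open>slope\<close> at \<open>s\<close> equals \<open>ln (R * cmod w)\<close>,
  so the potential-theoretic bound on \<open>V\<close> is literally the hypothesis of
  \<open>curve_profile\<close>.\<close>

lemma profile:
  assumes w: "w \<noteq> 0" and v: "1 / fs w < s \<Longrightarrow> v \<le> ln (R * cmod w)" "s \<le> 1 / fs w \<Longrightarrow> v = 0"
  shows "curve_profile ((cmod w)\<^sup>2) (1 / fs w) s v"
proof
  have w1: "0 < 1 + (cmod w)\<^sup>2" by (simp add: add_pos_nonneg)
  show "0 < (cmod w)\<^sup>2" using w by simp
  show "0 < 1 / fs w" by simp
  have "1 < fs w" using w by (simp add: fs_def)
  then show "1 / fs w < 1" by simp
  show "(1 / fs w)\<^sup>2 = 1 / (1 + (cmod w)\<^sup>2)" using w1 by (simp add: fs_def power_divide)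
  show "0 < s" "s < 1" using s T by auto
  show "v = 0" if "s \<le> 1 / fs w" by (rule v(2)[OF that])
  show "v \<le> 1 / 2 * slope ((cmod w)\<^sup>2) s" if "1 / fs w < s"
  proof -
    have s1: "0 < s\<^sup>2" "0 < 1 - s\<^sup>2" using s T sq_less_1[of s] by auto
    have "2 * ln R = ln (R\<^sup>2)" using R by (simp add: ln_realpow)
    also have "\<dots> = ln (s\<^sup>2) - ln (1 - s\<^sup>2)" unfolding R_s using s1 by (simp only: ln_divide_pos)
    finally have "slope ((cmod w)\<^sup>2) s = ln ((cmod w)\<^sup>2) + 2 * ln R" by (simp only: slope_def add_diff_eq)
    also have "ln ((cmod w)\<^sup>2) = 2 * ln (cmod w)" using w by (simp add: ln_realpow)
    finally have "1 / 2 * slope ((cmod w)\<^sup>2) s = ln R + ln (cmod w)" by simp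
    also have "\<dots> = ln (R * cmod w)" using R w by (simp add: ln_mult)
    finally show ?thesis using v(1)[OF that] by (simp only:)
  qed
qed

lemma cap_potential_branch:
  assumes "0 < \<tau>"
  shows "cap_potential (\<tau>\<^sup>2) (Some w) = ereal (if \<tau> \<le> 1 / fs w then 0 else cap_branch ((cmod w)\<^sup>2) \<tau>)"
  using mem_cap_iff[OF assms, of w] by (simp add: cap_potential_def cap_branch_def)

text \<open>Where \<open>V\<close> is minus infinity the perturbed curve stops at \<open>s\<close>
  instead of \<open>T\<close>. It is then an unperturbed profile, with \<open>v = 0\<close>, cut off
  earlier.\<close>

lemma curve_Some:
  assumes e: "e \<in> {0, 1}" and w: "w \<noteq> 0"
  obtains v b where "b \<in> {s, T}" "curve_profile ((cmod w)\<^sup>2) (1 / fs w) s v"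
    "(\<lambda>\<tau>. curve e \<tau> (Some w)) = (\<lambda>\<tau>. if \<tau> \<le> b then ereal (curve_profile.g ((cmod w)\<^sup>2) (1 / fs w) s v \<tau>) else -\<infinity>)"
proof (cases "e = 1 \<and> V (Some w) = -\<infinity>")
  case True
  have sT: "s < T" by (rule s(2))
  have P: "curve_profile ((cmod w)\<^sup>2) (1 / fs w) s 0"
  proof (rule profile[OF w])
    assume "1 / fs w < s"
    then have "1 < R * cmod w" using s_cap[of w] R by (simp add: field_simps)
    then show "0 \<le> ln (R * cmod w)" by simp
  qed simp
  interpret curve_profile "(cmod w)\<^sup>2" "1 / fs w" s 0 by (rule P)
  have "curve e \<tau> (Some w) = (if \<tau> \<le> s then ereal (g \<tau>) else -\<infinity>)" for \<tau>
  proof (cases "\<tau> \<le> 0")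
    case True
    then have "g \<tau> = 0" using t(1) by (intro g_eq_0) linarith
    then show ?thesis using True s by (simp add: curve_def)
  next
    case False
    then have c: "cap_potential (\<tau>\<^sup>2) (Some w) = ereal (g \<tau>)"
      using cap_potential_branch[of \<tau> w] by (simp add: g_def)
    show ?thesis
    proof (cases "\<tau> \<le> s")
      case True
      then have "\<tau> \<le> T" using sT by linarith
      then show ?thesis using True False c by (simp add: curve_def bend_def perturbed_def flip: zero_ereal_def)
    next
      case gt: False
      \<comment> \<open>Past \<open>s\<close> the coefficient is positive, so the product is minus
        infinity and not 0.\<close>
      then have "ereal (bend e \<tau>) * V (Some w) = -\<infinity>" using True by (simp add: bend_def)
      from this c have "perturbed (\<tau>\<^sup>2) (bend e \<tau>) (Some w) = -\<infinity>"
        unfolding perturbed_def by (simp only:) simp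
      then show ?thesis using False gt by (simp add: curve_def)
    qed
  qed
  then show thesis using that[of s 0] P by blast
next
  case False
  have sT: "s < T" by (rule s(2))
  define v where "v = (if e = 0 then 0 else real_of_ereal (V (Some w)))"
  have V: "ereal x * V (Some w) = ereal (x * real_of_ereal (V (Some w)))" if "e = 1" for x
    using False that V_less_top[of "Some w"] by (cases "V (Some w)") auto
  have P: "curve_profile ((cmod w)\<^sup>2) (1 / fs w) s v"
  proof (rule profile[OF w])
    assume "1 / fs w < s"
    then have le: "1 / R < cmod w" using s_cap[of w] by simp
    then have "V (Some w) \<le> ereal (ln (R * cmod w))" by (intro V_Some_le) simp
    moreover have "1 < R * cmod w" using le R by (simp add: field_simps)
    then have "0 \<le> ln (R * cmod w)" by simp
    ultimately show "v \<le> ln (R * cmod w)"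
      unfolding v_def by (cases "V (Some w)") auto
  next
    assume "s \<le> 1 / fs w"
    then have "cmod w \<le> 1 / R" using s_cap[of w] by simp
    then show "v = 0" by (simp add: v_def V_Some_eq_0)
  qed
  interpret curve_profile "(cmod w)\<^sup>2" "1 / fs w" s v by (rule P)
  have "curve e \<tau> (Some w) = (if \<tau> \<le> T then ereal (g \<tau>) else -\<infinity>)" for \<tau>
  proof (cases "\<tau> \<le> 0")
    case True
    then have "g \<tau> = 0" using t(1) by (intro g_eq_0) linarith
    then show ?thesis using True s sT by (simp add: curve_def)
  next
    case False
    have "perturbed (\<tau>\<^sup>2) (bend e \<tau>) (Some w) = ereal (g \<tau>)"
    proof (cases "e = 0")
      case True
      have "g \<tau> = (if \<tau> \<le> 1 / fs w then 0 else cap_branch ((cmod w)\<^sup>2) \<tau>)"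
        unfolding g_def using True by (simp add: v_def)
      then show ?thesis using True cap_potential_branch[of \<tau> w] False
        by (simp add: bend_def perturbed_0)
    next
      case e0: False
      then have "e = 1" using e by simp
      moreover have "g \<tau> = (if \<tau> \<le> 1 / fs w then 0 else cap_branch ((cmod w)\<^sup>2) \<tau>)
          + real_of_ereal (V (Some w)) * (if \<tau> \<le> s then 0 else (\<tau> - s)\<^sup>2)"
        unfolding g_def using e0 by (simp add: v_def)
      then have "g \<tau> = (if \<tau> \<le> 1 / fs w then 0 else cap_branch ((cmod w)\<^sup>2) \<tau>) + bend e \<tau> * real_of_ereal (V (Some w))"
        using \<open>e = 1\<close> by (simp add: bend_def)
      moreover have "cap_potential (\<tau>\<^sup>2) (Some w) = ereal (if \<tau> \<le> 1 / fs w then 0 else cap_branch ((cmod w)\<^sup>2) \<tau>)"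
        using False by (intro cap_potential_branch) simp
      ultimately show ?thesis unfolding perturbed_def V[OF \<open>e = 1\<close>] by (simp only: plus_ereal.simps)
    qed
    then show ?thesis using False by (simp add: curve_def)
  qed
  then show thesis using that[of T v] P by blast
qed

lemma const_test_curve:
  fixes b :: real
  assumes "f = (\<lambda>\<tau>. if \<tau> \<le> b then 0 else -\<infinity>)"
  shows "usc euclidean f \<and> ext_concave f \<and> antimono f"
  by (rule cutoff_test_curve[where g="\<lambda>_. 0" and b=b])
    (auto simp: assms zero_ereal_def concave_on_def monotone_on_def convex_on_const)

lemma curve_regular:
  assumes e: "e \<in> {0, 1}"
  shows "usc euclidean (\<lambda>\<tau>. curve e \<tau> x) \<and> ext_concave (\<lambda>\<tau>. curve e \<tau> x) \<and> antimono (\<lambda>\<tau>. curve e \<tau> x)"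
proof (cases x)
  \<comment> \<open>At infinity every cap potential is minus infinity, so the curve is 0 up to
    parameter 0 and minus infinity afterwards.\<close>
  case None
  show ?thesis unfolding None
    by (rule const_test_curve[of _ 0]) (auto simp: curve_def perturbed_def cap_potential_def V_def)
next
  case (Some w)
  show ?thesis
  proof (cases "w = 0")
    case True
    have V0: "V (Some 0) = 0" using R by (intro V_Some_eq_0) simp
    have c: "cap_potential (\<tau>\<^sup>2) (Some 0) = 0" if "0 < \<tau>" "\<tau> \<le> T" for \<tau>
      using sq_bounds[OF that] by (simp add: cap_potential_def cap_def)
    show ?thesis unfolding Some True
      by (rule const_test_curve[of _ T]) (use s c in \<open>auto simp: curve_def perturbed_def V0 fun_eq_iff\<close>)
  next
    case False
    obtain v b where vb: "b \<in> {s, T}" "curve_profile ((cmod w)\<^sup>2) (1 / fs w) s v"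
      "(\<lambda>\<tau>. curve e \<tau> (Some w)) = (\<lambda>\<tau>. if \<tau> \<le> b then ereal (curve_profile.g ((cmod w)\<^sup>2) (1 / fs w) s v \<tau>) else -\<infinity>)"
      using curve_Some[OF e False] by metis
    show ?thesis unfolding Some using vb(1) s T by (intro curve_profile.cutoff[OF vb(2) _ vb(3)]) auto
  qed
qed

text \<open>The curve decreases and starts at 0; no separate estimate of the perturbation is
  needed.\<close>

lemma curve_nonpos: "e \<in> {0, 1} \<Longrightarrow> curve e \<tau> x \<le> 0"
proof -
  assume "e \<in> {0, 1}"
  then have "antimono (\<lambda>\<tau>. curve e \<tau> x)" using curve_regular by blast
  then have "curve e \<tau> x \<le> curve e (min \<tau> 0) x" by (simp add: antimono_def)
  then show ?thesis by (simp add: curve_def split: if_splits)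
qed

lemma curve_perturbed: "0 < \<tau> \<Longrightarrow> \<tau> \<le> T \<Longrightarrow> curve e \<tau> = perturbed (\<tau>\<^sup>2) (bend e \<tau>)"
  by (simp add: curve_def)

text \<open>On the cap this is the vanishing of \<open>V\<close>. Off the cap the parameter has
  passed \<open>1 / fs w\<close>, so the value is either strictly negative by \<open>g_neg\<close>
  or minus infinity.\<close>

lemma curve_zero_set:
  assumes e: "e \<in> {0, 1}" and \<tau>: "0 < \<tau>" "\<tau> \<le> T"
  shows "{x. curve e \<tau> x = 0} = Some ` cap (\<tau>\<^sup>2)"
proof (intro set_eqI)
  fix x
  note b = bend_bounds[OF e \<tau>]
  have \<tau>2: "0 < \<tau>\<^sup>2" "\<tau>\<^sup>2 < 1" using sq_bounds[OF \<tau>] by auto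
  show "x \<in> {x. curve e \<tau> x = 0} \<longleftrightarrow> x \<in> Some ` cap (\<tau>\<^sup>2)"
  proof (cases x)
    case None
    then show ?thesis using \<tau> by (auto simp: curve_perturbed perturbed_def cap_potential_def V_def)
  next
    case (Some w)
    show ?thesis
    proof (cases "w \<in> cap (\<tau>\<^sup>2)")
      case True
      then show ?thesis using Some \<tau> perturbed_cap[OF \<tau>2 b(3)] by (simp add: curve_perturbed)
    next
      case False
      then have w0: "w \<noteq> 0" using \<tau>2 by (auto simp: cap_def)
      obtain v b where vb: "b \<in> {s, T}" "curve_profile ((cmod w)\<^sup>2) (1 / fs w) s v"
        "(\<lambda>\<tau>. curve e \<tau> (Some w)) = (\<lambda>\<tau>. if \<tau> \<le> b then ereal (curve_profile.g ((cmod w)\<^sup>2) (1 / fs w) s v \<tau>) else -\<infinity>)"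
        using curve_Some[OF e w0] by metis
      have "curve_profile.g ((cmod w)\<^sup>2) (1 / fs w) s v \<tau> < 0"
        using False mem_cap_iff[OF \<tau>(1), of w] \<tau> T by (intro curve_profile.g_neg[OF vb(2)]) auto
      then have "curve e \<tau> (Some w) \<noteq> 0"
        using fun_cong[OF vb(3), of \<tau>] by (auto simp: zero_ereal_def split: if_splits)
      then show ?thesis using Some False by auto
    qed
  qed
qed

lemma curve_model:
  assumes e: "e \<in> {0, 1}" and \<tau>: "\<tau> \<le> T"
  shows "model_potential (curve e \<tau>)"
proof (cases "\<tau> \<le> 0")
  case True
  then show ?thesis using zero_model by (simp add: curve_def)
next
  case False
  then have \<tau>0: "0 < \<tau>" by simp
  note b = bend_bounds[OF e \<tau>0 \<tau>]
  have "perturbed (\<tau>\<^sup>2) (bend e \<tau>) x \<le> 0" for x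
    using curve_nonpos[OF e, of \<tau> x] by (simp add: curve_perturbed[OF \<tau>0 \<tau>])
  then show ?thesis unfolding curve_perturbed[OF \<tau>0 \<tau>]
    using sq_bounds[OF \<tau>0 \<tau>] b by (intro perturbed_model) auto
qed

lemma curve_positive_mass:
  assumes e: "e \<in> {0, 1}" and \<tau>: "0 < \<tau>" "\<tau> \<le> T"
  shows "positive_mass (curve e \<tau>)"
proof -
  note b = bend_bounds[OF e \<tau>]
  have \<tau>2: "0 < \<tau>\<^sup>2" "\<tau>\<^sup>2 < 1" using sq_bounds[OF \<tau>] by auto
  show ?thesis unfolding curve_perturbed[OF \<tau>]
    by (rule perturbed_positive_mass[OF \<tau>2 b(1,2) perturbed_cap[OF \<tau>2 b(3)]])
qed

lemma curve_maximal:
  assumes e: "e \<in> {0, 1}"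
  shows "maximal_test_curve (curve e)"
  unfolding maximal_test_curve_def test_curve_def
proof (intro conjI allI impI)
  have "\<forall>\<^sub>F \<tau> in at_bot. \<tau> \<le> (0::real)" by (rule eventually_le_at_bot)
  then show "\<forall>\<^sub>F \<tau> in at_bot. curve e \<tau> = (\<lambda>_. 0)" by eventually_elim (simp add: curve_def)
  have "\<forall>\<^sub>F \<tau> in at_top. T < \<tau>" by (rule eventually_gt_at_top)
  then show "\<forall>\<^sub>F \<tau> in at_top. curve e \<tau> = (\<lambda>_. -\<infinity>)"
    by (rule eventually_mono) (use s in \<open>simp add: curve_def\<close>)
  fix \<tau>
  have *: "model_potential (curve e \<tau>) \<or> curve e \<tau> = (\<lambda>_. -\<infinity>)"
    using curve_model[OF e, of \<tau>] s by (cases "\<tau> \<le> T") (auto simp: curve_def)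
  then show "curve e \<tau> \<in> PSH \<union> {\<lambda>_. -\<infinity>}" by (auto simp: model_potential_def normalized_def)
  show "model_potential (curve e \<tau>)" if "curve e \<tau> \<noteq> (\<lambda>_. -\<infinity>)" using * that by simp
qed (use curve_regular[OF e] in blast)+

lemma curves_differ:
  assumes \<tau>: "s < \<tau>" "\<tau> \<le> T"
  shows "curve 0 \<tau> \<noteq> curve 1 \<tau>"
proof
  assume eq: "curve 0 \<tau> = curve 1 \<tau>"
  \<comment> \<open>At an atom of positive weight the perturbed curve is minus infinity, whereas cap
    potentials are finite at all affine points.\<close>
  obtain k where k: "0 < \<alpha> k" using exists_positive_weight by blast
  let ?x = "chart_inf (c k)"
  have \<tau>0: "0 < \<tau>" using \<tau> s by simp
  have x: "?x = Some (1 / c k)" using c_nonzero by (simp add: chart_inf_def)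
  have "curve 1 \<tau> ?x = -\<infinity>"
    using \<tau> cap_potential_branch[OF \<tau>0, of "1 / c k"] V_centre[OF k]
    by (simp add: curve_perturbed[OF \<tau>0 \<tau>(2)] perturbed_def bend_def x)
  moreover have "curve 0 \<tau> ?x \<noteq> -\<infinity>"
    using cap_potential_branch[OF \<tau>0, of "1 / c k"]
    by (simp add: curve_perturbed[OF \<tau>0 \<tau>(2)] perturbed_0 bend_def x)
  ultimately show False using eq by simp
qed

end

theorem proposition5p1:
  shows "\<exists>(\<delta>::real) (s\<^sub>0::real) (T::real) (\<epsilon>::real)
           (\<psi> :: real \<Rightarrow> cp1 \<Rightarrow> ereal) (\<theta> :: real \<Rightarrow> cp1 \<Rightarrow> ereal).
      0 < s\<^sub>0 \<and> 0 < T \<and> 0 < \<delta> \<and> \<delta> < s\<^sub>0\<^sup>2 \<and> s\<^sub>0\<^sup>2 < T\<^sup>2 \<and> T\<^sup>2 < 1 \<and> 0 < \<epsilon> \<and>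
      maximal_test_curve \<psi> \<and> maximal_test_curve \<theta> \<and> \<psi> \<noteq> \<theta> \<and>
      (\<forall>\<tau>. {x. \<psi> \<tau> x = 0} = {x. \<theta> \<tau> x = 0}) \<and>
      (\<forall>\<tau>. \<tau> \<le> 0 \<longrightarrow> \<psi> \<tau> = (\<lambda>_. 0) \<and> \<theta> \<tau> = (\<lambda>_. 0)) \<and>
      (\<forall>\<tau>. 0 < \<tau> \<and> \<tau> \<le> T \<longrightarrow> \<psi> \<tau> = cap_potential (\<tau>\<^sup>2)) \<and>
      (\<forall>\<tau>. T < \<tau> \<longrightarrow> \<psi> \<tau> = (\<lambda>_. -\<infinity>) \<and> \<theta> \<tau> = (\<lambda>_. -\<infinity>)) \<and>
      (\<forall>\<tau>. 0 < \<tau> \<and> \<tau> \<le> s\<^sub>0 \<longrightarrow> \<theta> \<tau> = cap_potential (\<tau>\<^sup>2)) \<and>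
      (\<forall>\<tau>. s\<^sub>0 < \<tau> \<and> \<tau> \<le> T \<longrightarrow>
          model_potential (\<theta> \<tau>) \<and> positive_mass (\<theta> \<tau>) \<and>
          {x. \<theta> \<tau> x = 0} = {x. cap_potential (\<tau>\<^sup>2) x = 0} \<and>
          {x. cap_potential (\<tau>\<^sup>2) x = 0} = Some ` cap (\<tau>\<^sup>2)) \<and>
      (\<forall>x. usc euclidean (\<lambda>\<tau>. \<psi> \<tau> x) \<and> ext_concave (\<lambda>\<tau>. \<psi> \<tau> x) \<and> antimono (\<lambda>\<tau>. \<psi> \<tau> x)) \<and>
      (\<forall>x. usc euclidean (\<lambda>\<tau>. \<theta> \<tau> x) \<and> ext_concave (\<lambda>\<tau>. \<theta> \<tau> x) \<and> antimono (\<lambda>\<tau>. \<theta> \<tau> x)) \<and>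
      (\<forall>\<tau>. s\<^sub>0 < \<tau> \<and> \<tau> \<le> T \<longrightarrow> \<psi> \<tau> \<noteq> \<theta> \<tau>)"
proof -
  \<comment> \<open>The triple 3, 4, 5 makes everything rational: for s = 3/5 one has s^2 / (1 -
    s^2) = 9/16, so R = 3/4, and T = 4/5 lies between s and 1.\<close>
  obtain c :: "nat \<Rightarrow> complex" and r where "packing (3 / 4) c r"
    by (rule disc_packing[of "3 / 4"]) (auto simp: packing_def)
  then interpret packing "3 / 4" c r .
  interpret test_curves "3 / 4" c r "3 / 5" "4 / 5"
    by unfold_locales (auto simp: power2_eq_square)
  have ne: "curve 0 \<noteq> curve 1" using curves_differ[of "4 / 5"] by auto
  have zero: "{x. curve 0 \<tau> x = 0} = {x. curve 1 \<tau> x = 0}" for \<tau>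
    using curve_zero_set[of 0 \<tau>] curve_zero_set[of 1 \<tau>]
    by (cases "\<tau> \<le> 0"; cases "\<tau> \<le> 4 / 5") (auto simp: curve_def)
  have cap0: "curve 0 \<tau> = cap_potential (\<tau>\<^sup>2)" if "0 < \<tau>" "\<tau> \<le> 4 / 5" for \<tau>
    using that by (simp add: curve_def bend_def perturbed_0 fun_eq_iff)
  have cap1: "curve 1 \<tau> = cap_potential (\<tau>\<^sup>2)" if "0 < \<tau>" "\<tau> \<le> 3 / 5" for \<tau>
    using that by (simp add: curve_def bend_def perturbed_0 fun_eq_iff)
  have mid: "model_potential (curve 1 \<tau>) \<and> positive_mass (curve 1 \<tau>) \<and>
      {x. curve 1 \<tau> x = 0} = {x. cap_potential (\<tau>\<^sup>2) x = 0} \<and>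
      {x. cap_potential (\<tau>\<^sup>2) x = 0} = Some ` cap (\<tau>\<^sup>2)" if "3 / 5 < \<tau>" "\<tau> \<le> 4 / 5" for \<tau>
    using that curve_model[of 1 \<tau>] curve_positive_mass[of 1 \<tau>] curve_zero_set[of 1 \<tau>]
      curve_zero_set[of 0 \<tau>] cap0[of \<tau>] by simp
  show ?thesis
    \<comment> \<open>The first witness satisfies 1/5 < 9/25, the square of 3/5.\<close>
    by (intro exI[of _ "1 / 5"] exI[of _ "3 / 5"] exI[of _ "4 / 5"] exI[of _ 1] exI[of _ "curve 0"] exI[of _ "curve 1"])
      (use ne zero cap0 cap1 mid curve_maximal curve_regular curves_differ in
        \<open>auto simp: curve_def power2_eq_square\<close>)
qed

end
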